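(* Let $(\mathcal{P}_n)_{n\ge1}$ be a good sequence of configurations of polygons and let $\epsilon_n\in\{\mathrm{even},\mathrm{odd}\}$ be the parity of $n+\#\mathcal{P}_n$. Let $\#\mathbf{V}_{\mathcal{P}_n}$ be the number of vertices of the random surface obtained by the uniform labeling and gluing of the sides of the polygons of $\mathcal{P}_n$. Then $$\mathrm{d_{TV}}\left(\#\mathbf{V}_{\mathcal{P}_n},\ \mathrm{Poisson}^{\epsilon_n}_{\log n}\right)\longrightarrow 0\qquad\text{as } n\to\infty .$$
   Context: A configuration of polygons is a finite multiset $\mathcal{P}=\{p_1,\dots,p_k\}$ of positive integers with even sum. Write $\#\mathcal{P}=k$, $|\mathcal{P}|=\frac12\sum_i p_i$, $\mathsf{L}(\mathcal{P})=\#\{i:p_i=1\}$, $\mathsf{B}(\mathcal{P})=\#\{i:p_i=2\}$. A sequence $(\mathcal{P}_n)_{n\ge1}$ of configurations with $|\mathcal{P}_n|=n$ is good if $\mathsf{L}(\mathcal{P}_n)/\sqrt n\to0$ and $\mathsf{B}(\mathcal{P}_n)/n\to0$. Random gluing: given $\mathcal{P}$ with $|\mathcal{P}|=n$, take oriented polygons of perimeters $p_1,\dots,p_k$, label their sides by $1,\dots,2n$ uniformly at random, let $\phi$ be the permutation of $\{1,\dots,2n\}$ sending each side to the next one around its polygon, and let $\omega$ be an independent uniform involution without fixed points of $\{1,\dots,2n\}$. Glue side $i$ to side $\omega(i)$ for every $i$, respecting orientations (the end of $i$ is identified with the start of $\omega(i)$ and conversely). The vertices of the resulting surface are the cycles of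 $\phi\circ\omega$. For $\alpha>0$, $\mathrm{Poisson}^{\mathrm{odd}}_\alpha$ (resp. $\mathrm{Poisson}^{\mathrm{even}}_\alpha$) is a Poisson variable of parameter $\alpha$ conditioned on being odd (resp. even). $\mathrm{d_{TV}}$ is the total variation distance between laws. *)

theory Defs
  imports "HOL-Probability.Probability" "HOL-Combinatorics.Combinatorics"
begin

definition configuration :: "nat multiset \<Rightarrow> bool" where
  "configuration P \<longleftrightarrow> (\<forall>p\<in>#P. p > 0) \<and> even (\<Sum>\<^sub># P)"

definition half_perimeter :: "nat multiset \<Rightarrow> nat" where
  "half_perimeter P = \<Sum>\<^sub># P div 2"

definition loops :: "nat multiset \<Rightarrow> nat" where
  "loops P = count P 1"

definition bigons :: "nat multiset \<Rightarrow> nat" where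
  "bigons P = count P 2"

(* The value of the sequence at index 0 is not constrained and plays no role. *)
definition good_sequence :: "(nat \<Rightarrow> nat multiset) \<Rightarrow> bool" where
  "good_sequence \<P> \<longleftrightarrow>
     (\<forall>n\<ge>1. configuration (\<P> n) \<and> half_perimeter (\<P> n) = n) \<and>
     (\<lambda>n. real (loops (\<P> n)) / sqrt (real n)) \<longlonglongrightarrow> 0 \<and>
     (\<lambda>n. real (bigons (\<P> n)) / real n) \<longlonglongrightarrow> 0"

(* The triple (p, i, j) is the j-th side, in the cyclic order given by the orientation,
   of the i-th polygon of perimeter p; indices start from 0. *)
definition sides :: "nat multiset \<Rightarrow> (nat \<times> nat \<times> nat) set" where
  "sides P = {(p, i, j). i < count P p \<and> j < p}"

definition next_side :: "nat \<times> nat \<times> nat \<Rightarrow> nat \<times> nat \<times> nat" where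
  "next_side = (\<lambda>(p, i, j). (p, i, Suc j mod p))"

definition labels :: "nat \<Rightarrow> nat set" where
  "labels n = {1..2 * n}"

definition labelings :: "nat multiset \<Rightarrow> (nat \<times> nat \<times> nat \<Rightarrow> nat) set" where
  "labelings P = {l \<in> extensional (sides P). bij_betw l (sides P) (labels (half_perimeter P))}"

(* The permutation phi: next_side transported to the labels, and the identity
   outside the set of labels. *)
definition polygon_perm :: "nat multiset \<Rightarrow> (nat \<times> nat \<times> nat \<Rightarrow> nat) \<Rightarrow> nat \<Rightarrow> nat" where
  "polygon_perm P l = map_permutation (sides P) l next_side"

definition fixpoint_free_involutions :: "'a set \<Rightarrow> ('a \<Rightarrow> 'a) set" where
  "fixpoint_free_involutions A =
     {\<omega>. \<omega> permutes A \<and> (\<forall>i\<in>A. \<omega> (\<omega> i) = i \<and> \<omega> i \<noteq> i)}"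

(* Fixed points count as cycles of length one. *)
definition cycles_on :: "'a set \<Rightarrow> ('a \<Rightarrow> 'a) \<Rightarrow> 'a set set" where
  "cycles_on A f = orbit f ` A"

(* Since the end of side i is the start of side phi i, gluing i to omega i identifies the start
   of i with the start of phi (omega i); the vertices are thus the cycles of phi o omega. *)
definition glued_vertices ::
    "nat multiset \<Rightarrow> (nat \<times> nat \<times> nat \<Rightarrow> nat) \<Rightarrow> (nat \<Rightarrow> nat) \<Rightarrow> nat set set" where
  "glued_vertices P l \<omega> = cycles_on (labels (half_perimeter P)) (polygon_perm P l \<circ> \<omega>)"

definition vertex_count_pmf :: "nat multiset \<Rightarrow> nat pmf" where
  "vertex_count_pmf P =
     map_pmf (\<lambda>(l, \<omega>). card (glued_vertices P l \<omega>))
       (pair_pmf (pmf_of_set (labelings P))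
                 (pmf_of_set (fixpoint_free_involutions (labels (half_perimeter P)))))"

(* The rate is meant to be positive, as poisson_pmf is unspecified otherwise. *)
definition poisson_even_pmf :: "real \<Rightarrow> nat pmf" where
  "poisson_even_pmf \<alpha> = cond_pmf (poisson_pmf \<alpha>) {k. even k}"

definition poisson_odd_pmf :: "real \<Rightarrow> nat pmf" where
  "poisson_odd_pmf \<alpha> = cond_pmf (poisson_pmf \<alpha>) {k. odd k}"

definition tv_dist :: "'a pmf \<Rightarrow> 'a pmf \<Rightarrow> real" where
  "tv_dist p q = (SUP A. \<bar>measure_pmf.prob p A - measure_pmf.prob q A\<bar>)"

text \<open>
  The sets over which \<^const>\<open>pmf_of_set\<close> is taken above are finite and nonempty, so these are
  genuine uniform distributions.
\<close>

lemma sides_eq_Sigma: "sides P = (SIGMA p:set_mset P. {..<count P p} \<times> {..<p})"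
  by (auto simp: sides_def) (metis count_greater_zero_iff gr_zeroI not_less_zero)

lemma finite_sides: "finite (sides P)"
  by (simp add: sides_eq_Sigma)

lemma card_sides: "card (sides P) = \<Sum>\<^sub># P"
proof -
  have "(\<Sum>p\<in>A. count P p * p) = \<Sum>\<^sub># P" if "finite A" "set_mset P \<subseteq> A" for A
    using that(2)
  proof (induction P)
    case (add x P)
    have "(\<Sum>p\<in>A. count (add_mset x P) p * p) =
            (\<Sum>p\<in>A. count P p * p + (if p = x then p else 0))"
      by (rule sum.cong) auto
    with add that(1) show ?case by (simp add: sum.distrib)
  qed simp
  from this[of "set_mset P"] show ?thesis by (simp add: sides_eq_Sigma)
qed

lemma finite_labelings: "finite (labelings P)"
proof (rule finite_subset)
  show "labelings P \<subseteq> sides P \<rightarrow>\<^sub>E labels (half_perimeter P)"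
    by (auto simp: labelings_def PiE_def bij_betw_def)
  show "finite (sides P \<rightarrow>\<^sub>E labels (half_perimeter P))"
    by (intro finite_PiE) (auto simp: finite_sides labels_def)
qed

lemma labelings_nonempty:
  assumes "configuration P"
  shows "labelings P \<noteq> {}"
proof -
  have "card (sides P) = card (labels (half_perimeter P))"
    using assms by (simp add: card_sides labels_def half_perimeter_def configuration_def)
  then obtain l where l: "bij_betw l (sides P) (labels (half_perimeter P))"
    using finite_same_card_bij[OF finite_sides, of "labels (half_perimeter P)" P]
    by (auto simp: labels_def)
  then have "restrict l (sides P) \<in> labelings P"
    by (auto simp: labelings_def cong: bij_betw_cong)
  then show ?thesis by blast
qed

lemma finite_fixpoint_free_involutions:
  "finite A \<Longrightarrow> finite (fixpoint_free_involutions A)"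
  by (rule finite_subset[OF _ finite_permutations[of A]])
     (auto simp: fixpoint_free_involutions_def)

lemma fixpoint_free_involutions_nonempty:
  "fixpoint_free_involutions (labels n) \<noteq> {}"
proof -
  define \<omega> where
    "\<omega> i = (if i \<in> {1..2 * n} then if odd i then Suc i else i - 1 else i)" for i :: nat
  have range: "\<omega> i \<in> {1..2 * n}" if "i \<in> {1..2 * n}" for i
    using that unfolding \<omega>_def atLeastAtMost_iff by presburger
  have inv: "\<omega> (\<omega> i) = i" for i
    unfolding \<omega>_def atLeastAtMost_iff by presburger
  have "bij_betw \<omega> {1..2 * n} {1..2 * n}"
    by (rule bij_betw_byWitness[of _ \<omega>]) (use inv range in blast)+
  then have "\<omega> permutes labels n"
    unfolding labels_def by (rule bij_imp_permutes) (simp only: \<omega>_def if_False)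
  moreover have "\<omega> i \<noteq> i" if "i \<in> labels n" for i
    using that by (auto simp: \<omega>_def labels_def)
  ultimately have "\<omega> \<in> fixpoint_free_involutions (labels n)"
    by (simp add: fixpoint_free_involutions_def inv)
  then show ?thesis by blast
qed

end

theory Submission
  imports Defs "HOL-Real_Asymp.Real_Asymp"
begin

text \<open>
  Reveal the gluing one side at a time, always gluing a side of the smallest polygon. It is glued to
  another polygon, which merges the two, or to itself, which splits it; the latter has probability at
  most the inverse of the number \<open>k\<close> of polygons. Merging keeps \<open>m - k\<close> constant, where \<open>m\<close> is the half
  perimeter, so that on average the peeling ends with a single polygon of macroscopic perimeter after
  a bounded number of vertices have been closed. A potential function makes this an induction.

  For a single polygon of perimeter \<open>2 m\<close>, the mean \<open>G m g\<close> of \<open>g\<close> at the number of vertices satisfies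
  the Harer-Zagier recurrence \<open>(m + 1) G m g = 2 G (m - 1) (g \<circ> Suc) + (m - 1) G (m - 2) g\<close>. It comes
  from the peeling equations for \<open>g k = x ^ k\<close>, read as the equations for a linear functional on symmetric
  functions given on the products of power sums: the functional has a closed form on the products of
  a complete and an elementary symmetric function, and the power sums are combinations of these. The
  recurrence says that, when \<open>m\<close> grows by two, a vertex is added with probability about \<open>2 / m\<close>. Hence the
  law is close to that of a Poisson variable of rate \<open>ln m + O(1)\<close> with the parity of \<open>m + 1\<close>, and both a
  bounded change of the rate and a shift by one, up to the parity, change this law little.
\<close>

section \<open>Gluing two sides\<close>

text \<open>At a natural number N in place of \<open>x\<close>, the peeling equations are those of
  the mean, over a Gaussian Hermitian matrix M of size N, of the product of the traces of M ^ p over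
  the polygons. This explains why a polygon of perimeter 0 counts as a factor \<open>x\<close>, and
  it suggests symmetric functions of the eigenvalues; no matrix is used, though. The laws for small
  \<open>m\<close> are not close to Poisson laws, so the descent along the recurrence stops at a
  cutoff \<open>K\<close>: the errors above it telescope to order \<open>1 / K\<close>, and the
  vertices left below it cost order \<open>K / sqrt (ln n)\<close>. Hence \<open>K\<close> is fixed
  before \<open>n\<close> grows. Loops and bigons are the obstacle to the peeling. Loops are always
  the smallest polygons, and gluing two of them closes a vertex, so that l loops among order n sides
  close about \<open>l\<^sup>2 / n\<close> vertices in the mean; this is bounded for l up to order
  \<open>sqrt n\<close>. A bigon glued to a loop gives a loop back, and neither loops nor bigons
  contribute positively to \<open>m - k\<close>, which has to stay of order n for the last polygon
  to be macroscopic.\<close>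

lemma orbit_conjugate:
  assumes "a \<in> A" "\<And>a. a \<in> A \<Longrightarrow> f a \<in> A" "\<And>a. a \<in> A \<Longrightarrow> g (h a) = h (f a)"
  shows "orbit g (h a) = h ` orbit f a"
proof -
  have *: "(g ^^ n) (h a) = h ((f ^^ n) a) \<and> (f ^^ n) a \<in> A" for n
    by (induction n) (use assms in auto)
  show ?thesis
    unfolding orbit_altdef using * by (auto simp: image_iff)
qed

lemma orbit_subset_invariant:
  assumes "a \<in> A" "\<And>a. a \<in> A \<Longrightarrow> f a \<in> A"
  shows "orbit f a \<subseteq> A"
proof
  fix x assume "x \<in> orbit f a"
  then show "x \<in> A" by induction (use assms in auto)
qed

lemma card_cycles_on_conjugate:
  assumes h: "bij_betw h A B" and f: "\<And>a. a \<in> A \<Longrightarrow> f a \<in> A"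
    and g: "\<And>a. a \<in> A \<Longrightarrow> g (h a) = h (f a)"
  shows "card (cycles_on B g) = card (cycles_on A f)"
proof -
  have "cycles_on B g = (\<lambda>a. orbit g (h a)) ` A"
    using h by (auto simp: cycles_on_def bij_betw_def)
  also have "\<dots> = (`) h ` cycles_on A f"
    using orbit_conjugate[of _ A f g h] f g by (force simp: cycles_on_def)
  finally have "cycles_on B g = (`) h ` cycles_on A f" .
  moreover have "inj_on ((`) h) (cycles_on A f)"
    by (rule inj_on_subset[OF inj_on_image_Pow[of h A]])
       (use h orbit_subset_invariant[of _ A f] f in \<open>auto simp: bij_betw_def cycles_on_def\<close>)
  ultimately show ?thesis by (simp add: card_image)
qed

section \<open>Deleting a point from a permutation\<close>

text \<open>The first-return map of \<open>f\<close> to the complement of \<open>s\<close>, extended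
  by fixing \<open>s\<close>.\<close>

definition remove_point :: "'a \<Rightarrow> ('a \<Rightarrow> 'a) \<Rightarrow> 'a \<Rightarrow> 'a" where
  "remove_point s f y = (if y = s then s else if f y = s then f s else f y)"

lemma remove_point_permutes:
  assumes f: "f permutes A" and s: "s \<in> A"
  shows "remove_point s f permutes (A - {s})"
proof -
  have "remove_point s f = Transposition.transpose s (f s) \<circ> f"
    using inj_eq[OF permutes_inj[OF f]]
    by (auto simp: remove_point_def fun_eq_iff Transposition.transpose_def)
  moreover have "Transposition.transpose s (f s) \<circ> f permutes A"
    using f s by (intro permutes_compose permutes_swap_id) (auto simp: permutes_in_image)
  ultimately have "remove_point s f permutes A" by simp
  then show ?thesis
    by (rule permutes_superset) (auto simp: remove_point_def)
qed

lemma orbit_remove_point: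
  assumes f: "f permutes A" and fin: "finite A" and a: "a \<in> A" "a \<noteq> s"
  shows "orbit (remove_point s f) a = orbit f a - {s}"
proof
  let ?g = "remove_point s f"
  show "orbit ?g a \<subseteq> orbit f a - {s}"
  proof
    fix x assume "x \<in> orbit ?g a"
    then show "x \<in> orbit f a - {s}"
    proof induction
      case base
      show ?case using a orbit.base[of f] orbit.step[of _ f] inj_eq[OF permutes_inj[OF f]]
        by (auto simp: remove_point_def)
    next
      case (step x)
      then show ?case using orbit.base[of f] orbit.step[of _ f] inj_eq[OF permutes_inj[OF f]]
        by (auto simp: remove_point_def)
    qed
  qed
  show "orbit f a - {s} \<subseteq> orbit ?g a"
  proof
    fix x assume "x \<in> orbit f a - {s}"
    then have "x \<in> orbit f a" "x \<noteq> s" by auto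
    \<comment> \<open>The orbit may pass through \<open>s\<close>, which the orbit of
      \<open>remove_point s f\<close> avoids; there the induction carries the claim for the
      successor \<open>f s\<close> instead.\<close>
    moreover have "(x \<noteq> s \<longrightarrow> x \<in> orbit ?g a) \<and> (x = s \<longrightarrow> f s \<in> orbit ?g a \<or> f s = s)"
      if "x \<in> orbit f a" for x
      using that
    proof induction
      case base
      show ?case
        using a orbit.base[of ?g a] unfolding remove_point_def[of s f a] by (auto split: if_splits)
    next
      case (step x)
      show ?case
      proof (cases "x = s")
        case True
        then show ?thesis using step by auto
      next
        case False
        then have "x \<in> orbit ?g a" using step by auto
        from orbit.step[OF this] False show ?thesis
          unfolding remove_point_def[of s f x] by (auto split: if_splits)
      qed
    qed
    ultimately show "x \<in> orbit ?g a" by blast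
  qed
qed

text \<open>Two cycles that meet \<open>A - {s}\<close> and agree off \<open>s\<close> share a
  point, so deleting \<open>s\<close> is injective on them. The only cycle that can be lost is
  \<open>{s}\<close>.\<close>

lemma card_cycles_on_remove_point:
  assumes f: "f permutes A" and fin: "finite A" and s: "s \<in> A"
  shows "card (cycles_on A f) =
           card (cycles_on (A - {s}) (remove_point s f)) + (if f s = s then 1 else 0)"
proof -
  let ?g = "remove_point s f"
  have perm: "permutation f" using f fin by (auto simp: permutation_permutes)
  let ?C = "orbit f ` (A - {s})"
  have eq: "cycles_on (A - {s}) ?g = (\<lambda>C. C - {s}) ` ?C"
    using orbit_remove_point[OF f fin] by (force simp: cycles_on_def)
  have inj: "inj_on (\<lambda>C. C - {s}) ?C"
  proof (rule inj_onI)
    fix C D assume "C \<in> ?C" "D \<in> ?C" and CD: "C - {s} = D - {s}"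
    then obtain a b where ab: "a \<in> A" "b \<in> A" "a \<noteq> s" "b \<noteq> s" "C = orbit f a" "D = orbit f b"
      by auto
    moreover have "a \<in> orbit f a" using permutation_self_in_orbit[OF perm] .
    ultimately have "a \<in> orbit f b" using CD by blast
    then show "C = D"
      unfolding ab by (metis orbit_cyclic_eq3 cyclic_on_orbit' perm)
  qed
  have C: "card (cycles_on (A - {s}) ?g) = card ?C"
    unfolding eq by (rule card_image[OF inj])
  have A: "cycles_on A f = insert (orbit f s) ?C"
    using s by (auto simp: cycles_on_def)
  show ?thesis
  proof (cases "f s = s")
    case True
    then have o: "orbit f s = {s}" by (simp add: orbit_eq_singleton_iff)
    have "{s} \<notin> ?C"
    proof
      assume "{s} \<in> ?C"
      then obtain a where "a \<noteq> s" "orbit f a = {s}" by auto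
      with permutation_self_in_orbit[OF perm, of a] show False by auto
    qed
    then show ?thesis using True C A o fin by simp
  next
    case False
    have "f s \<in> A" using f s by (simp add: permutes_in_image)
    moreover have "orbit f (f s) = orbit f s"
      by (rule permutation_orbit_step[OF perm])
    ultimately have "orbit f s \<in> ?C" using False by (metis DiffI imageI singletonD)
    then have "cycles_on A f = ?C" using A by (simp add: insert_absorb)
    then show ?thesis using False C by simp
  qed
qed

section \<open>Sums over pairings, decomposed by the partner of one point\<close>

lemma fixpoint_free_involutions_iff:
  "\<omega> \<in> fixpoint_free_involutions A \<longleftrightarrow>
     (\<forall>i. i \<notin> A \<longrightarrow> \<omega> i = i) \<and> (\<forall>i\<in>A. \<omega> i \<in> A \<and> \<omega> (\<omega> i) = i \<and> \<omega> i \<noteq> i)" (is "?L \<longleftrightarrow> ?R")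
proof
  assume ?L then show ?R
    unfolding fixpoint_free_involutions_def by (auto simp: permutes_not_in permutes_in_image)
next
  assume R: ?R
  have "\<omega> permutes A"
    by (rule bij_imp_permutes, rule bij_betw_byWitness[of _ \<omega>]) (use R in auto)
  with R show ?L unfolding fixpoint_free_involutions_def by auto
qed

text \<open>This conditions on the partner \<open>t\<close> of \<open>s\<close>. Composing with the
  transposition removes the pair: the result fixes \<open>s\<close> and \<open>t\<close>, and
  involutions are the identity off their set, so it is an involution of the smaller set.\<close>

lemma sum_fixpoint_free_involutions_remove:
  fixes G :: "('a \<Rightarrow> 'a) \<Rightarrow> real"
  assumes s: "s \<in> A" and fin: "finite A"
  shows "(\<Sum>\<omega>\<in>fixpoint_free_involutions A. G \<omega>) =
    (\<Sum>t\<in>A - {s}. \<Sum>\<omega>\<in>fixpoint_free_involutions (A - {s, t}). G (\<omega> \<circ> Transposition.transpose s t))"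
proof -
  let ?I = fixpoint_free_involutions
  have fin_I: "finite (?I (A - {s, t}))" for t
    using fin by (intro finite_fixpoint_free_involutions) auto
  have "(\<Sum>t\<in>A - {s}. \<Sum>\<omega>\<in>?I (A - {s, t}). G (\<omega> \<circ> Transposition.transpose s t)) =
        (\<Sum>(t, \<omega>)\<in>(SIGMA t:A - {s}. ?I (A - {s, t})). G (\<omega> \<circ> Transposition.transpose s t))"
    by (rule sum.Sigma) (use fin fin_I in simp_all)
  also have "\<dots> = (\<Sum>\<omega>\<in>?I A. G \<omega>)"
  proof (rule sum.reindex_bij_witness[of _ "\<lambda>\<omega>. (\<omega> s, \<omega> \<circ> Transposition.transpose s (\<omega> s))"
          "\<lambda>(t, \<omega>). \<omega> \<circ> Transposition.transpose s t"])
    fix x assume x: "x \<in> (SIGMA t:A - {s}. ?I (A - {s, t}))"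
    obtain t \<omega> where t: "x = (t, \<omega>)" by force
    have w: "t \<in> A" "t \<noteq> s" "\<omega> t = t" "\<omega> s = s" "\<And>i. i \<notin> A \<Longrightarrow> \<omega> i = i"
      and w': "\<And>i. i \<in> A \<Longrightarrow> i \<noteq> s \<Longrightarrow> i \<noteq> t \<Longrightarrow> \<omega> i \<in> A - {s, t} \<and> \<omega> (\<omega> i) = i \<and> \<omega> i \<noteq> i"
      using x t by (auto simp: fixpoint_free_involutions_iff)
    show "(\<lambda>\<omega>. (\<omega> s, \<omega> \<circ> Transposition.transpose s (\<omega> s)))
        ((\<lambda>(t, \<omega>). \<omega> \<circ> Transposition.transpose s t) x) = x"
      unfolding t using w by (simp add: fun_eq_iff)
    let ?w = "\<omega> \<circ> Transposition.transpose s t"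
    have "?w i = i" if "i \<notin> A" for i
      using that w s by (metis comp_apply transpose_apply_other)
    moreover have "?w i \<in> A \<and> ?w (?w i) = i \<and> ?w i \<noteq> i" if "i \<in> A" for i
    proof (cases "i = s \<or> i = t")
      case True
      then show ?thesis using w s by auto
    next
      case False
      then show ?thesis using w'[OF that] by (simp add: transpose_apply_other)
    qed
    ultimately show "(\<lambda>(t, \<omega>). \<omega> \<circ> Transposition.transpose s t) x \<in> ?I A"
      unfolding t fixpoint_free_involutions_iff by simp
    show "G ((\<lambda>(t, \<omega>). \<omega> \<circ> Transposition.transpose s t) x) =
        (case x of (t, \<omega>) \<Rightarrow> G (\<omega> \<circ> Transposition.transpose s t))"
      by (simp add: t)
  next
    fix \<omega> assume "\<omega> \<in> ?I A"
    then have w: "\<omega> s \<in> A" "\<omega> s \<noteq> s" "\<omega> (\<omega> s) = s" "\<And>i. i \<notin> A \<Longrightarrow> \<omega> i = i"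
      and w': "\<And>i. i \<in> A \<Longrightarrow> \<omega> i \<in> A \<and> \<omega> (\<omega> i) = i \<and> \<omega> i \<noteq> i"
      using s by (auto simp: fixpoint_free_involutions_iff)
    let ?w = "\<omega> \<circ> Transposition.transpose s (\<omega> s)"
    show "(\<lambda>(t, \<omega>). \<omega> \<circ> Transposition.transpose s t) (\<omega> s, ?w) = \<omega>"
      by (simp add: fun_eq_iff)
    have "?w i = i" if "i \<notin> A - {s, \<omega> s}" for i
      using that w s by (metis DiffI comp_apply insertE singletonD transpose_apply_first
          transpose_apply_other transpose_apply_second)
    moreover have "?w i \<in> A - {s, \<omega> s} \<and> ?w (?w i) = i \<and> ?w i \<noteq> i" if i: "i \<in> A - {s, \<omega> s}" for i
    proof -
      have "\<omega> i \<noteq> s" "\<omega> i \<noteq> \<omega> s" using i w w' by (metis DiffD1 DiffD2 insertCI)+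
      then show ?thesis using w'[of i] i by (simp add: transpose_apply_other)
    qed
    ultimately show "(\<omega> s, ?w) \<in> (SIGMA t:A - {s}. ?I (A - {s, t}))"
      using w unfolding mem_Sigma_iff fixpoint_free_involutions_iff by blast
  qed
  finally show ?thesis by simp
qed

text \<open>\<open>z\<close> counts the vertices closed so far, so that the sum can be continued in
  the middle of a peeling.\<close>

definition gluing_sum :: "'a set \<Rightarrow> ('a \<Rightarrow> 'a) \<Rightarrow> nat \<Rightarrow> (nat \<Rightarrow> real) \<Rightarrow> real" where
  "gluing_sum A \<phi> z g = (\<Sum>\<omega>\<in>fixpoint_free_involutions A. g (card (cycles_on A (\<phi> \<circ> \<omega>)) + z))"

lemma map_permutation_apply:
  "inj_on h A \<Longrightarrow> a \<in> A \<Longrightarrow> map_permutation A h \<omega> (h a) = h (\<omega> a)"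
  by (simp add: map_permutation_def restrict_id_def)

lemma map_permutation_fixpoint_free_involution:
  assumes h: "bij_betw h A B" and w: "\<omega> \<in> fixpoint_free_involutions A"
  shows "map_permutation A h \<omega> \<in> fixpoint_free_involutions B"
proof -
  have inj: "inj_on h A" and B: "B = h ` A" using h by (auto simp: bij_betw_def)
  have "map_permutation A h \<omega> b = b" if "b \<notin> B" for b
    using that by (simp add: map_permutation_def restrict_id_def B)
  moreover have "map_permutation A h \<omega> b \<in> B \<and> map_permutation A h \<omega> (map_permutation A h \<omega> b) = b
      \<and> map_permutation A h \<omega> b \<noteq> b" if b: "b \<in> B" for b
  proof -
    obtain a where a: "a \<in> A" "b = h a" using b B by auto
    have "\<omega> a \<in> A" "\<omega> (\<omega> a) = a" "\<omega> a \<noteq> a"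
      using w a by (auto simp: fixpoint_free_involutions_iff)
    then show ?thesis using a inj B by (auto simp: map_permutation_apply inj_on_eq_iff)
  qed
  ultimately show ?thesis by (simp add: fixpoint_free_involutions_iff)
qed

lemma gluing_sum_conjugate:
  assumes h: "bij_betw h A B" and \<phi>: "\<And>a. a \<in> A \<Longrightarrow> \<phi> a \<in> A"
    and \<psi>: "\<And>a. a \<in> A \<Longrightarrow> \<psi> (h a) = h (\<phi> a)"
  shows "gluing_sum B \<psi> z g = gluing_sum A \<phi> z g"
proof -
  let ?I = fixpoint_free_involutions
  let ?k = "inv_into A h"
  have inj: "inj_on h A" and B: "B = h ` A" using h by (auto simp: bij_betw_def)
  have k: "bij_betw ?k B A" using h by (rule bij_betw_inv_into)
  show ?thesis unfolding gluing_sum_def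
  proof (rule sum.reindex_bij_witness[of _ "map_permutation A h" "map_permutation B ?k"])
    fix \<omega> assume w: "\<omega> \<in> ?I B"
    show "map_permutation B ?k \<omega> \<in> ?I A"
      by (rule map_permutation_fixpoint_free_involution[OF k w])
    let ?w = "map_permutation B ?k \<omega>"
    have wB: "\<omega> b \<in> B" if "b \<in> B" for b using w that by (auto simp: fixpoint_free_involutions_iff)
    have "?w a = ?k (\<omega> (h a))" if "a \<in> A" for a
      using map_permutation_apply[of ?k B "h a" \<omega>] k that B inj
      by (simp add: bij_betw_def)
    then have wa: "?w a \<in> A \<and> h (?w a) = \<omega> (h a)" if "a \<in> A" for a
      using that wB B by (simp add: f_inv_into_f inv_into_into)
    show "map_permutation A h ?w = \<omega>"
    proof
      fix b show "map_permutation A h ?w b = \<omega> b"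
      proof (cases "b \<in> B")
        case True
        then show ?thesis using B wa map_permutation_apply[OF inj] by auto
      next
        case False
        then show ?thesis using w B
          by (simp add: map_permutation_def restrict_id_def fixpoint_free_involutions_iff)
      qed
    qed
    have "card (cycles_on B (\<psi> \<circ> \<omega>)) = card (cycles_on A (\<phi> \<circ> ?w))"
      by (rule card_cycles_on_conjugate[OF h]) (use wa \<phi> \<psi> in \<open>auto simp flip: \<psi>\<close>)
    then show "g (card (cycles_on A (\<phi> \<circ> ?w)) + z) = g (card (cycles_on B (\<psi> \<circ> \<omega>)) + z)"
      by simp
  next
    fix \<omega> assume w: "\<omega> \<in> ?I A"
    show "map_permutation B ?k (map_permutation A h \<omega>) = \<omega>"
    proof
      fix a show "map_permutation B ?k (map_permutation A h \<omega>) a = \<omega> a"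
      proof (cases "a \<in> A")
        case True
        then have "?k (h a) = a" "h a \<in> B" "\<omega> a \<in> A"
          using B inj w by (auto simp: fixpoint_free_involutions_iff)
        then show ?thesis
          using map_permutation_apply[of ?k B "h a"] map_permutation_apply[OF inj, of a] True k inj
          by (simp add: bij_betw_def)
      next
        case False
        then show ?thesis using w k
          by (simp add: map_permutation_def restrict_id_def fixpoint_free_involutions_iff bij_betw_def)
      qed
    qed
    show "map_permutation A h \<omega> \<in> ?I B"
      by (rule map_permutation_fixpoint_free_involution[OF h w])
  qed
qed

section \<open>Permutations presented by lists of cycles\<close>

text \<open>Empty lists satisfy both conditions and may be repeated: they record polygons with no
  side left.\<close>

definition cycle_lists :: "('a \<Rightarrow> 'a) \<Rightarrow> 'a list list \<Rightarrow> bool" where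
  "cycle_lists \<phi> cs \<longleftrightarrow> distinct (concat cs) \<and> (\<forall>c\<in>set cs. map \<phi> c = rotate1 c)"

lemma cycle_lists_closed:
  assumes "cycle_lists \<phi> cs" "a \<in> set (concat cs)"
  shows "\<phi> a \<in> set (concat cs)"
proof -
  obtain c where c: "c \<in> set cs" "a \<in> set c" using assms by auto
  then have "\<phi> a \<in> set (rotate1 c)" using assms unfolding cycle_lists_def by (metis image_eqI list.set_map)
  then show ?thesis using c by auto
qed

lemma mset_concat_cong: "mset cs = mset ds \<Longrightarrow> mset (concat cs) = mset (concat ds)"
  by (metis mset_concat mset_map sum_mset_sum_list)

lemma cycle_lists_mset_cong:
  "mset cs = mset ds \<Longrightarrow> cycle_lists \<phi> cs \<longleftrightarrow> cycle_lists \<phi> ds"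
  unfolding cycle_lists_def
  using mset_concat_cong[of cs ds] mset_eq_imp_distinct_iff mset_eq_setD by metis

lemma ex_map_eq:
  assumes "mset (map f xs) = mset ys"
  shows "\<exists>xs'. mset xs' = mset xs \<and> map f xs' = ys"
  using assms
proof (induction ys arbitrary: xs)
  case (Cons y ys)
  have "y \<in> set (map f xs)" using Cons.prems by (metis list.set_intros(1) mset_eq_setD)
  then obtain x where x: "x \<in> set xs" "f x = y" by auto
  have "mset (map f (remove1 x xs)) = mset ys"
    using Cons.prems x by (simp add: image_mset_Diff)
  then obtain xs' where "mset xs' = mset (remove1 x xs)" "map f xs' = ys" using Cons.IH by blast
  then show ?case using x by (intro exI[of _ "x # xs'"]) simp
qed simp

lemma ex_fun_map_eq:
  assumes "distinct xs" "length xs = length ys"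
  shows "\<exists>h. map h xs = ys"
proof
  show "map (the \<circ> map_of (zip xs ys)) xs = ys"
    using assms by (intro nth_equalityI) (auto simp: map_of_zip_nth)
qed

text \<open>Permutations of the same cycle type are conjugate. The bijection sends each cycle to one
  of equal length in list order; it commutes with the permutations because both act on their lists
  as \<open>rotate1\<close>.\<close>

lemma gluing_sum_cycle_lists_cong:
  assumes cs: "cycle_lists \<phi> cs" and ds: "cycle_lists \<psi> ds"
    and len: "mset (map length cs) = mset (map length ds)"
  shows "gluing_sum (set (concat cs)) \<phi> z g = gluing_sum (set (concat ds)) \<psi> z g"
proof -
  obtain ds' where ds': "mset ds' = mset ds" "map length ds' = map length cs"
    using ex_map_eq[of length ds "map length cs"] len by auto
  have d: "distinct (concat ds')" and set_ds': "set ds' = set ds" "set (concat ds') = set (concat ds)"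
    using ds ds' mset_concat_cong mset_eq_imp_distinct_iff mset_eq_setD
    unfolding cycle_lists_def by metis+
  have "length (concat cs) = length (concat ds')" using ds' by (simp add: length_concat)
  then obtain h where h: "map h (concat cs) = concat ds'"
    using ex_fun_map_eq cs unfolding cycle_lists_def by blast
  have "length ds' = length cs" using ds'(2) by (metis length_map)
  then have maps: "map (map h) cs = ds'"
    using h ds'(2) by (intro concat_injective)
      (auto simp: map_concat in_set_zip list_eq_iff_nth_eq)
  have bij: "bij_betw h (set (concat cs)) (set (concat ds'))"
    using h d cs unfolding bij_betw_def cycle_lists_def by (metis distinct_map list.set_map)
  have "\<psi> (h a) = h (\<phi> a)" if a: "a \<in> set (concat cs)" for a
  proof -
    obtain c where c: "c \<in> set cs" "a \<in> set c" using a by auto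
    have "map h c \<in> set ds" unfolding set_ds'(1)[symmetric] maps[symmetric] using c(1) by simp
    then have "map \<psi> (map h c) = rotate1 (map h c)" "map \<phi> c = rotate1 c"
      using cs ds c(1) unfolding cycle_lists_def by blast+
    then have "map \<psi> (map h c) = map h (map \<phi> c)" by (metis rotate1_map)
    then show ?thesis using c by (simp add: map_eq_conv)
  qed
  then have "gluing_sum (set (concat ds')) \<psi> z g = gluing_sum (set (concat cs)) \<phi> z g"
    by (intro gluing_sum_conjugate[OF bij] cycle_lists_closed[OF cs])
  then show ?thesis by (simp only: set_ds')
qed

lemma cycle_lists_remove_point:
  assumes "cycle_lists \<phi> ((s # ys) # rs)"
  shows "cycle_lists (remove_point s \<phi>) (ys # rs)" "\<phi> s = s \<longleftrightarrow> ys = []"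
proof -
  have d: "s \<notin> set ys" "s \<notin> set (concat rs)" and m: "map \<phi> (s # ys) = ys @ [s]"
    and r: "\<And>c. c \<in> set rs \<Longrightarrow> map \<phi> c = rotate1 c" and dc: "distinct (concat (ys # rs))"
    using assms by (auto simp: cycle_lists_def)
  show "\<phi> s = s \<longleftrightarrow> ys = []" using m d by (cases ys) auto
  have "map (remove_point s \<phi>) ys = rotate1 ys"
  proof (cases ys)
    case (Cons y zs)
    have "map (remove_point s \<phi>) ys = map (\<lambda>v. if v = s then \<phi> s else v) (map \<phi> ys)"
      using d by (auto simp: remove_point_def)
    also have "\<phi> s = y" using m Cons by simp
    also have "map \<phi> ys = zs @ [s]" using m Cons by auto
    finally show ?thesis using d Cons by (auto intro: map_idI)
  qed simp
  moreover have "map (remove_point s \<phi>) c = rotate1 c" if "c \<in> set rs" for c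
  proof -
    have "map (remove_point s \<phi>) c = map \<phi> c"
    proof (rule map_cong[OF refl])
      fix a assume a: "a \<in> set c"
      then have "\<phi> a \<in> set c" using r[OF that] by (metis image_eqI list.set_map set_rotate1)
      then show "remove_point s \<phi> a = \<phi> a" using d that a by (auto simp: remove_point_def)
    qed
    then show ?thesis using r that by simp
  qed
  ultimately show "cycle_lists (remove_point s \<phi>) (ys # rs)" using dc by (simp add: cycle_lists_def)
qed

text \<open>The transposition exchanges the successors of \<open>s\<close> and \<open>t\<close>,
  which cuts their common cycle in two. On two distinct cycles the same surgery joins them, as in
  \<open>cycle_lists_merge\<close>.\<close>

lemma cycle_lists_split:
  assumes "cycle_lists \<phi> ((s # ys @ t # zs) # rs)"
  shows "cycle_lists (\<phi> \<circ> Transposition.transpose s t) ((s # zs) # (t # ys) # rs)"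
proof -
  let ?\<psi> = "\<phi> \<circ> Transposition.transpose s t"
  have d: "distinct (concat ((s # ys @ t # zs) # rs))"
    and m: "map \<phi> (s # ys) @ map \<phi> (t # zs) = (ys @ [t]) @ (zs @ [s])"
    and r: "\<And>c. c \<in> set rs \<Longrightarrow> map \<phi> c = rotate1 c"
    using assms by (auto simp: cycle_lists_def)
  have m': "map \<phi> (s # ys) = ys @ [t]" "map \<phi> (t # zs) = zs @ [s]"
    using m by (subst (asm) append_eq_append_conv, simp, blast)+
  have eq: "map ?\<psi> xs = map \<phi> xs" if "s \<notin> set xs" "t \<notin> set xs" for xs
    using that by (auto simp: Transposition.transpose_def)
  have "map ?\<psi> (t # ys) = map \<phi> (s # ys)" "map ?\<psi> (s # zs) = map \<phi> (t # zs)"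
    using d eq[of ys] eq[of zs] by auto
  then have "map ?\<psi> (t # ys) = rotate1 (t # ys)" "map ?\<psi> (s # zs) = rotate1 (s # zs)"
    unfolding m' by simp_all
  moreover have "map ?\<psi> c = rotate1 c" if "c \<in> set rs" for c
    using r[OF that] d that by (subst eq) auto
  ultimately have "\<forall>c\<in>set ((s # zs) # (t # ys) # rs). map ?\<psi> c = rotate1 c"
    by (metis set_ConsD)
  moreover have "distinct (concat ((s # zs) # (t # ys) # rs))" using d by auto
  ultimately show ?thesis unfolding cycle_lists_def by blast
qed

lemma cycle_lists_merge:
  assumes "cycle_lists \<phi> ((s # ys) # (t # zs) # rs)"
  shows "cycle_lists (\<phi> \<circ> Transposition.transpose s t) ((s # zs @ t # ys) # rs)"
proof -
  let ?\<psi> = "\<phi> \<circ> Transposition.transpose s t"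
  have d: "distinct (concat ((s # ys) # (t # zs) # rs))"
    and m: "map \<phi> (s # ys) = ys @ [s]" "map \<phi> (t # zs) = zs @ [t]"
    and r: "\<And>c. c \<in> set rs \<Longrightarrow> map \<phi> c = rotate1 c"
    using assms by (auto simp: cycle_lists_def)
  have eq: "map ?\<psi> xs = map \<phi> xs" if "s \<notin> set xs" "t \<notin> set xs" for xs
    using that by (auto simp: Transposition.transpose_def)
  have "map ?\<psi> (s # zs @ t # ys) = map \<phi> (t # zs) @ map \<phi> (s # ys)"
    using d eq[of ys] eq[of zs] by auto
  then have "map ?\<psi> (s # zs @ t # ys) = rotate1 (s # zs @ t # ys)"
    unfolding m by simp
  moreover have "map ?\<psi> c = rotate1 c" if "c \<in> set rs" for c
    using r[OF that] d that by (subst eq) auto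
  ultimately have "\<forall>c\<in>set ((s # zs @ t # ys) # rs). map ?\<psi> c = rotate1 c"
    by (metis set_ConsD)
  moreover have "distinct (concat ((s # zs @ t # ys) # rs))" using d by auto
  ultimately show ?thesis unfolding cycle_lists_def by blast
qed

lemma cycle_lists_rotate:
  assumes "cycle_lists \<phi> ((us @ t # vs) # rs)"
  shows "cycle_lists \<phi> ((t # vs @ us) # rs)"
proof -
  let ?c = "us @ t # vs"
  have "map \<phi> ?c = rotate1 ?c" using assms by (simp add: cycle_lists_def)
  then have "map \<phi> (rotate (length us) ?c) = rotate1 (rotate (length us) ?c)"
    by (metis rotate_map rotate1_rotate_swap)
  moreover have "rotate (length us) ?c = t # vs @ us" by (simp add: rotate_append)
  ultimately show ?thesis using assms by (auto simp: cycle_lists_def)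
qed

lemma ex_cycle_lists_sides:
  "\<exists>cs. cycle_lists next_side cs \<and> set (concat cs) = sides P \<and> mset (map length cs) = P"
proof (induction P)
  case empty
  show ?case by (intro exI[of _ "[]"]) (auto simp: cycle_lists_def sides_def)
next
  case (add p P)
  then obtain cs where cs: "cycle_lists next_side cs" "set (concat cs) = sides P" "mset (map length cs) = P"
    by blast
  let ?c = "map (\<lambda>j. (p, count P p, j)) [0..<p]"
  have "map next_side ?c = rotate1 ?c"
    by (rule nth_equalityI) (auto simp: next_side_def nth_rotate1)
  moreover have "set ?c \<inter> sides P = {}" by (auto simp: sides_def)
  moreover have "distinct ?c" by (auto simp: distinct_map inj_on_def)
  moreover have "set ?c \<union> sides P = sides (add_mset p P)"
    by (auto simp: sides_def image_iff split: if_splits)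
  ultimately show ?case using cs
    by (intro exI[of _ "?c # cs"]) (auto simp: cycle_lists_def)
qed

lemma cycle_lists_permutes:
  assumes cs: "cycle_lists \<phi> cs"
  shows "(\<lambda>a. if a \<in> set (concat cs) then \<phi> a else a) permutes set (concat cs)" (is "?\<phi> permutes ?A")
    and "cycle_lists (\<lambda>a. if a \<in> set (concat cs) then \<phi> a else a) cs"
proof -
  have "map (\<lambda>a. if a \<in> ?A then \<phi> a else a) c = map \<phi> c" if "c \<in> set cs" for c
    using that by auto
  then show "cycle_lists ?\<phi> cs" using cs unfolding cycle_lists_def by metis
  have "?A \<subseteq> \<phi> ` ?A"
  proof
    fix a assume "a \<in> ?A"
    then obtain c where "c \<in> set cs" "a \<in> set c" by auto
    then have "a \<in> \<phi> ` set c" using cs unfolding cycle_lists_def by (metis list.set_map set_rotate1)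
    then show "a \<in> \<phi> ` ?A" using \<open>c \<in> set cs\<close> by auto
  qed
  moreover have "\<phi> ` ?A \<subseteq> ?A" using cycle_lists_closed[OF cs] by blast
  ultimately have "\<phi> ` ?A = ?A" by blast
  then have "bij_betw \<phi> ?A ?A" by (simp add: bij_betw_def finite_surj_inj)
  then have "bij_betw ?\<phi> ?A ?A" by (subst bij_betw_cong[of _ _ \<phi>]) auto
  then show "?\<phi> permutes ?A"
    by (rule bij_imp_permutes) auto
qed

text \<open>A polygon of perimeter 0 stands for a vertex whose sides are all glued, so that gluing two sides of
  a configuration yields a configuration again.\<close>

definition vertex_sum :: "nat multiset \<Rightarrow> (nat \<Rightarrow> real) \<Rightarrow> real" where
  "vertex_sum P g = gluing_sum (sides P) next_side (count P 0) g"

lemma gluing_sum_eq_vertex_sum: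
  assumes cs: "cycle_lists \<phi> cs"
  shows "gluing_sum (set (concat cs)) \<phi> (count (mset (map length cs)) 0) g =
           vertex_sum (mset (map length cs)) g"
proof -
  obtain ds where ds: "cycle_lists next_side ds" "set (concat ds) = sides (mset (map length cs))"
     "mset (map length ds) = mset (map length cs)"
    using ex_cycle_lists_sides by blast
  show ?thesis
    unfolding vertex_sum_def ds(2)[symmetric]
    by (rule gluing_sum_cycle_lists_cong[OF cs ds(1)]) (use ds in simp)
qed

section \<open>Gluing one pair of sides and the peeling equation\<close>

text \<open>As \<open>\<omega>\<close> fixes \<open>s\<close> and \<open>t\<close>, it commutes with
  their transposition, which can thus be absorbed in the permutation of the polygons. For the same
  reason, deleting \<open>s\<close> and then \<open>t\<close> does not interfere with
  \<open>\<omega>\<close>; each deletion closes a vertex exactly when the deleted point is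
  fixed.\<close>

lemma gluing_sum_glue_pair:
  assumes \<phi>: "\<phi> permutes A" and fin: "finite A" and s: "s \<in> A" and t: "t \<in> A" "s \<noteq> t"
    and \<tau>: "\<tau> = \<phi> \<circ> Transposition.transpose s t" and \<psi>: "\<psi> = remove_point s \<tau>"
  shows "(\<Sum>\<omega>\<in>fixpoint_free_involutions (A - {s, t}).
            g (card (cycles_on A (\<phi> \<circ> (\<omega> \<circ> Transposition.transpose s t))) + z)) =
         gluing_sum (A - {s, t}) (remove_point t \<psi>)
           ((if \<tau> s = s then 1 else 0) + (if \<psi> t = t then 1 else 0) + z) g"
  unfolding gluing_sum_def
proof (rule sum.cong[OF refl])
  fix \<omega> assume w: "\<omega> \<in> fixpoint_free_involutions (A - {s, t})"
  then have ws: "\<omega> s = s" "\<omega> t = t" by (auto simp: fixpoint_free_involutions_iff)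
  have "\<omega> permutes (A - {s, t})" using w by (simp add: fixpoint_free_involutions_def)
  then have wA: "\<omega> permutes A" "\<omega> permutes (A - {s})" by (auto elim: permutes_subset)
  note inj = inj_eq[OF permutes_inj[OF wA(1)]]
  have ne: "\<omega> i = s \<longleftrightarrow> i = s" "\<omega> i = t \<longleftrightarrow> i = t" for i
    using inj[of i s] inj[of i t] ws by auto
  have \<tau>': "\<tau> permutes A" unfolding \<tau>
    by (intro permutes_compose permutes_swap_id s t \<phi>)
  have 1: "\<phi> \<circ> (\<omega> \<circ> Transposition.transpose s t) = \<tau> \<circ> \<omega>"
  proof
    fix i show "(\<phi> \<circ> (\<omega> \<circ> Transposition.transpose s t)) i = (\<tau> \<circ> \<omega>) i"
      unfolding \<tau> by (cases "i = s \<or> i = t") (auto simp: ws ne transpose_apply_other)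
  qed
  have 2: "remove_point s (\<tau> \<circ> \<omega>) = \<psi> \<circ> \<omega>"
    unfolding \<psi> by (auto simp: fun_eq_iff remove_point_def ws ne)
  have 3: "remove_point t (\<psi> \<circ> \<omega>) = remove_point t \<psi> \<circ> \<omega>"
    by (auto simp: fun_eq_iff remove_point_def ws ne)
  have \<psi>': "\<psi> permutes (A - {s})" unfolding \<psi> by (rule remove_point_permutes[OF \<tau>' s])
  have "card (cycles_on A (\<tau> \<circ> \<omega>)) = card (cycles_on (A - {s}) (\<psi> \<circ> \<omega>)) + (if \<tau> s = s then 1 else 0)"
    using card_cycles_on_remove_point[OF permutes_compose[OF wA(1) \<tau>'] fin s] ws by (simp add: 2)
  also have "card (cycles_on (A - {s}) (\<psi> \<circ> \<omega>)) =
      card (cycles_on (A - {s} - {t}) (remove_point t \<psi> \<circ> \<omega>)) + (if \<psi> t = t then 1 else 0)"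
    using card_cycles_on_remove_point[OF permutes_compose[OF wA(2) \<psi>'], of t] fin t ws by (simp add: 3)
  also have "A - {s} - {t} = A - {s, t}" by auto
  finally show "g (card (cycles_on A (\<phi> \<circ> (\<omega> \<circ> Transposition.transpose s t))) + z) =
     g (card (cycles_on (A - {s, t}) (remove_point t \<psi> \<circ> \<omega>)) +
         ((if \<tau> s = s then 1 else 0) + (if \<psi> t = t then 1 else 0) + z))"
    unfolding 1 by (intro arg_cong[of _ _ g]) linarith
qed

lemma glue_same_polygon:
  assumes \<phi>: "\<phi> permutes A" and cs: "cycle_lists \<phi> ((s # ys @ t # zs) # rs)"
    and A: "set (concat ((s # ys @ t # zs) # rs)) = A"
  shows "(\<Sum>\<omega>\<in>fixpoint_free_involutions (A - {s, t}).
            g (card (cycles_on A (\<phi> \<circ> (\<omega> \<circ> Transposition.transpose s t))) + count (mset (map length rs)) 0)) =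
         vertex_sum (add_mset (length ys) (add_mset (length zs) (mset (map length rs)))) g"
proof -
  define \<tau> where "\<tau> = \<phi> \<circ> Transposition.transpose s t"
  define \<psi> where "\<psi> = remove_point s \<tau>"
  have d: "distinct (concat ((s # ys @ t # zs) # rs))" using cs by (simp add: cycle_lists_def)
  have "cycle_lists \<tau> ((s # zs) # (t # ys) # rs)" unfolding \<tau>_def by (rule cycle_lists_split[OF cs])
  note r1 = cycle_lists_remove_point[OF this, folded \<psi>_def]
  have "cycle_lists \<psi> ((t # ys) # zs # rs)" using r1(1) by (subst cycle_lists_mset_cong) auto
  note r2 = cycle_lists_remove_point[OF this]
  have A': "A - {s, t} = set (concat (ys # zs # rs))" using A d by auto
  have "s \<in> A" "t \<in> A" "s \<noteq> t" "finite A" using A d by auto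
  note glue = gluing_sum_glue_pair[OF \<phi> this(4,1-3) \<tau>_def \<psi>_def, of g "count (mset (map length rs)) 0"]
  \<comment> \<open>A deleted fixed point leaves an empty list behind, so the closed vertex
    reappears as a polygon of perimeter 0.\<close>
  have z: "(if zs = [] then 1 else 0) + (if ys = [] then 1 else 0) + count (mset (map length rs)) 0 =
      count (mset (map length (ys # zs # rs))) 0" by simp
  show ?thesis
    unfolding glue r1(2) r2(2) z unfolding A' gluing_sum_eq_vertex_sum[OF r2(1)] by simp
qed

lemma glue_distinct_polygons:
  assumes \<phi>: "\<phi> permutes A" and cs: "cycle_lists \<phi> ((s # ys) # (t # zs) # rs)"
    and A: "set (concat ((s # ys) # (t # zs) # rs)) = A"
  shows "(\<Sum>\<omega>\<in>fixpoint_free_involutions (A - {s, t}).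
            g (card (cycles_on A (\<phi> \<circ> (\<omega> \<circ> Transposition.transpose s t))) + count (mset (map length rs)) 0)) =
         vertex_sum (add_mset (length ys + length zs) (mset (map length rs))) g"
proof -
  define \<tau> where "\<tau> = \<phi> \<circ> Transposition.transpose s t"
  define \<psi> where "\<psi> = remove_point s \<tau>"
  have d: "distinct (concat ((s # ys) # (t # zs) # rs))" using cs by (simp add: cycle_lists_def)
  have "cycle_lists \<tau> ((s # zs @ t # ys) # rs)" unfolding \<tau>_def by (rule cycle_lists_merge[OF cs])
  note r1 = cycle_lists_remove_point[OF this, folded \<psi>_def]
  have "cycle_lists \<psi> ((t # ys @ zs) # rs)" using cycle_lists_rotate[OF r1(1)] by simp
  note r2 = cycle_lists_remove_point[OF this]
  have A': "A - {s, t} = set (concat ((ys @ zs) # rs))" using A d by auto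
  have "s \<in> A" "t \<in> A" "s \<noteq> t" "finite A" using A d by auto
  note glue = gluing_sum_glue_pair[OF \<phi> this(4,1-3) \<tau>_def \<psi>_def, of g "count (mset (map length rs)) 0"]
  have z: "(if zs @ t # ys = [] then 1 else 0) + (if ys @ zs = [] then 1 else 0) + count (mset (map length rs)) 0 =
      count (mset (map length ((ys @ zs) # rs))) 0" by simp
  show ?thesis
    unfolding glue r1(2) r2(2) z unfolding A' gluing_sum_eq_vertex_sum[OF r2(1)] by simp
qed

lemma vertex_sum_empty [simp]: "vertex_sum {#} g = g 0"
proof -
  have "sides {#} = {}" by (auto simp: sides_def)
  moreover have "fixpoint_free_involutions {} = {id :: nat \<times> nat \<times> nat \<Rightarrow> _}"
    by (auto simp: fixpoint_free_involutions_iff)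
  ultimately show ?thesis by (simp add: vertex_sum_def gluing_sum_def cycles_on_def)
qed

lemma vertex_sum_zero: "vertex_sum (add_mset 0 P) g = vertex_sum P (\<lambda>k. g (Suc k))"
proof -
  have "sides (add_mset 0 P) = sides P" by (auto simp: sides_def split: if_splits)
  then show ?thesis by (simp add: vertex_sum_def gluing_sum_def)
qed

text \<open>\<open>d\<close> is the number of sides between the peeled side and its partner on the
  same polygon. On another polygon all \<open>q\<close> partners give the same configuration. The
  truncated \<open>p + q - 2\<close> is harmless for \<open>q = 0\<close>, where the weight is
  0.\<close>

lemma vertex_sum_peel:
  assumes "p \<ge> 1"
  shows "vertex_sum (add_mset p R) g =
           (\<Sum>d<p - 1. vertex_sum (add_mset d (add_mset (p - 2 - d) R)) g) +
           (\<Sum>q\<in>#R. real q * vertex_sum (add_mset (p + q - 2) (R - {#q#})) g)"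
proof -
  obtain cs' where cs': "cycle_lists next_side cs'" "mset (map length cs') = add_mset p R"
    using ex_cycle_lists_sides[of "add_mset p R"] by blast
  define A where "A = set (concat cs')"
  define \<phi> where "\<phi> = (\<lambda>a. if a \<in> A then next_side a else a)"
  have \<phi>: "\<phi> permutes A" and cyc': "cycle_lists \<phi> cs'"
    using cycle_lists_permutes[OF cs'(1)] by (auto simp: \<phi>_def A_def)
  have "p \<in> set (map length cs')" using cs'(2) by (metis mset_eq_setD set_mset_add_mset_insert insertI1 set_mset_mset)
  then obtain c where c: "c \<in> set cs'" "length c = p" by auto
  then obtain s xs where sxs: "c = s # xs" using assms by (cases c rule: list.exhaust) auto
  define rs where "rs = remove1 c cs'"
  have mset_cs: "mset cs' = mset (c # rs)" using c by (simp add: rs_def)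
  have cyc: "cycle_lists \<phi> ((s # xs) # rs)" using cyc' mset_cs sxs cycle_lists_mset_cong by metis
  have R: "mset (map length rs) = R" and xs: "length xs = p - 1"
    using cs'(2) c sxs mset_cs by auto
  have A: "A = set (concat ((s # xs) # rs))"
    unfolding A_def using mset_concat_cong[OF mset_cs] sxs by (metis mset_eq_setD)
  have d: "distinct (s # xs @ concat rs)" using cyc by (simp add: cycle_lists_def)
  let ?z = "count (add_mset p R) 0"
  have z: "?z = count R 0" using assms by simp
  define inner where "inner t = (\<Sum>\<omega>\<in>fixpoint_free_involutions (A - {s, t}).
            g (card (cycles_on A (\<phi> \<circ> (\<omega> \<circ> Transposition.transpose s t))) + count R 0))" for t
  have "vertex_sum (add_mset p R) g = gluing_sum A \<phi> (count R 0) g"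
    using gluing_sum_eq_vertex_sum[OF cyc', of g] cs'(2) z unfolding A_def by simp
  also have "\<dots> = (\<Sum>t\<in>A - {s}. inner t)"
    unfolding gluing_sum_def inner_def
    by (rule sum_fixpoint_free_involutions_remove) (auto simp: A)
  also have "A - {s} = set (xs @ concat rs)" using A d by auto
  also have "(\<Sum>t\<in>\<dots>. inner t) = sum_list (map inner (xs @ concat rs))"
    using d by (intro sum.distinct_set_conv_list) simp
  also have "\<dots> = sum_list (map inner xs) + sum_list (map (\<lambda>c. sum_list (map inner c)) rs)"
  proof -
    have "sum_list (concat ls) = sum_list (map sum_list ls)" for ls :: "real list list"
      by (induction ls) auto
    then show ?thesis by (simp add: map_concat comp_def)
  qed
  also have "sum_list (map inner xs) = (\<Sum>d<p - 1. inner (xs ! d))"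
    using xs by (simp add: sum_list_sum_nth atLeast0LessThan)
  also have "\<dots> = (\<Sum>d<p - 1. vertex_sum (add_mset d (add_mset (p - 2 - d) R)) g)"
  proof (rule sum.cong[OF refl])
    fix d assume "d \<in> {..<p - 1}"
    then have dl: "d < length xs" using xs by simp
    define ys zs where "ys = take d xs" and "zs = drop (Suc d) xs"
    have eq: "xs = ys @ xs ! d # zs" unfolding ys_def zs_def by (rule id_take_nth_drop[OF dl])
    have l: "length ys = d" "length zs = p - 2 - d" using dl xs by (auto simp: ys_def zs_def)
    have cyc2: "cycle_lists \<phi> ((s # ys @ xs ! d # zs) # rs)"
      and A2: "set (concat ((s # ys @ xs ! d # zs) # rs)) = A"
      unfolding eq[symmetric] using cyc A by simp_all
    show "inner (xs ! d) = vertex_sum (add_mset d (add_mset (p - 2 - d) R)) g"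
      using glue_same_polygon[OF \<phi> cyc2 A2, of g] unfolding inner_def R l .
  qed
  also have "sum_list (map (\<lambda>c. sum_list (map inner c)) rs) =
    sum_list (map (\<lambda>c. real (length c) * vertex_sum (add_mset (p + length c - 2) (R - {#length c#})) g) rs)"
  proof (rule arg_cong[of _ _ sum_list], rule map_cong[OF refl])
    fix c assume c: "c \<in> set rs"
    have "inner t = vertex_sum (add_mset (p + length c - 2) (R - {#length c#})) g" if t: "t \<in> set c" for t
    proof -
      obtain us vs where uv: "c = us @ t # vs" using t by (meson split_list)
      define rs' where "rs' = remove1 c rs"
      have m: "mset rs = mset (c # rs')" using c by (simp add: rs'_def)
      have "cycle_lists \<phi> (c # (s # xs) # rs')" using cyc m by (subst cycle_lists_mset_cong[of _ "(s # xs) # rs"]) auto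
      then have "cycle_lists \<phi> ((t # vs @ us) # (s # xs) # rs')" using cycle_lists_rotate uv by metis
      then have cyc2: "cycle_lists \<phi> ((s # xs) # (t # vs @ us) # rs')"
        by (subst cycle_lists_mset_cong[of _ "(t # vs @ us) # (s # xs) # rs'"]) auto
      have "set (concat rs) = set (concat (c # rs'))" using mset_concat_cong[OF m] by (metis mset_eq_setD)
      then have A2: "set (concat ((s # xs) # (t # vs @ us) # rs')) = A" unfolding A uv by auto
      have R': "R = add_mset (length c) (mset (map length rs'))" using R m by (metis mset_map image_mset_add_mset mset.simps(2))
      have "length c > 0" using uv by simp
      then have "count (mset (map length rs')) 0 = count R 0" "mset (map length rs') = R - {#length c#}"
        "length xs + length (vs @ us) = p + length c - 2"
        using R' uv xs assms by auto
      then show ?thesis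
        using glue_distinct_polygons[OF \<phi> cyc2 A2, of g] unfolding inner_def by simp
    qed
    then have "map inner c = map (\<lambda>t. vertex_sum (add_mset (p + length c - 2) (R - {#length c#})) g) c"
      by simp
    then show "sum_list (map inner c) = real (length c) * vertex_sum (add_mset (p + length c - 2) (R - {#length c#})) g"
      by (simp add: map_replicate_const sum_list_replicate)
  qed
  also have "\<dots> = (\<Sum>q\<in>#R. real q * vertex_sum (add_mset (p + q - 2) (R - {#q#})) g)"
    unfolding R[symmetric] by (simp add: sum_mset_sum_list[symmetric] image_mset.compositionality comp_def)
  finally show ?thesis .
qed

section \<open>Loop equations and the one-polygon surface\<close>

text \<open>Reading \<open>f\<close> as a linear functional on symmetric functions, given by its values at the products of
  power sums \<open>p_R\<close>, this is its composition with the multiplication by the complete symmetric function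
  \<open>h_i\<close> if \<open>c = 1\<close>, and by the elementary one \<open>e_i\<close> if \<open>c = - 1\<close>. The recursion is Newton's identity.\<close>

fun symmetric_op :: "real \<Rightarrow> nat \<Rightarrow> (nat multiset \<Rightarrow> real) \<Rightarrow> nat multiset \<Rightarrow> real" where
  "symmetric_op c 0 f R = f R"
| "symmetric_op c (Suc i) f R =
     (\<Sum>q\<le>i. c ^ q * symmetric_op c (i - q) f (add_mset (Suc q) R)) / real (Suc i)"

lemma symmetric_op_Suc_mult:
  "real (Suc i) * symmetric_op c (Suc i) f R =
     (\<Sum>q\<le>i. c ^ q * symmetric_op c (i - q) f (add_mset (Suc q) R))"
  by (simp del: of_nat_Suc)

declare symmetric_op.simps(2) [simp del]

lemma symmetric_op_linear:
  "symmetric_op c i (\<lambda>R. a * f R + b * g R) R = a * symmetric_op c i f R + b * symmetric_op c i g R"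
proof (induction i arbitrary: R rule: less_induct)
  case (less i)
  show ?case
  proof (cases i)
    case (Suc n)
    have IH: "symmetric_op c (n - q) (\<lambda>R. a * f R + b * g R) R =
       a * symmetric_op c (n - q) f R + b * symmetric_op c (n - q) g R" for q R
      by (rule less) (simp add: Suc)
    show ?thesis
      unfolding Suc symmetric_op.simps IH
      by (simp add: sum.distrib sum_distrib_left algebra_simps add_divide_distrib sum_divide_distrib)
  qed simp
qed

lemma symmetric_op_zero: "symmetric_op c i (\<lambda>R. 0) R = 0"
  using symmetric_op_linear[of c i 0 "\<lambda>R. 0" 0 "\<lambda>R. 0"] by simp

lemma symmetric_op_add: "symmetric_op c i (\<lambda>R. f R + g R) R = symmetric_op c i f R + symmetric_op c i g R"
  using symmetric_op_linear[of c i 1 f 1 g] by simp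

lemma symmetric_op_mult: "symmetric_op c i (\<lambda>R. a * f R) R = a * symmetric_op c i f R"
  using symmetric_op_linear[of c i a f 0 f] by simp

lemma symmetric_op_sum:
  "symmetric_op c i (\<lambda>R. \<Sum>j\<in>J. f j R) R = (\<Sum>j\<in>J. symmetric_op c i (f j) R)"
proof (induction J rule: infinite_finite_induct)
  case (insert j J)
  then show ?case by (simp add: symmetric_op_add)
qed (simp_all add: symmetric_op_zero)

text \<open>Multiplication by the power sum \<open>p_r\<close> commutes with multiplication by
  \<open>h_i\<close> or \<open>e_i\<close>.\<close>

lemma symmetric_op_append:
  "symmetric_op c i (\<lambda>R. f (add_mset r R)) R = symmetric_op c i f (add_mset r R)"
proof (induction i arbitrary: R rule: less_induct)
  case (less i)
  show ?case
  proof (cases i)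
    case (Suc n)
    have IH: "symmetric_op c (n - q) (\<lambda>R. f (add_mset r R)) R = symmetric_op c (n - q) f (add_mset r R)" for q R
      by (rule less) (simp add: Suc)
    show ?thesis unfolding Suc symmetric_op.simps IH by (simp add: add_mset_commute)
  qed simp
qed

lemma symmetric_op_zero_polygon:
  assumes "\<And>R. f (add_mset 0 R) = x * f R"
  shows "symmetric_op c i f (add_mset 0 R) = x * symmetric_op c i f R"
  using symmetric_op_append[of c i f 0] symmetric_op_mult[of c i x f] by (simp add: assms)

text \<open>Newton's identity, completed by a term \<open>q = 0\<close>: the power sum
  \<open>p_0\<close> takes the value \<open>x\<close>, as it would for \<open>x\<close>
  variables.\<close>

lemma symmetric_op_newton:
  assumes "\<And>R. f (add_mset 0 R) = x * f R"
  shows "(\<Sum>q\<le>i. c ^ q * symmetric_op c (i - q) f (add_mset q R)) = (x + c * real i) * symmetric_op c i f R"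
proof (cases i)
  case (Suc n)
  have "(\<Sum>q\<le>i. c ^ q * symmetric_op c (i - q) f (add_mset q R)) =
     symmetric_op c i f (add_mset 0 R) + c * (\<Sum>q\<le>n. c ^ q * symmetric_op c (n - q) f (add_mset (Suc q) R))"
    unfolding Suc by (subst sum.atMost_Suc_shift) (simp add: sum_distrib_left mult.assoc)
  also have "\<dots> = x * symmetric_op c i f R + c * (real i * symmetric_op c i f R)"
    unfolding symmetric_op_Suc_mult[symmetric] Suc symmetric_op_zero_polygon[of f x, OF assms] ..
  finally show ?thesis by (simp add: algebra_simps)
qed (simp add: assms)

section \<open>Loop equations on complete and elementary symmetric functions\<close>

definition peel_sum :: "nat \<Rightarrow> (nat multiset \<Rightarrow> real) \<Rightarrow> nat multiset \<Rightarrow> real" where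
  "peel_sum p f R = (\<Sum>d<p. f (add_mset d (add_mset (p - 1 - d) R))) +
     (\<Sum>q\<in>#R. real q * f (add_mset (p + q - 1) (R - {#q#})))"

lemma peel_sum_add_mset:
  "peel_sum p f (add_mset r R) = peel_sum p (\<lambda>S. f (add_mset r S)) R + real r * f (add_mset (p + r - 1) R)"
proof -
  have "(\<Sum>q\<in>#R. real q * f (add_mset (p + q - 1) (add_mset r R - {#q#}))) =
        (\<Sum>q\<in>#R. real q * f (add_mset r (add_mset (p + q - 1) (R - {#q#}))))"
    by (intro arg_cong[of _ _ sum_mset] image_mset_cong) (simp add: add_mset_commute)
  moreover have "(\<Sum>d<p. f (add_mset d (add_mset (p - 1 - d) (add_mset r R)))) =
        (\<Sum>d<p. f (add_mset r (add_mset d (add_mset (p - 1 - d) R))))"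
    by (simp add: add_mset_commute)
  ultimately show ?thesis unfolding peel_sum_def by simp
qed

lemma peel_sum_linear:
  "peel_sum p (\<lambda>R. \<Sum>j\<in>J. a j * f j R) R = (\<Sum>j\<in>J. a j * peel_sum p (f j) R)"
proof -
  have 1: "(\<Sum>d<p. \<Sum>j\<in>J. a j * f j (add_mset d (add_mset (p - 1 - d) R))) =
     (\<Sum>j\<in>J. a j * (\<Sum>d<p. f j (add_mset d (add_mset (p - 1 - d) R))))"
    by (simp add: sum_distrib_left) (rule sum.swap)
  have 2: "(\<Sum>q\<in>#Q. \<Sum>j\<in>J. a j * h j q) = (\<Sum>j\<in>J. a j * (\<Sum>q\<in>#Q. h j q))" for Q :: "nat multiset" and h :: "'a \<Rightarrow> nat \<Rightarrow> real"
    by (induction Q) (simp_all add: sum.distrib distrib_left)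
  show ?thesis
    unfolding peel_sum_def 1
    using 2[of "\<lambda>j q. real q * f j (add_mset (p + q - 1) (R - {#q#}))" R]
    by (simp add: sum_distrib_left sum.distrib algebra_simps)
qed

lemma sum_triangle:
  fixes F :: "nat \<Rightarrow> nat \<Rightarrow> real"
  shows "(\<Sum>d\<le>n. \<Sum>e\<le>n - d. F d e) = (\<Sum>k\<le>n. \<Sum>d\<le>k. F d (k - d))"
proof -
  have "(\<Sum>d\<le>n. \<Sum>e\<le>n - d. F d e) = (\<Sum>(d, e)\<in>(SIGMA d:{..n}. {..n - d}). F d e)"
    by (rule sum.Sigma) auto
  also have "(SIGMA d:{..n}. {..n - d}) = {(d, e). d + e \<le> n}" by auto
  finally show ?thesis by (simp add: sum.triangle_reindex_eq)
qed

lemma sum_triangle_swap: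
  fixes F :: "nat \<Rightarrow> nat \<Rightarrow> real"
  shows "(\<Sum>d\<le>n. \<Sum>e\<le>n - d. F d e) = (\<Sum>e\<le>n. \<Sum>d\<le>n - e. F d e)"
proof -
  have "(\<Sum>d\<le>k. F d (k - d)) = (\<Sum>e\<le>k. F (k - e) e)" for k
    by (rule sum.reindex_bij_witness[of _ "\<lambda>d. k - d" "\<lambda>d. k - d"]) auto
  then show ?thesis
    by (simp add: sum_triangle[of F] sum_triangle[of "\<lambda>e d. F d e"])
qed

text \<open>The peeled polygon can also be glued to those inside \<open>h_i\<close> or
  \<open>e_i\<close>. Gluing to a polygon of perimeter \<open>q\<close> is the derivation
  \<open>q * d/dp_q\<close> followed by multiplication by \<open>p_(p+q-1)\<close>, and
  \<open>q * dh_i/dp_q = h_(i-q)\<close>, with a sign \<open>(- 1) ^ (q - 1)\<close> for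
  \<open>e_i\<close>; the sum is over \<open>q - 1\<close>. The free term \<open>T\<close> allows a
  second application, for \<open>h_i\<close> on top of \<open>e_b\<close>.\<close>

lemma symmetric_op_peel:
  assumes loop: "\<And>p R. f (add_mset (Suc p) R) = peel_sum p f R + T p R"
  shows "symmetric_op c i f (add_mset (Suc p) R) =
     peel_sum p (symmetric_op c i f) R +
     (\<Sum>q<i. c ^ q * symmetric_op c (i - Suc q) f (add_mset (p + q) R)) +
     symmetric_op c i (T p) R"
proof (induction i arbitrary: R rule: less_induct)
  case (less i)
  show ?case
  proof (cases i)
    case 0
    then show ?thesis by (simp add: loop peel_sum_def)
  next
    case (Suc n)
    let ?K = "\<lambda>i. symmetric_op c i f"
    have IH: "?K (n - q) (add_mset (Suc p) R) = peel_sum p (?K (n - q)) R +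
     (\<Sum>r<n - q. c ^ r * ?K (n - q - Suc r) (add_mset (p + r) R)) + symmetric_op c (n - q) (T p) R" for q R
      by (rule less) (simp add: Suc)
    have "real i * ?K i (add_mset (Suc p) R) =
       (\<Sum>q\<le>n. c ^ q * ?K (n - q) (add_mset (Suc p) (add_mset (Suc q) R)))"
      unfolding Suc symmetric_op_Suc_mult by (simp add: add_mset_commute)
    also have "\<dots> = (\<Sum>q\<le>n. c ^ q * (peel_sum p (\<lambda>S. ?K (n - q) (add_mset (Suc q) S)) R)) +
        (\<Sum>q\<le>n. c ^ q * (real (Suc q) * ?K (n - q) (add_mset (p + q) R))) +
        (\<Sum>q\<le>n. c ^ q * (\<Sum>r<n - q. c ^ r * ?K (n - q - Suc r) (add_mset (p + r) (add_mset (Suc q) R)))) +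
        (\<Sum>q\<le>n. c ^ q * symmetric_op c (n - q) (T p) (add_mset (Suc q) R))"
      unfolding IH peel_sum_add_mset by (simp add: distrib_left sum.distrib del: of_nat_Suc)
    also have "(\<Sum>q\<le>n. c ^ q * (peel_sum p (\<lambda>S. ?K (n - q) (add_mset (Suc q) S)) R)) =
        peel_sum p (\<lambda>S. \<Sum>q\<le>n. c ^ q * ?K (n - q) (add_mset (Suc q) S)) R"
      by (rule peel_sum_linear[symmetric])
    also have "\<dots> = peel_sum p (\<lambda>S. \<Sum>j\<in>{()}. real i * ?K i S) R"
      unfolding Suc symmetric_op_Suc_mult[symmetric] by simp
    also have "\<dots> = real i * peel_sum p (?K i) R"
      by (subst peel_sum_linear) simp
    also have "(\<Sum>q\<le>n. c ^ q * symmetric_op c (n - q) (T p) (add_mset (Suc q) R)) =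
        real i * symmetric_op c i (T p) R"
      unfolding Suc symmetric_op_Suc_mult ..
    also have "(\<Sum>q\<le>n. c ^ q * (\<Sum>r<n - q. c ^ r * ?K (n - q - Suc r) (add_mset (p + r) (add_mset (Suc q) R)))) =
        (\<Sum>r\<le>n. c ^ r * (real (n - r) * ?K (n - r) (add_mset (p + r) R)))" (is "?L = ?M")
    proof (cases n)
      case (Suc m)
      have "?L = (\<Sum>q\<le>m. \<Sum>r\<le>m - q. c ^ q * c ^ r * ?K (m - q - r) (add_mset (p + r) (add_mset (Suc q) R)))"
        unfolding Suc by (simp add: sum_distrib_left lessThan_Suc_atMost Suc_diff_le mult.assoc)
      also have "\<dots> = (\<Sum>r\<le>m. \<Sum>q\<le>m - r. c ^ q * c ^ r * ?K (m - q - r) (add_mset (p + r) (add_mset (Suc q) R)))"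
        by (rule sum_triangle_swap)
      also have "\<dots> = (\<Sum>r\<le>m. c ^ r * (real (Suc (m - r)) * ?K (Suc (m - r)) (add_mset (p + r) R)))"
        unfolding symmetric_op_Suc_mult
        by (simp add: sum_distrib_left mult_ac add_mset_commute diff_commute diff_diff_left add.commute)
      also have "\<dots> = ?M" unfolding Suc sum.atMost_Suc
        by (simp del: of_nat_Suc of_nat_diff) (rule sum.cong, simp_all add: Suc_diff_le)
      finally show ?thesis .
    qed simp
    finally have "real i * ?K i (add_mset (Suc p) R) = real i * (peel_sum p (?K i) R) +
      ((\<Sum>q\<le>n. c ^ q * (real (Suc q) * ?K (n - q) (add_mset (p + q) R))) +
       (\<Sum>r\<le>n. c ^ r * (real (n - r) * ?K (n - r) (add_mset (p + r) R)))) +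
      real i * symmetric_op c i (T p) R" by simp
    \<comment> \<open>The weight \<open>q + 1\<close> comes from gluing to the power sum that
      Newton's identity has split off, \<open>n - q\<close> from gluing to the remaining factor;
      they add up to \<open>i\<close>.\<close>
    also have "(\<Sum>q\<le>n. c ^ q * (real (Suc q) * ?K (n - q) (add_mset (p + q) R))) +
       (\<Sum>r\<le>n. c ^ r * (real (n - r) * ?K (n - r) (add_mset (p + r) R))) =
       (\<Sum>q\<le>n. real i * (c ^ q * ?K (n - q) (add_mset (p + q) R)))"
      unfolding sum.distrib[symmetric]
      by (rule sum.cong) (auto simp: Suc of_nat_diff algebra_simps)
    also have "\<dots> = real i * (\<Sum>q<i. c ^ q * ?K (i - Suc q) (add_mset (p + q) R))"
      unfolding Suc by (simp add: sum_distrib_left lessThan_Suc_atMost del: of_nat_Suc)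
    finally show ?thesis using Suc by (simp add: distrib_left[symmetric] del: of_nat_Suc)
  qed
qed

text \<open>Newton's identity splits off a power sum, the loop equation peels it, and Newton's
  identity, used twice more, resums the result. No power sum is left apart from those in
  \<open>T\<close>: this two-step recurrence is what the power sums themselves do not have.\<close>

lemma symmetric_op_diagonal:
  assumes c: "c * c = 1"
    and zero: "\<And>R. f (add_mset 0 R) = x * f R"
    and loop: "\<And>p R. f (add_mset (Suc p) R) = peel_sum p f R + T p R"
  shows "real (i + 2) * symmetric_op c (i + 2) f {#} =
     (c * x + real i + 1) * (x + c * real i) * symmetric_op c i f {#} +
     (\<Sum>q\<le>i + 1. c ^ q * symmetric_op c (i + 1 - q) (T q) {#})"
proof -
  let ?K = "\<lambda>i. symmetric_op c i f"
  have peel: "?K j {#Suc q#} = (\<Sum>d<q. ?K j {#d, q - 1 - d#}) +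
      (\<Sum>r<j. c ^ r * ?K (j - Suc r) {#q + r#}) + symmetric_op c j (T q) {#}" for j q
    using symmetric_op_peel[OF loop, of c j q "{#}"] by (simp add: peel_sum_def)
  have "real (i + 2) * ?K (i + 2) {#} = (\<Sum>q\<le>i + 1. c ^ q * ?K (i + 1 - q) {#Suc q#})"
    using symmetric_op_Suc_mult[of "i + 1" c f "{#}"] by (simp del: of_nat_Suc of_nat_add)
  also have "\<dots> = (\<Sum>q\<le>i + 1. c ^ q * (\<Sum>d<q. ?K (i + 1 - q) {#d, q - 1 - d#})) +
      (\<Sum>q\<le>i + 1. c ^ q * (\<Sum>r<i + 1 - q. c ^ r * ?K (i + 1 - q - Suc r) {#q + r#})) +
      (\<Sum>q\<le>i + 1. c ^ q * symmetric_op c (i + 1 - q) (T q) {#})"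
    unfolding peel by (simp only: distrib_left sum.distrib)
  also have "(\<Sum>q\<le>i + 1. c ^ q * (\<Sum>d<q. ?K (i + 1 - q) {#d, q - 1 - d#})) =
      (\<Sum>q\<le>i. \<Sum>d\<le>q. c ^ Suc q * ?K (i - q) {#d, q - d#})"
    unfolding Suc_eq_plus1[symmetric]
    by (subst sum.atMost_Suc_shift) (simp add: sum_distrib_left lessThan_Suc_atMost)
  also have "\<dots> = (\<Sum>q\<le>i. \<Sum>d\<le>q. c ^ Suc (d + (q - d)) * ?K (i - d - (q - d)) {#d, q - d#})"
    by (intro sum.cong refl) auto
  also have "\<dots> = (\<Sum>d\<le>i. \<Sum>e\<le>i - d. c ^ Suc (d + e) * ?K (i - d - e) {#d, e#})"
    by (rule sum_triangle[symmetric])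
  also have "\<dots> = (\<Sum>d\<le>i. c * c ^ d * (\<Sum>e\<le>i - d. c ^ e * ?K (i - d - e) (add_mset e {#d#})))"
    by (simp add: sum_distrib_left power_add mult_ac add_mset_commute)
  also have "\<dots> = (\<Sum>d\<le>i. c * c ^ d * ((x + c * real (i - d)) * ?K (i - d) {#d#}))"
    unfolding symmetric_op_newton[of f x, OF zero] ..
  also have "\<dots> = (\<Sum>d\<le>i. (c * x + real (i - d)) * (c ^ d * ?K (i - d) {#d#}))"
  proof (rule sum.cong[OF refl])
    fix d assume "d \<in> {..i}"
    have e: "c * (x + c * real (i - d)) = c * x + real (i - d)"
      using c by (simp add: distrib_left flip: mult.assoc)
    have "c * c ^ d * ((x + c * real (i - d)) * ?K (i - d) {#d#}) =
        (c * (x + c * real (i - d))) * (c ^ d * ?K (i - d) {#d#})" by (simp only: mult_ac)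
    then show "c * c ^ d * ((x + c * real (i - d)) * ?K (i - d) {#d#}) = (c * x + real (i - d)) * (c ^ d * ?K (i - d) {#d#})"
      unfolding e .
  qed
  also have "(\<Sum>q\<le>i + 1. c ^ q * (\<Sum>r<i + 1 - q. c ^ r * ?K (i + 1 - q - Suc r) {#q + r#})) =
     (\<Sum>q\<le>i. \<Sum>r\<le>i - q. c ^ (q + r) * ?K (i - (q + r)) {#q + r#})"
    by (simp add: sum_distrib_left lessThan_Suc_atMost Suc_diff_le power_add mult.assoc)
  also have "\<dots> = (\<Sum>k\<le>i. \<Sum>d\<le>k. c ^ (d + (k - d)) * ?K (i - (d + (k - d))) {#d + (k - d)#})"
    by (rule sum_triangle)
  also have "\<dots> = (\<Sum>k\<le>i. (real k + 1) * (c ^ k * ?K (i - k) {#k#}))"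
    by (simp add: algebra_simps)
  also have "(\<Sum>d\<le>i. (c * x + real (i - d)) * (c ^ d * ?K (i - d) {#d#})) +
     (\<Sum>k\<le>i. (real k + 1) * (c ^ k * ?K (i - k) {#k#})) =
     (\<Sum>k\<le>i. (c * x + real i + 1) * (c ^ k * ?K (i - k) {#k#}))"
    unfolding sum.distrib[symmetric] by (rule sum.cong) (auto simp: of_nat_diff algebra_simps)
  also have "\<dots> = (c * x + real i + 1) * ((x + c * real i) * ?K i {#})"
    unfolding sum_distrib_left[symmetric] symmetric_op_newton[of f x, OF zero] ..
  finally show ?thesis by (simp add: mult.assoc)
qed

lemma symmetric_op_diagonal_one:
  assumes loop: "\<And>p R. f (add_mset (Suc p) R) = peel_sum p f R + T p R"
  shows "symmetric_op c (Suc 0) f {#} = T 0 {#}"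
  using loop[of 0 "{#}"] by (simp add: symmetric_op.simps(2) peel_sum_def)

section \<open>Values of the functional on products of a complete and an elementary function\<close>

locale loop_equations =
  fixes f :: "nat multiset \<Rightarrow> real" and x :: real
  assumes zero: "f (add_mset 0 R) = x * f R"
    and loop: "f (add_mset (Suc p) R) = peel_sum p f R"
    and empty: "f {#} = 1"
begin

text \<open>The value at \<open>h_i * e_b * p_R\<close>. For positive \<open>i\<close> and
  \<open>b\<close>, the product \<open>h_i * e_b\<close> is the sum of two hook Schur
  functions.\<close>

definition hook :: "nat \<Rightarrow> nat \<Rightarrow> nat multiset \<Rightarrow> real" where
  "hook i b R = symmetric_op 1 i (symmetric_op (- 1) b f) R"

text \<open>The contribution of gluing a polygon of perimeter \<open>q + 1\<close> inside
  \<open>h_i\<close> to one of perimeter \<open>r + 1\<close> inside \<open>e_b\<close>.\<close>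

definition hook_rim :: "nat \<Rightarrow> nat \<Rightarrow> real" where
  "hook_rim i b = (\<Sum>q<i. \<Sum>r<b. (- 1) ^ r * hook (i - 1 - q) (b - 1 - r) {#q + r#})"

lemma e_zero: "symmetric_op (- 1) b f (add_mset 0 R) = x * symmetric_op (- 1) b f R"
  by (rule symmetric_op_zero_polygon) (rule zero)

lemma e_loop: "symmetric_op (- 1) b f (add_mset (Suc p) R) = peel_sum p (symmetric_op (- 1) b f) R +
    (\<Sum>r<b. (- 1) ^ r * symmetric_op (- 1) (b - Suc r) f (add_mset (p + r) R))"
  using symmetric_op_peel[of f "\<lambda>p R. 0" "- 1" b p R] loop by (simp add: symmetric_op_zero)

lemma hook_append:
  "symmetric_op 1 i (\<lambda>R. \<Sum>r<b. (- 1) ^ r * symmetric_op (- 1) (b - Suc r) f (add_mset (q + r) R)) R =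
   (\<Sum>r<b. (- 1) ^ r * hook i (b - 1 - r) (add_mset (q + r) R))"
  unfolding symmetric_op_sum symmetric_op_mult symmetric_op_append hook_def by simp

lemma hook_diagonal:
  "real (i + 2) * hook (i + 2) b {#} = (x + real i + 1) * (x + real i) * hook i b {#} + hook_rim (i + 2) b"
proof -
  have "hook_rim (i + 2) b = (\<Sum>q\<le>i + 1. 1 ^ q * (\<Sum>r<b. (- 1) ^ r * hook (i + 1 - q) (b - 1 - r) (add_mset (q + r) {#})))"
    unfolding hook_rim_def by (rule sum.cong) auto
  then show ?thesis
    using symmetric_op_diagonal[of 1 "symmetric_op (- 1) b f" x, OF _ e_zero e_loop, of i]
    unfolding hook_append hook_def[symmetric] by simp
qed

lemma hook_1: "hook (Suc 0) b {#} = hook_rim (Suc 0) b"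
proof -
  have "hook (Suc 0) b {#} = (\<Sum>r<b. (- 1) ^ r * symmetric_op (- 1) (b - Suc r) f {#r#})"
    using symmetric_op_diagonal_one[of "symmetric_op (- 1) b f", OF e_loop, of 1] unfolding hook_def by simp
  also have "\<dots> = hook_rim (Suc 0) b" unfolding hook_rim_def by (simp add: hook_def)
  finally show ?thesis .
qed

lemma hook_0_diagonal:
  "real (b + 2) * hook 0 (b + 2) {#} = - ((x - real b - 1) * (x - real b)) * hook 0 b {#}"
proof -
  have l: "f (add_mset (Suc p) R) = peel_sum p f R + 0" for p R by (simp add: loop)
  have "real (b + 2) * symmetric_op (- 1) (b + 2) f {#} =
    (- 1 * x + real b + 1) * (x + - 1 * real b) * symmetric_op (- 1) b f {#}"
    using symmetric_op_diagonal[of "- 1" f x "\<lambda>p R. 0" b, OF _ zero l] unfolding symmetric_op_zero by simp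
  then show ?thesis unfolding hook_def symmetric_op.simps(1) by (simp only:) (simp add: algebra_simps)
qed

lemma hook_0_0: "hook 0 0 R = f R"
  by (simp add: hook_def)

lemma hook_newton_h:
  "(\<Sum>q\<le>n. hook (n - q) b (add_mset q R)) = (x + real n) * hook n b R"
  using symmetric_op_newton[of "symmetric_op (- 1) b f" x 1 n R, OF e_zero] by (simp add: hook_def)

lemma hook_newton_e:
  "(\<Sum>r\<le>n. (- 1) ^ r * hook i (n - r) (add_mset r R)) = (x - real n) * hook i n R"
proof -
  have "(\<lambda>R. \<Sum>r\<le>n. (- 1) ^ r * symmetric_op (- 1) (n - r) f (add_mset r R)) =
      (\<lambda>R. (x - real n) * symmetric_op (- 1) n f R)"
    using symmetric_op_newton[of f x "- 1" n, OF zero] by auto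
  then have "symmetric_op 1 i (\<lambda>R. \<Sum>r\<le>n. (- 1) ^ r * symmetric_op (- 1) (n - r) f (add_mset r R)) R =
     symmetric_op 1 i (\<lambda>R. (x - real n) * symmetric_op (- 1) n f R) R" by simp
  then show ?thesis
    unfolding symmetric_op_sum symmetric_op_mult symmetric_op_append hook_def[symmetric] .
qed

lemma hook_rim_zero [simp]: "hook_rim i 0 = 0" "hook_rim 0 b = 0"
  by (simp_all add: hook_rim_def)

text \<open>The interiors of the two double sums, \<open>q > 0\<close> in the first and
  \<open>r > 0\<close> in the second, cancel; the remaining edges are Newton sums. Thus neighbouring
  rims determine each other through hooks whose degree is lower by two.\<close>

lemma hook_rim_shift:
  "hook_rim (Suc i) b + hook_rim i (Suc b) =
     (if i = 0 then 0 else (x + real i - 1) * hook (i - 1) b {#}) +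
     (if b = 0 then 0 else (x - real b + 1) * hook i (b - 1) {#})"
proof -
  let ?S = "\<Sum>q<i. \<Sum>r<b. (- 1) ^ r * hook (i - Suc q) (b - Suc r) {#Suc (q + r)#}"
  have "hook_rim (Suc i) b = (\<Sum>r<b. (- 1) ^ r * hook i (b - Suc r) {#r#}) + ?S"
    unfolding hook_rim_def by (subst sum.lessThan_Suc_shift) simp
  moreover have "hook_rim i (Suc b) = (\<Sum>q<i. hook (i - Suc q) b {#q#}) - ?S"
    unfolding hook_rim_def
    by (subst sum.lessThan_Suc_shift) (simp add: sum.distrib sum_negf sum_subtractf)
  moreover have "(\<Sum>r<b. (- 1) ^ r * hook i (b - Suc r) {#r#}) =
      (if b = 0 then 0 else (x - real b + 1) * hook i (b - 1) {#})"
    by (cases b) (use hook_newton_e[of i _ "{#}"] in \<open>simp_all add: lessThan_Suc_atMost\<close>)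
  moreover have "(\<Sum>q<i. hook (i - Suc q) b {#q#}) =
      (if i = 0 then 0 else (x + real i - 1) * hook (i - 1) b {#})"
    by (cases i) (use hook_newton_h[of _ b "{#}"] in \<open>simp_all add: lessThan_Suc_atMost\<close>)
  ultimately show ?thesis by simp
qed

text \<open>\<open>rise1 j = (\<Prod>c=1..2*j. x + c) / (2 ^ j * fact j)\<close> and \<open>rise0 j = (\<Prod>c<2*j. x + c) / (2 ^ j * fact j)\<close>;
  in \<open>fall1\<close> and \<open>fall0\<close> the factors are \<open>x - c\<close> and the sign is \<open>(- 1) ^ j\<close>.\<close>

primrec rise1 :: "nat \<Rightarrow> real" where
  "rise1 0 = 1"
| "rise1 (Suc j) = (x + 2 * real j + 2) * (x + 2 * real j + 1) * rise1 j / (2 * (real j + 1))"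

primrec fall1 :: "nat \<Rightarrow> real" where
  "fall1 0 = 1"
| "fall1 (Suc k) = - ((x - 2 * real k - 2) * (x - 2 * real k - 1) * fall1 k / (2 * (real k + 1)))"

primrec rise0 :: "nat \<Rightarrow> real" where
  "rise0 0 = 1"
| "rise0 (Suc j) = x * (x + 2 * real j + 1) * rise1 j / (2 * (real j + 1))"

primrec fall0 :: "nat \<Rightarrow> real" where
  "fall0 0 = 1"
| "fall0 (Suc k) = - (x * (x - 2 * real k - 1) * fall1 k / (2 * (real k + 1)))"

lemma rise0_mult: "(x + 2 * real j) * rise0 j = x * rise1 j"
  by (cases j) (simp_all add: algebra_simps)

lemma fall0_mult: "(x - 2 * real k) * fall0 k = x * fall1 k"
  by (cases k) (simp_all add: algebra_simps)

lemma rise0_Suc': "rise0 (Suc j) = rise1 (Suc j) - (x + 2 * real j + 1) * rise1 j"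
proof -
  have "real j + 1 \<noteq> 0" by simp
  then show ?thesis by (simp add: field_simps del: of_nat_Suc)
qed

lemma fall0_Suc': "fall0 (Suc k) = fall1 (Suc k) - (x - 2 * real k - 1) * fall1 k"
proof -
  have "real k + 1 \<noteq> 0" by simp
  then show ?thesis by (simp add: field_simps del: of_nat_Suc)
qed

text \<open>Meant for \<open>i + b\<close> even, where \<open>b\<close> has the parity of
  \<open>i\<close>.\<close>

definition hook_value :: "nat \<Rightarrow> nat \<Rightarrow> real" where
  "hook_value i b = (if even i then rise0 (i div 2) * fall0 (b div 2)
                     else x * rise1 (i div 2) * fall1 (b div 2))"

text \<open>At degree \<open>2 * n\<close> the rims come first: induction on \<open>b\<close> along
  the antidiagonal, starting from \<open>b = 0\<close> where the rim is empty, uses only hooks of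
  degree \<open>2 * n - 2\<close>. The hooks of degree \<open>2 * n\<close> then follow from the
  two-step recurrences.\<close>

lemma hook_closed_form:
  "i + b = 2 * n \<Longrightarrow>
     hook i b {#} = hook_value i b \<and> hook_rim i b = (if even i then 0 else hook_value i b)"
proof (induction n arbitrary: i b rule: less_induct)
  case (less n)
  have outer: "hook i b {#} = hook_value i b" if "i + b + 2 = 2 * n" for i b
    using less.IH[of "n - 1" i b] that by (cases n) auto
  have "hook_rim i b = (if even i then 0 else hook_value i b)" if "i + b = 2 * n" for i b
    using that
  proof (induction b arbitrary: i)
    case 0
    then have "even i" by presburger
    then show ?case by simp
  next
    case (Suc b)
    have IH: "hook_rim (Suc i) b = (if odd i then 0 else hook_value (Suc i) b)"
      using Suc.IH[of "Suc i"] Suc.prems by simp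
    have shift: "hook_rim i (Suc b) = - (if odd i then 0 else hook_value (Suc i) b) +
     (if i = 0 then 0 else (x + real i - 1) * hook (i - 1) b {#}) +
     (if b = 0 then 0 else (x - real b + 1) * hook i (b - 1) {#})"
      using hook_rim_shift[of i b] IH by simp
    show ?case
    proof (cases "even i")
      case True
      then obtain j where j: "i = 2 * j" by auto
      show ?thesis
      proof (cases j)
        case (Suc l)
        obtain k where k: "b = Suc (2 * k)"
          using Suc.prems j by (metis Suc_double_not_eq_double add_Suc_right even_add evenE oddE even_mult_iff even_Suc Suc_eq_plus1 dvd_triv_left)
        have h1: "hook (i - 1) b {#} = x * rise1 l * fall1 k"
          using outer[of "i - 1" b] Suc.prems unfolding j Suc k by (simp add: hook_value_def)
        have h2: "hook i (b - 1) {#} = rise0 (Suc l) * fall0 k"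
          using outer[of i "b - 1"] Suc.prems unfolding j Suc k by (simp add: hook_value_def del: rise0.simps)
        have "hook_rim i (Suc b) = - (x * rise1 (Suc l) * fall1 k) + (x + 2 * real l + 1) * (x * rise1 l * fall1 k) +
            rise0 (Suc l) * ((x - 2 * real k) * fall0 k)"
          unfolding shift h1 h2 unfolding j Suc k
          by (simp add: hook_value_def algebra_simps del: rise0.simps rise1.simps)
        also have "\<dots> = 0" unfolding fall0_mult rise0_Suc' by (simp add: algebra_simps del: rise1.simps)
        finally show ?thesis using True by simp
      next
        case 0
        then show ?thesis using True j by simp
      qed
    next
      case False
      then obtain j where j: "i = Suc (2 * j)" by (auto elim: oddE)
      then have "even b" using Suc.prems by presburger
      then obtain k where k: "b = 2 * k" by auto
      have h1: "hook (i - 1) b {#} = rise0 j * fall0 k"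
        using outer[of "i - 1" b] Suc.prems unfolding j k by (simp add: hook_value_def)
      have "hook_rim i (Suc b) = x * rise1 j * fall1 k"
      proof (cases k)
        case 0
        then show ?thesis using shift h1 rise0_mult[of j] unfolding j k by simp
      next
        case (Suc l)
        have h2: "hook i (b - 1) {#} = x * rise1 j * fall1 l"
          using outer[of i "b - 1"] Suc.prems unfolding j Suc k by (simp add: hook_value_def)
        have "hook_rim i (Suc b) = ((x + 2 * real j) * rise0 j) * fall0 (Suc l) +
           (x - 2 * real l - 1) * (x * rise1 j * fall1 l)"
          unfolding shift h1 h2 unfolding j Suc k by (simp add: algebra_simps del: fall0.simps)
        also have "\<dots> = x * rise1 j * fall1 k"
          unfolding rise0_mult fall0_Suc' Suc by (simp add: algebra_simps del: fall1.simps)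
        finally show ?thesis .
      qed
      then show ?thesis using False by (simp add: hook_value_def j k)
    qed
  qed
  note rim = this
  have "hook i b {#} = hook_value i b" if ib: "i + b = 2 * n" for i b
  proof (cases i)
    case 0
    show ?thesis
    proof (cases n)
      case 0
      then show ?thesis using ib by (simp add: hook_0_0 empty hook_value_def)
    next
      case (Suc k)
      have b: "b = 2 * k + 2" using ib Suc \<open>i = 0\<close> by simp
      have "hook 0 (2 * k) {#} = fall0 k" using outer[of 0 "2 * k"] Suc by (simp add: hook_value_def)
      then have "real (2 * k + 2) * hook 0 b {#} = - ((x - 2 * real k - 1) * ((x - 2 * real k) * fall0 k))"
        unfolding b using hook_0_diagonal[of "2 * k"] by (simp del: of_nat_add of_nat_Suc)
      also have "\<dots> = real (2 * k + 2) * fall0 (Suc k)"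
        unfolding fall0_mult by (simp add: field_simps)
      finally show ?thesis using \<open>i = 0\<close> b by (simp add: hook_value_def del: fall0.simps)
    qed
  next
    case (Suc i')
    show ?thesis
    proof (cases i')
      case 0
      then show ?thesis using hook_1[of b] rim[OF ib] Suc by simp
    next
      case (Suc l)
      have i: "i = l + 2" using Suc \<open>i = Suc i'\<close> by simp
      have o: "hook l b {#} = hook_value l b" using outer[of l b] ib i by simp
      have d: "real i * hook i b {#} = (x + real l + 1) * (x + real l) * hook_value l b +
         (if even i then 0 else hook_value i b)"
        using hook_diagonal[of l b] rim[OF ib] unfolding o unfolding i by (simp del: of_nat_add of_nat_Suc)
      have "real i * hook i b {#} = real i * hook_value i b"
      proof (cases "even l")
        case True
        then obtain j where j: "l = 2 * j" by auto
        have "hook_value i b = rise0 (Suc j) * fall0 (b div 2)" by (simp add: hook_value_def i j)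
        moreover have "hook_value l b = rise0 j * fall0 (b div 2)" by (simp add: hook_value_def j)
        moreover have "(x + real l + 1) * (x + real l) * rise0 j = real i * rise0 (Suc j)"
        proof -
          have "(x + real l + 1) * (x + real l) * rise0 j = (x + 2 * real j + 1) * ((x + 2 * real j) * rise0 j)"
            by (simp add: j)
          also have "\<dots> = real i * rise0 (Suc j)"
            unfolding rise0_mult i j by (simp add: field_simps)
          finally show ?thesis .
        qed
        ultimately show ?thesis unfolding d using True i by (simp del: rise0.simps)
      next
        case False
        then obtain j where j: "l = Suc (2 * j)" by (auto elim: oddE)
        have "hook_value i b = x * rise1 (Suc j) * fall1 (b div 2)" by (simp add: hook_value_def i j)
        moreover have "hook_value l b = x * rise1 j * fall1 (b div 2)" by (simp add: hook_value_def j)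
        \<comment> \<open>For odd \<open>i\<close> the rim is \<open>hook_value i b\<close> itself,
          so that only \<open>real i - 1\<close> copies have to come from
          \<open>hook l b\<close>.\<close>
        moreover have m: "(x + real l + 1) * (x + real l) * rise1 j = (real i - 1) * rise1 (Suc j)"
          unfolding j i by (simp add: field_simps)
        have "(x + real l + 1) * (x + real l) * (x * rise1 j * fall1 (b div 2)) =
           x * ((x + real l + 1) * (x + real l) * rise1 j) * fall1 (b div 2)" by simp
        ultimately have v: "(x + real l + 1) * (x + real l) * hook_value l b = (real i - 1) * hook_value i b"
          unfolding m by (simp del: rise1.simps)
        show ?thesis unfolding d v using False i by (simp add: algebra_simps)
      qed
      then show ?thesis using i by simp
    qed
  qed
  with rim less.prems show ?case by simp
qed

lemma hook_Suc_h:
  "real (Suc i) * hook (Suc i) b R = (\<Sum>q\<le>i. hook (i - q) b (add_mset (Suc q) R))"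
  unfolding hook_def symmetric_op_Suc_mult by simp

lemma hook_Suc_e:
  "real (Suc b) * hook i (Suc b) R = (\<Sum>r\<le>b. (- 1) ^ r * hook i (b - r) (add_mset (Suc r) R))"
proof -
  have "(\<lambda>R. \<Sum>r\<le>b. (- 1) ^ r * symmetric_op (- 1) (b - r) f (add_mset (Suc r) R)) =
      (\<lambda>R. real (Suc b) * symmetric_op (- 1) (Suc b) f R)"
    using symmetric_op_Suc_mult[of b "- 1" f] by auto
  then have "symmetric_op 1 i (\<lambda>R. \<Sum>r\<le>b. (- 1) ^ r * symmetric_op (- 1) (b - r) f (add_mset (Suc r) R)) R =
     symmetric_op 1 i (\<lambda>R. real (Suc b) * symmetric_op (- 1) (Suc b) f R) R" by simp
  then show ?thesis
    unfolding symmetric_op_sum symmetric_op_mult symmetric_op_append hook_def[symmetric] by simp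
qed

section \<open>Power sums as alternating sums of hooks\<close>

lemma hook_weighted_sum:
  "(\<Sum>b\<le>Suc m. (- 1) ^ b * (real (Suc m - b) * hook (Suc m - b) b R)) =
     (\<Sum>q\<le>m. \<Sum>b\<le>m - q. (- 1) ^ b * hook (m - q - b) b (add_mset (Suc q) R))"
proof -
  have "(\<Sum>b\<le>Suc m. (- 1) ^ b * (real (Suc m - b) * hook (Suc m - b) b R)) =
     (\<Sum>b\<le>m. (- 1) ^ b * (real (Suc (m - b)) * hook (Suc (m - b)) b R))"
    unfolding sum.atMost_Suc by (simp del: of_nat_Suc of_nat_diff) (rule sum.cong, simp_all add: Suc_diff_le)
  also have "\<dots> = (\<Sum>b\<le>m. \<Sum>q\<le>m - b. (- 1) ^ b * hook (m - q - b) b (add_mset (Suc q) R))"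
    unfolding hook_Suc_h sum_distrib_left by (intro sum.cong refl) (simp only: diff_commute)
  also have "\<dots> = (\<Sum>q\<le>m. \<Sum>b\<le>m - q. (- 1) ^ b * hook (m - q - b) b (add_mset (Suc q) R))"
    by (rule sum_triangle_swap)
  finally show ?thesis .
qed

text \<open>Multiplied by \<open>n = b + (n - b)\<close>, the sum falls into two parts; expanding
  \<open>e_b\<close> in the first and \<open>h_(n-b)\<close> in the second by Newton's identity
  shows that they cancel.\<close>

lemma hook_alternating_sum:
  assumes "n > 0"
  shows "(\<Sum>b\<le>n. (- 1) ^ b * hook (n - b) b R) = 0"
proof -
  obtain m where n: "n = Suc m" using assms by (cases n) auto
  have "(\<Sum>b\<le>n. (- 1) ^ b * (real b * hook (n - b) b R)) =
     (\<Sum>b\<le>m. - ((- 1) ^ b * (real (Suc b) * hook (m - b) (Suc b) R)))"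
    unfolding n by (subst sum.atMost_Suc_shift) (simp del: of_nat_Suc)
  also have "\<dots> = - (\<Sum>b\<le>m. \<Sum>r\<le>b. (- 1) ^ (b - r) * hook (m - r - (b - r)) (b - r) (add_mset (Suc r) R))"
  proof -
    have sgn: "(- 1 :: real) ^ b * (- 1) ^ r = (- 1) ^ (b - r)" if "r \<le> b" for b r :: nat
    proof -
      obtain e where "b = r + e" using \<open>r \<le> b\<close> le_Suc_ex by blast
      moreover have "(- 1 :: real) ^ r * (- 1) ^ r = 1" by (simp flip: power_mult_distrib)
      ultimately show ?thesis by (simp add: power_add)
    qed
    show ?thesis
      unfolding hook_Suc_e sum_negf sum_distrib_left mult.assoc[symmetric]
      by (intro arg_cong[of _ _ uminus] sum.cong refl) (simp add: sgn)
  qed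
  also have "\<dots> = - (\<Sum>r\<le>m. \<Sum>b\<le>m - r. (- 1) ^ b * hook (m - r - b) b (add_mset (Suc r) R))"
    unfolding sum_triangle ..
  also have "\<dots> = - (\<Sum>b\<le>n. (- 1) ^ b * (real (n - b) * hook (n - b) b R))"
    unfolding n hook_weighted_sum ..
  finally have "(\<Sum>b\<le>n. (- 1) ^ b * (real b * hook (n - b) b R)) +
     (\<Sum>b\<le>n. (- 1) ^ b * (real (n - b) * hook (n - b) b R)) = 0" by simp
  moreover have "(\<Sum>b\<le>n. (- 1) ^ b * (real b * hook (n - b) b R)) +
     (\<Sum>b\<le>n. (- 1) ^ b * (real (n - b) * hook (n - b) b R)) =
     (\<Sum>b\<le>n. real n * ((- 1) ^ b * hook (n - b) b R))"
    unfolding sum.distrib[symmetric] by (rule sum.cong) (auto simp: algebra_simps of_nat_diff)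
  ultimately show ?thesis using assms unfolding sum_distrib_left[symmetric] by simp
qed

text \<open>In the weighted sum every power sum except the last multiplies a vanishing alternating
  sum.\<close>

lemma one_polygon_eq_hooks:
  "f {#Suc m#} = (\<Sum>b\<le>Suc m. (- 1) ^ b * (real (Suc m - b) * hook (Suc m - b) b {#}))"
proof -
  have "(\<Sum>b\<le>m - q. (- 1) ^ b * hook (m - q - b) b {#Suc q#}) = (if q = m then f {#Suc m#} else 0)"
    if "q \<le> m" for q
    using hook_alternating_sum[of "m - q" "{#Suc q#}"] that by (auto simp: hook_0_0)
  then have "(\<Sum>q\<le>m. \<Sum>b\<le>m - q. (- 1) ^ b * hook (m - q - b) b {#Suc q#}) =
     (\<Sum>q\<le>m. if q = m then f {#Suc m#} else 0)" by (intro sum.cong) auto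
  then show ?thesis unfolding hook_weighted_sum by simp
qed

lemma sum_even_odd: "(\<Sum>b\<le>2 * m. g b) = (\<Sum>k\<le>m. g (2 * k)) + (\<Sum>k<m. g (Suc (2 * k)))" for g :: "nat \<Rightarrow> real"
  by (induction m) (simp_all add: algebra_simps)

lemma one_polygon_value:
  "f {#2 * Suc M#} = x * (\<Sum>k\<le>M. rise1 (M - k) *
      ((x + 2 * real (M - k) + 1) * fall0 k - (2 * real (M - k) + 1) * fall1 k))"
proof -
  let ?n = "2 * Suc M"
  define g where "g b = (- 1) ^ b * (real (?n - b) * hook (?n - b) b {#})" for b
  have hook: "hook (?n - b) b {#} = hook_value (?n - b) b" if "b \<le> ?n" for b
    using hook_closed_form[of "?n - b" b "Suc M"] that by simp
  have "f {#?n#} = (\<Sum>b\<le>?n. g b)"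
    using one_polygon_eq_hooks[of "Suc (2 * M)"] by (simp add: g_def)
  also have "\<dots> = (\<Sum>k\<le>Suc M. g (2 * k)) + (\<Sum>k<Suc M. g (Suc (2 * k)))"
    by (rule sum_even_odd)
  also have "(\<Sum>k\<le>Suc M. g (2 * k)) = (\<Sum>k\<le>M. g (2 * k))" by (simp add: g_def)
  also have "\<dots> + (\<Sum>k<Suc M. g (Suc (2 * k))) = (\<Sum>k\<le>M. g (2 * k) + g (Suc (2 * k)))"
    by (simp only: lessThan_Suc_atMost sum.distrib)
  also have "\<dots> = (\<Sum>k\<le>M. x * (rise1 (M - k) *
      ((x + 2 * real (M - k) + 1) * fall0 k - (2 * real (M - k) + 1) * fall1 k)))"
  proof (rule sum.cong[OF refl])
    fix k assume k: "k \<in> {..M}"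
    define j where "j = M - k"
    have e: "?n - 2 * k = 2 * Suc j" "?n - Suc (2 * k) = Suc (2 * j)"
      using k by (auto simp: j_def)
    \<comment> \<open>The weight \<open>?n - 2 * k\<close> cancels the denominator of
      \<open>rise0 (Suc j)\<close>.\<close>
    have "g (2 * k) = (2 * (real j + 1)) * rise0 (Suc j) * fall0 k"
      unfolding g_def using hook[of "2 * k"] k unfolding e by (simp add: hook_value_def del: rise0.simps)
    also have "\<dots> = x * (x + 2 * real j + 1) * rise1 j * fall0 k"
      by (simp add: add_pos_nonneg)
    finally have 1: "g (2 * k) = x * (x + 2 * real j + 1) * rise1 j * fall0 k" .
    have 2: "g (Suc (2 * k)) = - ((2 * real j + 1) * (x * rise1 j * fall1 k))"
      unfolding g_def using hook[of "Suc (2 * k)"] k unfolding e by (simp add: hook_value_def algebra_simps)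
    show "g (2 * k) + g (Suc (2 * k)) = x * (rise1 (M - k) *
      ((x + 2 * real (M - k) + 1) * fall0 k - (2 * real (M - k) + 1) * fall1 k))"
      unfolding 1 2 j_def[symmetric] by (simp add: algebra_simps)
  qed
  finally show ?thesis by (simp only: sum_distrib_left)
qed

text \<open>The rising factors above \<open>x\<close> and the falling ones below it join to a single
  falling factorial, which becomes a binomial coefficient when \<open>x\<close> is a natural
  number.\<close>

lemma rise1_fall1_prod:
  "x * (rise1 j * fall1 k) * ((- 1) ^ k * 2 ^ (j + k) * fact j * fact k) =
     (\<Prod>i<2 * (j + k) + 1. x + 2 * real j - real i)"
proof (induction k)
  case 0
  show ?case
  proof (induction j)
    case (Suc j)
    have e: "2 * (Suc j + 0) + 1 = Suc (Suc (2 * (j + 0) + 1))" by simp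
    have step: "(\<Prod>i<2 * (Suc j + 0) + 1. x + 2 * real (Suc j) - real i) =
      (x + 2 * real j + 2) * (x + 2 * real j + 1) * (\<Prod>i<2 * (j + 0) + 1. x + 2 * real j - real i)"
      unfolding e prod.lessThan_Suc_shift by (simp add: algebra_simps)
    show ?case unfolding step Suc.IH[symmetric] by (simp add: field_simps)
  qed simp
next
  case (Suc k)
  have e: "2 * (j + Suc k) + 1 = Suc (Suc (2 * (j + k) + 1))" by simp
  have step: "(\<Prod>i<2 * (j + Suc k) + 1. x + 2 * real j - real i) =
     (\<Prod>i<2 * (j + k) + 1. x + 2 * real j - real i) * ((x - 2 * real k - 1) * (x - 2 * real k - 2))"
    unfolding e prod.lessThan_Suc by (simp add: algebra_simps)
  show ?case unfolding step Suc.IH[symmetric] by (simp add: field_simps)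
qed

lemma rise1_fall0_prod:
  "(x + 2 * real j + 1) * (rise1 j * fall0 k) * ((- 1) ^ k * 2 ^ (j + k) * fact j * fact k) =
     (\<Prod>i<2 * (j + k) + 1. x + 2 * real j + 1 - real i)"
proof (induction k)
  case 0
  show ?case
  proof (induction j)
    case (Suc j)
    have e: "2 * (Suc j + 0) + 1 = Suc (Suc (2 * (j + 0) + 1))" by simp
    have step: "(\<Prod>i<2 * (Suc j + 0) + 1. x + 2 * real (Suc j) + 1 - real i) =
      (x + 2 * real j + 3) * (x + 2 * real j + 2) * (\<Prod>i<2 * (j + 0) + 1. x + 2 * real j + 1 - real i)"
      unfolding e prod.lessThan_Suc_shift by (simp add: algebra_simps)
    show ?case unfolding step Suc.IH[symmetric] by (simp add: field_simps)
  qed simp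
next
  case (Suc k)
  have e: "2 * (j + Suc k) + 1 = Suc (Suc (2 * (j + k) + 1))" by simp
  have "(\<Prod>i<2 * (j + Suc k) + 1. x + 2 * real j + 1 - real i) =
     (\<Prod>i<2 * (j + k) + 1. x + 2 * real j + 1 - real i) * ((x - 2 * real k) * (x - 2 * real k - 1))"
    (is "?L = ?P * _")
    unfolding e prod.lessThan_Suc by (simp add: algebra_simps)
  also have "\<dots> = (x + 2 * real j + 1) * (rise1 j * ((x - 2 * real k) * fall0 k)) * (x - 2 * real k - 1) *
      ((- 1) ^ k * 2 ^ (j + k) * fact j * fact k)"
    unfolding Suc.IH[symmetric] by (simp add: mult_ac)
  finally have step: "?L = (x + 2 * real j + 1) * (rise1 j * (x * fall1 k)) * (x - 2 * real k - 1) *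
      ((- 1) ^ k * 2 ^ (j + k) * fact j * fact k)" unfolding fall0_mult .
  show ?case unfolding step by (simp add: field_simps)
qed

end

section \<open>Generating functions in the natural number N substituted for \<open>x\<close>\<close>

unbundle fps_syntax

abbreviation geometric_fps :: "real fps" ("J") where
  "geometric_fps \<equiv> inverse (1 - fps_X)"

lemma fps_X_mult_geometric: "fps_X * J = J - 1"
proof -
  have "(1 - fps_X) * J = 1" by (rule inverse_mult_eq_1') simp
  then show ?thesis by (simp add: algebra_simps)
qed

lemma geometric_fps_power_nth: "J ^ Suc n $ i = real ((n + i) choose i)"
  using one_minus_const_fps_X_neg_power'[of "Suc n" "1 :: real"]
  by (simp add: fps_inverse_power[symmetric] del: power_Suc)

lemma fps_deriv_geometric_power: "fps_deriv (J ^ n) = of_nat n * J ^ Suc n"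
proof -
  have d: "fps_deriv J = J * J"
    by (subst fps_inverse_deriv) (simp_all add: power2_eq_square)
  show ?thesis by (induction n) (simp_all add: d algebra_simps)
qed

lemma fps_X_mult_deriv_nth: "(fps_X * fps_deriv F) $ N = real N * F $ N"
  by (cases N) simp_all

text \<open>The coefficient of order \<open>N\<close> turns out to be the mean of \<open>N\<close> to the power of the number of vertices.\<close>

definition one_polygon_fps :: "nat \<Rightarrow> real fps" where
  "one_polygon_fps m = fps_X * (1 + fps_X) ^ m * J ^ (m + 2)"

text \<open>After division by the common factor \<open>C\<close>, everything is a polynomial in
  \<open>J\<close>, since \<open>fps_X * J\<close> and \<open>(1 + fps_X) * J\<close> are affine in
  \<open>J\<close>. The Euler operator \<open>fps_X * fps_deriv\<close> multiplies the coefficient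
  of order N by N, which is the effect of one more vertex on \<open>N ^ k\<close>.\<close>

lemma one_polygon_fps_recurrence:
  "of_nat (k + 3) * one_polygon_fps (k + 2) =
     2 * (fps_X * fps_deriv (one_polygon_fps (k + 1))) + of_nat (k + 1) * one_polygon_fps k"
proof -
  define C where "C = fps_X * (1 + fps_X) ^ k * J ^ (k + 2)"
  have XJ: "fps_X * J = J - 1" by (rule fps_X_mult_geometric)
  have one: "(1 + fps_X) * J = 2 * J - 1" using XJ by (simp add: algebra_simps)
  have p2: "one_polygon_fps (k + 2) = C * ((1 + fps_X) * J) ^ 2"
    by (simp add: one_polygon_fps_def C_def power_add power2_eq_square algebra_simps)
  have p1: "fps_X * fps_deriv (one_polygon_fps (k + 1)) =
     C * ((1 + fps_X) * J + of_nat (k + 1) * (fps_X * J) + of_nat (k + 3) * ((fps_X * J) * ((1 + fps_X) * J)))"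
  proof -
    have "fps_deriv (one_polygon_fps (k + 1)) = (1 + fps_X) ^ (k + 1) * J ^ (k + 3) +
       fps_X * (of_nat (k + 1) * (1 + fps_X) ^ k) * J ^ (k + 3) +
       fps_X * (1 + fps_X) ^ (k + 1) * (of_nat (k + 3) * J ^ (k + 4))"
    proof -
      have e: "k + 1 + 2 = k + 3" "Suc (k + 3) = k + 4" by simp_all
      have "fps_deriv ((1 + fps_X :: real fps) ^ (k + 1)) = of_nat (k + 1) * (1 + fps_X) ^ k"
        by (simp only: fps_deriv_power') simp
      then show ?thesis
        unfolding one_polygon_fps_def fps_deriv_mult e fps_deriv_geometric_power by (simp add: algebra_simps)
    qed
    then show ?thesis by (simp add: C_def power_add algebra_simps eval_nat_numeral)
  qed
  show ?thesis
    unfolding p2 p1 XJ one one_polygon_fps_def[of k] C_def[symmetric]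
    by (simp add: algebra_simps power2_eq_square)
qed

lemma one_polygon_fps_nth_recurrence:
  "real (k + 3) * one_polygon_fps (k + 2) $ N =
     2 * real N * one_polygon_fps (k + 1) $ N + real (k + 1) * one_polygon_fps k $ N"
proof -
  have n: "(of_nat a * F) $ N = real a * F $ N" for a and F :: "real fps"
    by (simp add: fps_of_nat[symmetric] del: fps_of_nat)
  have "(of_nat (k + 3) * one_polygon_fps (k + 2)) $ N =
     (of_nat 2 * (fps_X * fps_deriv (one_polygon_fps (k + 1))) + of_nat (k + 1) * one_polygon_fps k) $ N"
    unfolding one_polygon_fps_recurrence by simp
  then show ?thesis unfolding n fps_add_nth fps_X_mult_deriv_nth by simp
qed

text \<open>The factors \<open>N\<close> and \<open>k\<close> both come from the Euler operator, so
  the sum over \<open>k\<close> reduces to \<open>B = (1 - fps_X\<^sup>2) ^ M\<close> and its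
  derivative.\<close>

lemma one_polygon_fps_binomial_sum:
  "(\<Sum>k\<le>M. (- 1) ^ k * real (M choose k) *
      (real N * (fps_X ^ (2 * k) * J ^ (2 * M + 2)) $ N -
       real (2 * (M - k) + 1) * (fps_X ^ (2 * k + 1) * J ^ (2 * M + 2)) $ N)) = one_polygon_fps (Suc M) $ N"
proof -
  define s where "s k = fps_const ((- 1) ^ k * real (M choose k))" for k
  define B where "B = (\<Sum>k\<le>M. s k * fps_X ^ (2 * k))"
  let ?K = "J ^ (2 * M + 2)"
  have B: "B = (1 - fps_X\<^sup>2) ^ M"
  proof -
    have "(1 - fps_X\<^sup>2) ^ M = ((- (fps_X\<^sup>2) + 1) ^ M :: real fps)" by simp
    also have "\<dots> = (\<Sum>k\<le>M. of_nat (M choose k) * (- (fps_X\<^sup>2)) ^ k * 1 ^ (M - k))"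
      by (rule binomial_ring)
    also have "\<dots> = B" unfolding B_def s_def
    proof (rule sum.cong[OF refl])
      fix k :: nat
      have "(- (fps_X\<^sup>2) :: real fps) ^ k = (- 1) ^ k * fps_X ^ (2 * k)"
        by (subst power_minus) (simp add: power_mult)
      moreover have "fps_const ((- 1) ^ k * real (M choose k)) = (- 1) ^ k * of_nat (M choose k)"
        by (simp add: fps_of_nat[symmetric] fps_const_power[symmetric] fps_const_neg[symmetric] fps_const_mult[symmetric]
              del: fps_of_nat fps_const_power fps_const_neg fps_const_mult)
      ultimately show "of_nat (M choose k) * (- (fps_X\<^sup>2)) ^ k * 1 ^ (M - k) =
         fps_const ((- 1) ^ k * real (M choose k)) * fps_X ^ (2 * k)" by (simp add: mult_ac)
    qed
    finally show ?thesis by simp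
  qed
  have XB: "(\<Sum>k\<le>M. s k * of_nat (2 * k) * fps_X ^ (2 * k)) = fps_X * fps_deriv B"
  proof -
    have "fps_X * fps_deriv (s k * fps_X ^ (2 * k)) = s k * of_nat (2 * k) * fps_X ^ (2 * k)" for k
      by (rule fps_ext) (simp only: fps_X_mult_deriv_nth,
          simp add: s_def fps_of_nat[symmetric] mult.assoc del: fps_of_nat)
    then show ?thesis unfolding B_def fps_deriv_sum sum_distrib_left by simp
  qed
  define S where "S = fps_X * fps_deriv (B * ?K) - fps_X * ?K * (of_nat (2 * M + 1) * B - fps_X * fps_deriv B)"
  have "(\<Sum>k\<le>M. (- 1) ^ k * real (M choose k) *
      (real N * (fps_X ^ (2 * k) * ?K) $ N - real (2 * (M - k) + 1) * (fps_X ^ (2 * k + 1) * ?K) $ N)) =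
     (\<Sum>k\<le>M. s k * (fps_X * fps_deriv (fps_X ^ (2 * k) * ?K) - of_nat (2 * (M - k) + 1) * (fps_X ^ (2 * k + 1) * ?K))) $ N"
  proof -
    have n: "(of_nat a * F) $ N = real a * F $ N" for a and F :: "real fps"
      by (simp add: fps_of_nat[symmetric] del: fps_of_nat)
    show ?thesis unfolding fps_sum_nth s_def fps_mult_left_const_nth fps_sub_nth n fps_X_mult_deriv_nth ..
  qed
  also have "(\<Sum>k\<le>M. s k * (fps_X * fps_deriv (fps_X ^ (2 * k) * ?K) - of_nat (2 * (M - k) + 1) * (fps_X ^ (2 * k + 1) * ?K))) = S"
  proof -
    have "fps_X * fps_deriv (B * ?K) = (\<Sum>k\<le>M. s k * (fps_X * fps_deriv (fps_X ^ (2 * k) * ?K)))"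
    proof -
      have d: "fps_deriv (s k * (fps_X ^ (2 * k) * ?K)) = s k * fps_deriv (fps_X ^ (2 * k) * ?K)" for k
        unfolding s_def by (rule fps_deriv_mult_const_left)
      have "fps_deriv (B * ?K) = (\<Sum>k\<le>M. s k * fps_deriv (fps_X ^ (2 * k) * ?K))"
        unfolding B_def sum_distrib_right fps_deriv_sum mult.assoc d ..
      then show ?thesis
        unfolding sum_distrib_left by (simp only: sum_distrib_left) (rule sum.cong, simp, simp only: mult_ac)
    qed
    moreover have "of_nat (2 * M + 1) * B - fps_X * fps_deriv B = (\<Sum>k\<le>M. s k * of_nat (2 * (M - k) + 1) * fps_X ^ (2 * k))"
      unfolding XB[symmetric] unfolding B_def sum_distrib_left sum_subtractf[symmetric]
    proof (rule sum.cong[OF refl])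
      fix k assume "k \<in> {..M}"
      then have "2 * M + 1 = 2 * (M - k) + 1 + 2 * k" by auto
      then have "(of_nat (2 * M + 1) :: real fps) = of_nat (2 * (M - k) + 1) + of_nat (2 * k)"
        by (metis of_nat_add)
      then show "of_nat (2 * M + 1) * (s k * fps_X ^ (2 * k)) - s k * of_nat (2 * k) * fps_X ^ (2 * k) =
         s k * of_nat (2 * (M - k) + 1) * fps_X ^ (2 * k)" by (simp only:) (simp add: algebra_simps)
    qed
    ultimately show ?thesis unfolding S_def
      by (simp only: sum_distrib_left sum_subtractf[symmetric])
         (rule sum.cong, simp, simp only: power_add power_one_right, simp add: algebra_simps)
  qed
  also have "S = one_polygon_fps (Suc M)"
  proof -
    have XJ: "fps_X * J = J - 1" by (rule fps_X_mult_geometric)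
    have one: "(1 + fps_X) * J = 2 * J - 1" using XJ by (simp add: algebra_simps)
    have unit: "(1 - fps_X) * J = 1" using XJ by (simp add: algebra_simps)
    \<comment> \<open>Multiplication by \<open>1 + fps_X\<close> restores the missing power of
      \<open>1 - fps_X\<^sup>2\<close> up to a factor \<open>J\<close>, so that no exponent
      \<open>M - 1\<close> remains.\<close>
    have DB: "(1 + fps_X) * fps_deriv B = - (of_nat (2 * M) * (fps_X * J) * B)"
    proof (cases M)
      case 0
      then show ?thesis by (simp add: B)
    next
      case (Suc M')
      have a1: "fps_deriv B = of_nat M * (- (2 * fps_X)) * (1 - fps_X\<^sup>2) ^ M'"
        unfolding B Suc fps_deriv_power' by (simp add: power2_eq_square algebra_simps)
      have a2: "J * B = (1 + fps_X) * ((1 - fps_X) * J) * (1 - fps_X\<^sup>2) ^ M'"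
        unfolding B Suc by (simp add: power2_eq_square algebra_simps)
      have "of_nat (2 * M) * (fps_X * J) * B = of_nat (2 * M) * fps_X * (J * B)"
        by (simp only: mult_ac)
      then show ?thesis unfolding a1 a2 unit by (simp add: algebra_simps)
    qed
    have "S = ?K * (fps_X * ((1 + fps_X) * fps_deriv B)) + fps_X * B * ?K * (of_nat (2 * M + 2) * J - of_nat (2 * M + 1))"
      unfolding S_def fps_deriv_mult fps_deriv_geometric_power power_Suc[of J "2 * M + 2"] by (simp add: algebra_simps)
    also have "\<dots> = fps_X * B * ?K * (- (of_nat (2 * M) * (fps_X * J)) + of_nat (2 * M + 2) * J - of_nat (2 * M + 1))"
      unfolding DB by (simp add: algebra_simps)
    also have "\<dots> = fps_X * B * ?K * ((1 + fps_X) * J)"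
      unfolding XJ one by (simp add: algebra_simps)
    also have "B = (1 + fps_X) ^ M * (1 - fps_X) ^ M"
      unfolding B power_mult_distrib[symmetric] by (simp add: power2_eq_square algebra_simps)
    also have "fps_X * ((1 + fps_X) ^ M * (1 - fps_X) ^ M) * ?K * ((1 + fps_X) * J) =
       ((1 - fps_X) * J) ^ M * (fps_X * (1 + fps_X) ^ Suc M * J ^ (Suc M + 2))"
    proof -
      have "?K * J = J ^ M * J ^ (Suc M + 2)" by (simp add: mult_2 flip: power_add power_Suc2)
      then show ?thesis unfolding power_mult_distrib by (simp add: mult_ac)
    qed
    also have "\<dots> = one_polygon_fps (Suc M)" unfolding unit one_polygon_fps_def by simp
    finally show ?thesis .
  qed
  finally show ?thesis .
qed

lemma fact_mult_binomial: "(\<Prod>i<n. real a - real i) = fact n * real (a choose n)"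
  using gbinomial_mult_fact[of n "real a"] by (simp add: binomial_gbinomial atLeast0LessThan)

text \<open>Introducing \<open>a\<close> avoids a truncated \<open>N - l\<close>; for
  \<open>N < l\<close> both sides vanish, since then \<open>a < n\<close>.\<close>

lemma fps_X_power_geometric_nth:
  assumes "a + l = N + n"
  shows "(fps_X ^ l * J ^ Suc n) $ N = real (a choose n)"
proof (cases "N < l")
  case True
  then show ?thesis using assms by (simp add: fps_X_power_mult_nth del: power_Suc)
next
  case False
  then have "a = n + (N - l)" using assms by simp
  moreover have "(n + (N - l)) choose (N - l) = (n + (N - l)) choose n"
    by (subst binomial_symmetric) simp_all
  ultimately show ?thesis using False
    by (simp add: fps_X_power_mult_nth geometric_fps_power_nth del: power_Suc)
qed

text \<open>The double factorial \<open>(2 m - 1)!!\<close>, the number of perfect matchings of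
  \<open>2 * m\<close> points.\<close>

definition pairings :: "nat \<Rightarrow> real" where
  "pairings m = fact (2 * m) / (2 ^ m * fact m)"

lemma pairings_Suc: "pairings (Suc m) = (2 * real m + 1) * pairings m"
proof -
  have "pairings (Suc m) = (2 * (real m + 1)) * ((2 * real m + 1) * fact (2 * m)) /
      ((2 * (real m + 1)) * (2 ^ m * fact m))"
    by (simp add: pairings_def algebra_simps)
  also have "\<dots> = (2 * real m + 1) * fact (2 * m) / (2 ^ m * fact m)"
    by (rule nonzero_mult_divide_mult_cancel_left) (simp add: add_eq_0_iff)
  finally show ?thesis by (simp add: pairings_def)
qed


text \<open>For natural \<open>x\<close> the falling factorials are binomial coefficients, hence
  coefficients of \<open>fps_X ^ l * J ^ (2 * M + 2)\<close>. Natural values are enough to identify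
  polynomials later.\<close>

lemma (in loop_equations) one_polygon_eq_fps:
  assumes x: "x = real N"
  shows "f {#2 * m#} = pairings m * one_polygon_fps m $ N"
proof (cases m)
  case 0
  have "f {#0#} = x" using zero[of "{#}"] by (simp add: empty)
  moreover have "one_polygon_fps 0 $ N = real N"
  proof -
    have "(J * J) $ i = real (Suc i)" for i
      using geometric_fps_power_nth[of 1 i] by simp
    then show ?thesis by (cases N) (simp_all add: one_polygon_fps_def)
  qed
  ultimately show ?thesis using 0 x by (simp add: pairings_def)
next
  case (Suc M)
  let ?K = "J ^ (2 * M + 2)"
  let ?c = "fact (2 * M + 1) / (2 ^ M * fact M) :: real"
  have summand: "x * (rise1 (M - k) *
      ((x + 2 * real (M - k) + 1) * fall0 k - (2 * real (M - k) + 1) * fall1 k)) =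
     ?c * ((- 1) ^ k * real (M choose k) *
      (real N * (fps_X ^ (2 * k) * ?K) $ N - real (2 * (M - k) + 1) * (fps_X ^ (2 * k + 1) * ?K) $ N))"
    if k: "k \<le> M" for k
  proof -
    define j where "j = M - k"
    have M: "j + k = M" "2 * M + 2 = Suc (2 * M + 1)" using k by (auto simp: j_def)
    \<comment> \<open>The signed common denominator that turns both products of
      \<open>rise1 j\<close> with \<open>fall0 k\<close> or \<open>fall1 k\<close> into falling
      factorials.\<close>
    define D :: real where "D = (- 1) ^ k * 2 ^ M * fact j * fact k"
    have D: "D \<noteq> 0" by (simp add: D_def)
    have "real (fact k * fact (M - k) * (M choose k)) = real (fact M)"
      by (simp only: binomial_fact_lemma[OF k])
    then have fM: "fact k * fact j * real (M choose k) = (fact M :: real)"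
      by (simp add: j_def)
    have "?c * ((- 1) ^ k * real (M choose k)) * D =
        ?c * 2 ^ M * (((- 1) ^ k * (- 1) ^ k) * (fact k * fact j * real (M choose k)))"
      by (simp add: D_def mult_ac)
    also have "(- 1 :: real) ^ k * (- 1) ^ k = 1" by (simp flip: power_mult_distrib)
    also have "?c * 2 ^ M * (1 * (fact k * fact j * real (M choose k))) = fact (2 * M + 1)"
      unfolding fM by (simp del: fact_Suc)
    finally have c: "?c * ((- 1) ^ k * real (M choose k)) * D = fact (2 * M + 1)" .
    have e0: "(fps_X ^ (2 * k) * ?K) $ N = real ((N + 2 * j + 1) choose (2 * M + 1))"
      unfolding M(2) by (rule fps_X_power_geometric_nth) (use M in simp)
    have e1: "(fps_X ^ (2 * k + 1) * ?K) $ N = real ((N + 2 * j) choose (2 * M + 1))"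
      unfolding M(2) by (rule fps_X_power_geometric_nth) (use M in simp)
    have a0: "real (N + 2 * j + 1) = x + 2 * real j + 1" and a1: "real (N + 2 * j) = x + 2 * real j"
      by (simp_all add: x)
    have p0: "(x + 2 * real j + 1) * (rise1 j * fall0 k) * D = fact (2 * M + 1) * (fps_X ^ (2 * k) * ?K) $ N"
      using rise1_fall0_prod[of j k] fact_mult_binomial[of "N + 2 * j + 1" "2 * M + 1"]
      unfolding M(1) e0 a0 D_def by (simp only:)
    have p1: "x * (rise1 j * fall1 k) * D = fact (2 * M + 1) * (fps_X ^ (2 * k + 1) * ?K) $ N"
      using rise1_fall1_prod[of j k] fact_mult_binomial[of "N + 2 * j" "2 * M + 1"]
      unfolding M(1) e1 a1 D_def by (simp only:)
    define U0 U1 where "U0 = (fps_X ^ (2 * k) * ?K) $ N" and "U1 = (fps_X ^ (2 * k + 1) * ?K) $ N"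
    have "x * (rise1 j * ((x + 2 * real j + 1) * fall0 k - (2 * real j + 1) * fall1 k)) * D =
      x * ((x + 2 * real j + 1) * (rise1 j * fall0 k) * D) - (2 * real j + 1) * (x * (rise1 j * fall1 k) * D)"
      by (simp add: algebra_simps)
    also have "\<dots> = (real N * (fps_X ^ (2 * k) * ?K) $ N -
       real (2 * j + 1) * (fps_X ^ (2 * k + 1) * ?K) $ N) * fact (2 * M + 1)"
      unfolding p0 p1 U0_def[symmetric] U1_def[symmetric] by (simp add: x algebra_simps del: fact_Suc)
    also have "\<dots> = (?c * ((- 1) ^ k * real (M choose k)) * D) * (real N * (fps_X ^ (2 * k) * ?K) $ N -
       real (2 * j + 1) * (fps_X ^ (2 * k + 1) * ?K) $ N)"
      unfolding c by (rule mult.commute)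
    also have "\<dots> = ?c * ((- 1) ^ k * real (M choose k)) * (real N * (fps_X ^ (2 * k) * ?K) $ N -
       real (2 * j + 1) * (fps_X ^ (2 * k + 1) * ?K) $ N) * D"
      by (simp only: mult_ac)
    finally have "x * (rise1 j * ((x + 2 * real j + 1) * fall0 k - (2 * real j + 1) * fall1 k)) =
        ?c * ((- 1) ^ k * real (M choose k)) * (real N * (fps_X ^ (2 * k) * ?K) $ N -
       real (2 * j + 1) * (fps_X ^ (2 * k + 1) * ?K) $ N)"
      using D by (simp only: mult_cancel_right) simp
    then show ?thesis unfolding j_def by (simp only: mult.assoc)
  qed
  have "f {#2 * m#} = (\<Sum>k\<le>M. ?c * ((- 1) ^ k * real (M choose k) *
      (real N * (fps_X ^ (2 * k) * ?K) $ N - real (2 * (M - k) + 1) * (fps_X ^ (2 * k + 1) * ?K) $ N)))"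
    unfolding Suc one_polygon_value sum_distrib_left by (rule sum.cong[OF refl], rule summand) simp
  also have "\<dots> = ?c * one_polygon_fps m $ N"
    unfolding sum_distrib_left[symmetric] one_polygon_fps_binomial_sum Suc ..
  also have "?c = pairings m"
    unfolding Suc pairings_Suc by (simp add: pairings_def)
  finally show ?thesis .
qed

lemma card_fixpoint_free_involutions:
  "finite A \<Longrightarrow> card A = 2 * m \<Longrightarrow> real (card (fixpoint_free_involutions A)) = pairings m"
proof (induction m arbitrary: A)
  case 0
  then have "A = {}" by simp
  moreover have "fixpoint_free_involutions {} = {id :: 'a \<Rightarrow> 'a}"
    by (auto simp: fixpoint_free_involutions_iff)
  ultimately show ?case by (simp add: pairings_def)
next
  case (Suc m)
  then obtain s where s: "s \<in> A" by (metis card.empty ex_in_conv mult_is_0 nat.simps(3) zero_neq_numeral)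
  have IH: "real (card (fixpoint_free_involutions (A - {s, t}))) = pairings m" if "t \<in> A - {s}" for t
  proof (rule Suc.IH)
    have "card {s, t} = 2" using that by auto
    then show "card (A - {s, t}) = 2 * m"
      using Suc.prems s that by (subst card_Diff_subset) auto
  qed (use Suc.prems in simp)
  have "real (card (fixpoint_free_involutions A)) = (\<Sum>t\<in>A - {s}. real (card (fixpoint_free_involutions (A - {s, t}))))"
    using sum_fixpoint_free_involutions_remove[OF s Suc.prems(1), of "\<lambda>_. 1"] by simp
  also have "\<dots> = (2 * real m + 1) * pairings m"
    using IH s Suc.prems by simp
  also have "\<dots> = pairings (Suc m)"
    by (simp add: pairings_Suc)
  finally show ?case .
qed

lemma pairings_pos: "pairings m > 0"
  by (simp add: pairings_def)

section \<open>Normalised means and the Harer-Zagier recurrence\<close>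

lemma vertex_sum_linear:
  "vertex_sum P (\<lambda>k. a * g k + b * h k) = a * vertex_sum P g + b * vertex_sum P h"
  by (simp add: vertex_sum_def gluing_sum_def sum.distrib sum_distrib_left)

lemma vertex_sum_mult: "vertex_sum P (\<lambda>k. a * g k) = a * vertex_sum P g"
  using vertex_sum_linear[of P a g 0 g] by simp

text \<open>As the weights do not depend on \<open>g\<close>, an identity for the functions
  \<open>N ^ k\<close> becomes one between polynomials in N.\<close>

lemma vertex_sum_weights: "\<exists>c B. \<forall>g. vertex_sum P g = (\<Sum>k\<le>B. c k * g k)"
proof (intro exI allI)
  fix g
  let ?A = "sides P"
  let ?B = "card ?A + count P 0"
  let ?V = "\<lambda>\<omega>. card (cycles_on ?A (next_side \<circ> \<omega>)) + count P 0"
  have "?V \<omega> \<le> ?B" for \<omega>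
    unfolding cycles_on_def using card_image_le[OF finite_sides] by simp
  then have "vertex_sum P g = (\<Sum>k\<le>?B. \<Sum>\<omega>\<in>{\<omega> \<in> fixpoint_free_involutions ?A. ?V \<omega> = k}. g (?V \<omega>))"
    unfolding vertex_sum_def gluing_sum_def
    by (intro sum.group[symmetric]) (auto simp: finite_fixpoint_free_involutions finite_sides)
  then show "vertex_sum P g = (\<Sum>k\<le>?B. real (card {\<omega> \<in> fixpoint_free_involutions ?A. ?V \<omega> = k}) * g k)"
    by simp
qed

definition gluing_mean :: "nat multiset \<Rightarrow> (nat \<Rightarrow> real) \<Rightarrow> real" where
  "gluing_mean P g = vertex_sum P g / pairings (half_perimeter P)"

lemma gluing_mean_linear:
  "gluing_mean P (\<lambda>k. a * g k + b * h k) = a * gluing_mean P g + b * gluing_mean P h"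
  by (simp add: gluing_mean_def vertex_sum_linear add_divide_distrib)

lemma gluing_mean_nonneg:
  assumes "\<And>k. 0 \<le> g k"
  shows "0 \<le> gluing_mean P g"
  unfolding gluing_mean_def vertex_sum_def gluing_sum_def
  by (rule divide_nonneg_pos[OF _ pairings_pos], rule sum_nonneg, rule assms)

lemma gluing_mean_one:
  assumes "even (\<Sum>\<^sub># P)"
  shows "gluing_mean P (\<lambda>k. 1) = 1"
  using card_fixpoint_free_involutions[OF finite_sides, of P "half_perimeter P"] assms pairings_pos[of "half_perimeter P"]
  by (simp add: gluing_mean_def vertex_sum_def gluing_sum_def card_sides half_perimeter_def)

lemma gluing_mean_zero_polygon: "gluing_mean (add_mset 0 P) g = gluing_mean P (\<lambda>k. g (Suc k))"
  by (simp add: gluing_mean_def half_perimeter_def vertex_sum_zero)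

text \<open>The ratio of \<open>pairings (Suc m)\<close> to \<open>pairings m\<close> is
  \<open>2 m + 1\<close>, the number of possible partners of a side.\<close>

lemma gluing_mean_peel:
  assumes p: "p \<ge> 1" and m: "\<Sum>\<^sub># (add_mset p R) = 2 * Suc m"
  shows "(2 * real m + 1) * gluing_mean (add_mset p R) g =
           (\<Sum>d<p - 1. gluing_mean (add_mset d (add_mset (p - 2 - d) R)) g) +
           (\<Sum>q\<in>#R. real q * gluing_mean (add_mset (p + q - 2) (R - {#q#})) g)"
proof -
  let ?c = "pairings m"
  have c: "?c > 0" by (rule pairings_pos)
  have h: "half_perimeter (add_mset p R) = Suc m" using m by (simp add: half_perimeter_def)
  have 1: "vertex_sum (add_mset d (add_mset (p - 2 - d) R)) g =
      ?c * gluing_mean (add_mset d (add_mset (p - 2 - d) R)) g" if "d < p - 1" for d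
  proof -
    have "\<Sum>\<^sub># (add_mset d (add_mset (p - 2 - d) R)) = 2 * m" using that m by simp
    then show ?thesis using c by (simp add: gluing_mean_def half_perimeter_def)
  qed
  have 2: "real q * vertex_sum (add_mset (p + q - 2) (R - {#q#})) g =
      ?c * (real q * gluing_mean (add_mset (p + q - 2) (R - {#q#})) g)" if "q \<in># R" for q
  proof (cases "q = 0")
    case False
    have "q + \<Sum>\<^sub># (R - {#q#}) = \<Sum>\<^sub># R" using that by (auto dest: multi_member_split)
    then have "\<Sum>\<^sub># (add_mset (p + q - 2) (R - {#q#})) = 2 * m" using that m False p by simp
    then show ?thesis using c by (simp add: gluing_mean_def half_perimeter_def)
  qed simp
  have "vertex_sum (add_mset p R) g =
      (\<Sum>d<p - 1. ?c * gluing_mean (add_mset d (add_mset (p - 2 - d) R)) g) +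
      (\<Sum>q\<in>#R. ?c * (real q * gluing_mean (add_mset (p + q - 2) (R - {#q#})) g))"
  proof -
    have "(\<Sum>d<p - 1. vertex_sum (add_mset d (add_mset (p - 2 - d) R)) g) =
      (\<Sum>d<p - 1. ?c * gluing_mean (add_mset d (add_mset (p - 2 - d) R)) g)"
      by (rule sum.cong[OF refl], rule 1) simp
    moreover have "(\<Sum>q\<in>#R. real q * vertex_sum (add_mset (p + q - 2) (R - {#q#})) g) =
      (\<Sum>q\<in>#R. ?c * (real q * gluing_mean (add_mset (p + q - 2) (R - {#q#})) g))"
      by (rule arg_cong[of _ _ sum_mset], rule image_mset_cong, rule 2)
    ultimately show ?thesis unfolding vertex_sum_peel[OF p] by simp
  qed
  also have "\<dots> = ?c * ((\<Sum>d<p - 1. gluing_mean (add_mset d (add_mset (p - 2 - d) R)) g) +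
      (\<Sum>q\<in>#R. real q * gluing_mean (add_mset (p + q - 2) (R - {#q#})) g))"
    by (simp only: sum_distrib_left sum_mset_distrib_left distrib_left)
  finally show ?thesis
    using c h by (simp add: gluing_mean_def pairings_Suc)
qed

lemma loop_equations_vertex_sum: "loop_equations (\<lambda>P. vertex_sum P (\<lambda>k. x ^ k)) x"
proof
  fix p R
  show "vertex_sum (add_mset 0 R) (\<lambda>k. x ^ k) = x * vertex_sum R (\<lambda>k. x ^ k)"
    by (simp add: vertex_sum_zero vertex_sum_mult)
  show "vertex_sum (add_mset (Suc p) R) (\<lambda>k. x ^ k) = peel_sum p (\<lambda>P. vertex_sum P (\<lambda>k. x ^ k)) R"
    unfolding peel_sum_def by (subst vertex_sum_peel) (simp_all add: diff_diff_left add.commute)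
qed simp

lemma gluing_mean_one_polygon_power: "gluing_mean {#2 * m#} (\<lambda>k. real N ^ k) = one_polygon_fps m $ N"
  using loop_equations.one_polygon_eq_fps[OF loop_equations_vertex_sum refl, of m N] pairings_pos[of m]
  by (simp add: gluing_mean_def half_perimeter_def)

text \<open>The difference of the two sides is a combination of values of \<open>g\<close> with
  weights \<open>d\<close> independent of \<open>g\<close>. For \<open>g k = N ^ k\<close> it
  vanishes by the recurrence of the power series, so the polynomial with coefficients
  \<open>d\<close> has all natural numbers as roots.\<close>

lemma harer_zagier_recurrence:
  "real (k + 3) * gluing_mean {#2 * (k + 2)#} g =
     2 * gluing_mean {#2 * (k + 1)#} (\<lambda>j. g (Suc j)) + real (k + 1) * gluing_mean {#2 * k#} g"
proof -
  have weights: "\<exists>c B. \<forall>g. gluing_mean P g = (\<Sum>k\<le>B. c k * g k)" for P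
  proof -
    obtain c B where "\<And>g. vertex_sum P g = (\<Sum>k\<le>B. c k * g k)" using vertex_sum_weights by metis
    then show ?thesis
      by (intro exI[of _ "\<lambda>k. c k / pairings (half_perimeter P)"] exI[of _ B])
         (simp add: gluing_mean_def sum_divide_distrib)
  qed
  have extend: "(\<Sum>k\<le>B. c k * g k) = (\<Sum>k\<le>B'. (if k \<le> B then c k else 0) * g k)" if "B \<le> B'"
    for c g :: "nat \<Rightarrow> real" and B B' :: nat
    using that by (intro sum.mono_neutral_cong_left) auto
  obtain c2 B2 where c2: "\<And>g. gluing_mean {#2 * (k + 2)#} g = (\<Sum>k\<le>B2. c2 k * g k)" using weights by metis
  obtain c1 B1 where c1: "\<And>g. gluing_mean {#2 * (k + 1)#} g = (\<Sum>k\<le>B1. c1 k * g k)" using weights by metis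
  obtain c0 B0 where c0: "\<And>g. gluing_mean {#2 * k#} g = (\<Sum>k\<le>B0. c0 k * g k)" using weights by metis
  define B where "B = B2 + Suc B1 + B0"
  define c1' where "c1' j = (case j of 0 \<Rightarrow> 0 | Suc i \<Rightarrow> c1 i)" for j
  have c1': "gluing_mean {#2 * (k + 1)#} (\<lambda>j. g (Suc j)) = (\<Sum>j\<le>Suc B1. c1' j * g j)" for g
    unfolding c1 by (subst sum.atMost_Suc_shift) (simp add: c1'_def)
  define d where "d j = real (k + 3) * (if j \<le> B2 then c2 j else 0) - 2 * (if j \<le> Suc B1 then c1' j else 0)
     - real (k + 1) * (if j \<le> B0 then c0 j else 0)" for j
  have L: "real (k + 3) * gluing_mean {#2 * (k + 2)#} g -
     2 * gluing_mean {#2 * (k + 1)#} (\<lambda>j. g (Suc j)) - real (k + 1) * gluing_mean {#2 * k#} g =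
     (\<Sum>j\<le>B. d j * g j)" for g
  proof -
    have "B2 \<le> B" "Suc B1 \<le> B" "B0 \<le> B" by (auto simp: B_def)
    then show ?thesis
      unfolding c2 c1' c0 extend[OF \<open>B2 \<le> B\<close>] extend[OF \<open>Suc B1 \<le> B\<close>] extend[OF \<open>B0 \<le> B\<close>] d_def
      by (simp add: sum_distrib_left sum_subtractf[symmetric] left_diff_distrib mult.assoc)
  qed
  have "(\<Sum>j\<le>B. d j * real N ^ j) = 0" for N
  proof -
    have "gluing_mean {#2 * (k + 1)#} (\<lambda>j. real N ^ Suc j) = real N * gluing_mean {#2 * (k + 1)#} (\<lambda>j. real N ^ j)"
      using gluing_mean_linear[of _ "real N" "\<lambda>j. real N ^ j" 0 "\<lambda>j. 0"] by simp
    then have "(\<Sum>j\<le>B. d j * real N ^ j) = real (k + 3) * one_polygon_fps (k + 2) $ N -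
      2 * (real N * one_polygon_fps (k + 1) $ N) - real (k + 1) * one_polygon_fps k $ N"
      unfolding L[symmetric] by (simp only: gluing_mean_one_polygon_power)
    then show ?thesis using one_polygon_fps_nth_recurrence[of k N] by simp
  qed
  then have "range real \<subseteq> {x. (\<Sum>j\<le>B. d j * x ^ j) = 0}" by auto
  moreover have "infinite (range real)" by (simp add: range_inj_infinite inj_of_nat)
  ultimately have "infinite {x. (\<Sum>j\<le>B. d j * x ^ j) = 0}" using finite_subset by blast
  then have "\<forall>j\<le>B. d j = 0" by (metis polyfun_finite_roots)
  then have "(\<Sum>j\<le>B. d j * g j) = 0" by simp
  then show ?thesis using L[of g] by simp
qed

lemma gluing_mean_one_polygon_0: "gluing_mean {#0#} g = g 1"
  by (simp add: gluing_mean_zero_polygon) (simp add: gluing_mean_def half_perimeter_def pairings_def)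

lemma gluing_mean_one_polygon_1: "gluing_mean {#2#} g = g 2"
proof -
  have "gluing_mean {#2#} g = gluing_mean {#0, 0#} g"
    using gluing_mean_peel[of 2 "{#}" 0 g] by simp
  also have "\<dots> = g 2"
    by (simp add: gluing_mean_zero_polygon) (simp add: gluing_mean_def half_perimeter_def pairings_def numeral_2_eq_2)
  finally show ?thesis .
qed

section \<open>Comparison of the one-polygon surface with Poisson laws\<close>

text \<open>The mean of \<open>g\<close> at a Poisson variable of rate \<open>h\<close>, as a power
  series in \<open>h\<close> in order to be differentiated termwise; the rate 0 is included.\<close>

definition poisson_mean :: "real \<Rightarrow> (nat \<Rightarrow> real) \<Rightarrow> real" where
  "poisson_mean h g = exp (- h) * (\<Sum>j. g j / fact j * h ^ j)"

text \<open>Values in the unit interval rather than indicators, since the class has to be stable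
  under averaging, as in \<open>one_polygon_mean_test_function\<close>.\<close>

definition test_function :: "(nat \<Rightarrow> real) \<Rightarrow> bool" where
  "test_function g \<longleftrightarrow> (\<forall>k. 0 \<le> g k \<and> g k \<le> 1)"

lemma test_functionI: "(\<And>k. 0 \<le> g k) \<Longrightarrow> (\<And>k. g k \<le> 1) \<Longrightarrow> test_function g"
  by (simp add: test_function_def)

lemma test_function_abs: "test_function g \<Longrightarrow> \<bar>g k\<bar> \<le> 1"
  by (simp add: test_function_def)

lemma test_function_comp: "test_function g \<Longrightarrow> test_function (\<lambda>k. g (f k))"
  by (simp add: test_function_def)

lemma test_function_if: "test_function g \<Longrightarrow> test_function (\<lambda>k. if P k then g k else 0)"
  by (simp add: test_function_def)

lemma poisson_weights_sums: "(\<lambda>j. h ^ j / fact j) sums exp (h :: real)"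
  using exp_converges[of h] by (simp add: field_simps)

lemma poisson_summable:
  fixes g :: "nat \<Rightarrow> real"
  assumes "\<And>j. \<bar>g j\<bar> \<le> C"
  shows "summable (\<lambda>j. g j / fact j * h ^ j)"
proof (rule summable_comparison_test')
  show "summable (\<lambda>j. C * (\<bar>h\<bar> ^ j / fact j))"
    using poisson_weights_sums[of "\<bar>h\<bar>"] by (intro summable_mult) (auto simp: sums_iff)
  show "norm (g j / fact j * h ^ j) \<le> C * (\<bar>h\<bar> ^ j / fact j)" for j
  proof -
    have "\<bar>g j\<bar> * (\<bar>h\<bar> ^ j / fact j) \<le> C * (\<bar>h\<bar> ^ j / fact j)"
      by (rule mult_right_mono[OF assms]) simp
    then show ?thesis by (simp add: abs_mult power_abs)
  qed
qed

lemma poisson_mean_const [simp]: "poisson_mean h (\<lambda>j. c) = c"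
proof -
  have "(\<lambda>j. c * (h ^ j / fact j)) sums (c * exp h)"
    by (rule sums_mult[OF poisson_weights_sums])
  then have "(\<Sum>j. c / fact j * h ^ j) = c * exp h" by (simp add: sums_iff)
  then show ?thesis by (simp add: poisson_mean_def exp_minus)
qed

lemma poisson_mean_linear:
  assumes "\<And>j. \<bar>f j\<bar> \<le> C" "\<And>j. \<bar>g j\<bar> \<le> D"
  shows "poisson_mean h (\<lambda>j. a * f j + b * g j) = a * poisson_mean h f + b * poisson_mean h g"
proof -
  note sf = poisson_summable[of f C h, OF assms(1)] and sg = poisson_summable[of g D h, OF assms(2)]
  have "(\<lambda>j. (a * f j + b * g j) / fact j * h ^ j) = (\<lambda>j. a * (f j / fact j * h ^ j) + b * (g j / fact j * h ^ j))"
    by (simp add: field_simps)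
  moreover have "(\<Sum>j. a * (f j / fact j * h ^ j) + b * (g j / fact j * h ^ j)) =
     a * (\<Sum>j. f j / fact j * h ^ j) + b * (\<Sum>j. g j / fact j * h ^ j)"
    unfolding suminf_mult[OF sf, symmetric] suminf_mult[OF sg, symmetric]
    by (rule suminf_add[symmetric]) (intro summable_mult sf sg)+
  ultimately show ?thesis unfolding poisson_mean_def by (simp add: algebra_simps)
qed

lemma poisson_mean_mono:
  assumes "h \<ge> 0" "\<And>j. \<bar>f j\<bar> \<le> C" "\<And>j. \<bar>g j\<bar> \<le> D" "\<And>j. f j \<le> g j"
  shows "poisson_mean h f \<le> poisson_mean h g"
  unfolding poisson_mean_def
proof (intro mult_left_mono suminf_le)
  show "f j / fact j * h ^ j \<le> g j / fact j * h ^ j" for j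
    using assms by (intro mult_right_mono divide_right_mono) auto
  show "summable (\<lambda>j. f j / fact j * h ^ j)" by (rule poisson_summable[of f C]) (rule assms)
  show "summable (\<lambda>j. g j / fact j * h ^ j)" by (rule poisson_summable[of g D]) (rule assms)
qed simp

lemma poisson_mean_test_function:
  assumes "h \<ge> 0" "test_function g"
  shows "0 \<le> poisson_mean h g" "poisson_mean h g \<le> 1"
  using poisson_mean_mono[of h "\<lambda>_. 0" 0 g 1] poisson_mean_mono[of h g 1 "\<lambda>_. 1" 1] assms
  by (auto simp: test_function_def)

lemma poisson_mean_0: "poisson_mean 0 g = g 0"
  unfolding poisson_mean_def powser_zero by simp

lemma Suc_divide_fact_Suc: "real (Suc j) / fact (Suc j) = 1 / fact j"
  by (simp del: of_nat_Suc)

lemma poisson_mean_has_derivative: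
  assumes "\<And>j. \<bar>g j\<bar> \<le> C"
  shows "((\<lambda>h. poisson_mean h g) has_real_derivative
           poisson_mean h (\<lambda>j. g (Suc j)) - poisson_mean h g) (at h)"
proof -
  have "((\<lambda>h. \<Sum>j. g j / fact j * h ^ j) has_field_derivative (\<Sum>j. diffs (\<lambda>j. g j / fact j) j * h ^ j)) (at h)"
    by (rule termdiffs_strong_converges_everywhere) (rule poisson_summable[of g C, OF assms])
  moreover have "diffs (\<lambda>j. g j / fact j) = (\<lambda>j. g (Suc j) / fact j)"
  proof
    fix j
    have "diffs (\<lambda>j. g j / fact j) j = (real (Suc j) / fact (Suc j)) * g (Suc j)"
      unfolding diffs_def by simp
    then show "diffs (\<lambda>j. g j / fact j) j = g (Suc j) / fact j"
      unfolding Suc_divide_fact_Suc by simp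
  qed
  ultimately have 1: "((\<lambda>h. \<Sum>j. g j / fact j * h ^ j) has_field_derivative (\<Sum>j. g (Suc j) / fact j * h ^ j)) (at h)"
    by simp
  show ?thesis
    unfolding poisson_mean_def
    by (rule derivative_eq_intros 1 refl)+ (simp add: algebra_simps)
qed

text \<open>The variance of \<open>j / h\<close>, without the normalisation
  \<open>exp (- h)\<close>, obtained from the factorial moments.\<close>

lemma poisson_second_moment:
  assumes "h > 0"
  shows "(\<lambda>j. (real j / h - 1)\<^sup>2 * (h ^ j / fact j)) sums (exp h / h)"
proof -
  let ?w = "\<lambda>j. h ^ j / fact j"
  have 0: "?w sums exp h" by (rule poisson_weights_sums)
  have e1: "real (Suc j) * ?w (Suc j) = h * ?w j" for j
  proof -
    have "real (Suc j) * ?w (Suc j) = (real (Suc j) / fact (Suc j)) * (h * h ^ j)" by simp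
    then show ?thesis unfolding Suc_divide_fact_Suc by simp
  qed
  have 1: "(\<lambda>j. real j * ?w j) sums (h * exp h)"
    using sums_Suc_iff[of "\<lambda>j. real j * ?w j" "h * exp h"] sums_mult[OF 0, of h] unfolding e1 by simp
  have e2: "real (Suc j) * (real (Suc j) - 1) * ?w (Suc j) = h * (real j * ?w j)" for j
    using e1[of j] by (simp add: mult.assoc mult.left_commute)
  have 2: "(\<lambda>j. real j * (real j - 1) * ?w j) sums (h * (h * exp h))"
    using sums_Suc_iff[of "\<lambda>j. real j * (real j - 1) * ?w j" "h * (h * exp h)"] sums_mult[OF 1, of h]
    unfolding e2 by simp
  have "(\<lambda>j. 1 / h\<^sup>2 * (real j * (real j - 1) * ?w j) + (1 / h\<^sup>2 - 2 / h) * (real j * ?w j) + ?w j)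
     sums (1 / h\<^sup>2 * (h * (h * exp h)) + (1 / h\<^sup>2 - 2 / h) * (h * exp h) + exp h)"
    by (intro sums_add sums_mult 0 1 2)
  moreover have "1 / h\<^sup>2 * (real j * (real j - 1) * ?w j) + (1 / h\<^sup>2 - 2 / h) * (real j * ?w j) + ?w j =
     (real j / h - 1)\<^sup>2 * ?w j" for j
  proof -
    have "1 / h\<^sup>2 * (real j * (real j - 1)) + (1 / h\<^sup>2 - 2 / h) * real j + 1 = (real j / h - 1)\<^sup>2"
      using assms by (simp add: field_simps power2_eq_square)
    then show ?thesis by (metis (no_types, lifting) distrib_right mult.assoc mult_1)
  qed
  moreover have "1 / h\<^sup>2 * (h * (h * exp h)) + (1 / h\<^sup>2 - 2 / h) * (h * exp h) + exp h = exp h / h"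
    using assms by (simp add: field_simps power2_eq_square)
  ultimately show ?thesis by simp
qed

text \<open>The weights of the Poisson law satisfy \<open>h * w (j - 1) = j * w j\<close>, so that shifting it changes the
  mean of \<open>g\<close> by at most the mean of \<open>\<bar>j / h - 1\<bar>\<close>, which the variance controls.\<close>

lemma poisson_mean_shift:
  assumes h: "h > 0" and g: "\<And>j. \<bar>g j\<bar> \<le> 1"
  shows "\<bar>poisson_mean h (\<lambda>j. g (Suc j)) - poisson_mean h g\<bar> \<le> 1 / sqrt h"
proof -
  let ?w = "\<lambda>j. h ^ j / fact j"
  define s where "s = sqrt h"
  have s: "s > 0" "s * s = h" using h by (auto simp: s_def)
  define S0 where "S0 = (\<Sum>j. g j / fact j * h ^ j)"
  define S1 where "S1 = (\<Sum>j. g (Suc j) / fact j * h ^ j)"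
  have 0: "(\<lambda>j. g j / fact j * h ^ j) sums S0"
    unfolding S0_def by (rule summable_sums, rule poisson_summable[of g 1, OF g])
  have 1: "(\<lambda>j. g (Suc j) / fact j * h ^ j) sums S1"
    unfolding S1_def by (rule summable_sums, rule poisson_summable[of _ 1]) (rule g)
  have "g (Suc j) / fact j * h ^ j = real (Suc j) / h * (g (Suc j) / fact (Suc j) * h ^ Suc j)" for j
  proof -
    have "real (Suc j) / h * (g (Suc j) / fact (Suc j) * h ^ Suc j) =
        (real (Suc j) / fact (Suc j)) * (g (Suc j) * h ^ j)" using h by simp
    then show ?thesis unfolding Suc_divide_fact_Suc by simp
  qed
  then have "(\<lambda>j. real (Suc j) / h * (g (Suc j) / fact (Suc j) * h ^ Suc j)) sums S1" using 1 by presburger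
  then have S1': "(\<lambda>j. real j / h * (g j / fact j * h ^ j)) sums S1"
    using sums_Suc_iff[of "\<lambda>j. real j / h * (g j / fact j * h ^ j)" S1] by simp
  have diff: "(\<lambda>j. g j * (real j / h - 1) * ?w j) sums (S1 - S0)"
    using sums_diff[OF S1' 0] by (simp add: algebra_simps)
  \<comment> \<open>The Cauchy-Schwarz inequality in the pointwise form
    \<open>|u| \<le> s / 2 * u\<^sup>2 + 1 / (2 * s)\<close>, so that comparison of series suffices.
    After averaging, \<open>s = sqrt h\<close> is the optimal choice.\<close>
  have bound: "(\<lambda>j. s / 2 * ((real j / h - 1)\<^sup>2 * ?w j) + 1 / (2 * s) * ?w j) sums
     (s / 2 * (exp h / h) + 1 / (2 * s) * exp h)"
    by (intro sums_add sums_mult poisson_second_moment poisson_weights_sums h)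
  have le: "\<bar>g j * (real j / h - 1) * ?w j\<bar> \<le> s / 2 * ((real j / h - 1)\<^sup>2 * ?w j) + 1 / (2 * s) * ?w j" for j
  proof -
    let ?u = "real j / h - 1"
    have "\<bar>g j * ?u\<bar> \<le> \<bar>?u\<bar>" using g[of j] by (simp add: abs_mult mult_left_le_one_le)
    also have "0 \<le> (s * \<bar>?u\<bar> - 1)\<^sup>2" by simp
    then have "\<bar>?u\<bar> \<le> s / 2 * ?u\<^sup>2 + 1 / (2 * s)"
      using s by (simp add: power2_eq_square field_simps)
    finally have "\<bar>g j * ?u\<bar> * ?w j \<le> (s / 2 * ?u\<^sup>2 + 1 / (2 * s)) * ?w j"
      using h by (intro mult_right_mono) auto
    moreover have "\<bar>?w j\<bar> = ?w j" using h by simp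
    ultimately show ?thesis by (simp only: abs_mult distrib_right mult.assoc)
  qed
  have "\<bar>S1 - S0\<bar> \<le> s / 2 * (exp h / h) + 1 / (2 * s) * exp h"
  proof -
    have "summable (\<lambda>j. \<bar>g j * (real j / h - 1) * ?w j\<bar>)"
      by (rule summable_comparison_test'[OF sums_summable[OF bound]]) (use le in simp)
    then have "\<bar>S1 - S0\<bar> \<le> (\<Sum>j. \<bar>g j * (real j / h - 1) * ?w j\<bar>)"
      using summable_rabs[of "\<lambda>j. g j * (real j / h - 1) * ?w j"] sums_unique[OF diff] by simp
    also have "\<dots> \<le> s / 2 * (exp h / h) + 1 / (2 * s) * exp h"
      unfolding sums_unique[OF bound]
      by (rule suminf_le[OF le]) (fact | rule sums_summable[OF bound])+
    finally show ?thesis .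
  qed
  also have "\<dots> = exp h * (1 / s)"
    using s h by (simp add: field_simps)
  finally have "exp (- h) * \<bar>S1 - S0\<bar> \<le> exp (- h) * (exp h * (1 / s))"
    by (intro mult_left_mono) auto
  moreover have "poisson_mean h (\<lambda>j. g (Suc j)) - poisson_mean h g = exp (- h) * (S1 - S0)"
    by (simp add: poisson_mean_def S0_def S1_def algebra_simps)
  ultimately show ?thesis by (simp add: abs_mult s_def exp_minus)
qed

lemma poisson_mean_rate_le:
  assumes "0 \<le> h" "h \<le> h'" "\<And>j. \<bar>g j\<bar> \<le> C"
    and "\<And>y. h < y \<Longrightarrow> y < h' \<Longrightarrow> \<bar>poisson_mean y (\<lambda>j. g (Suc j)) - poisson_mean y g\<bar> \<le> B"
    and "B \<ge> 0"
  shows "\<bar>poisson_mean h' g - poisson_mean h g\<bar> \<le> (h' - h) * B"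
proof (cases "h = h'")
  case False
  then have "h < h'" using assms by simp
  from MVT2[OF this, of "\<lambda>h. poisson_mean h g" "\<lambda>h. poisson_mean h (\<lambda>j. g (Suc j)) - poisson_mean h g"]
  obtain y where "h < y" "y < h'" "poisson_mean h' g - poisson_mean h g =
      (h' - h) * (poisson_mean y (\<lambda>j. g (Suc j)) - poisson_mean y g)"
    using poisson_mean_has_derivative[of g C, OF assms(3)] by blast
  then show ?thesis using assms(4)[of y] assms(2) by (simp add: abs_mult mult_left_mono)
qed (use assms in simp)

lemma poisson_mean_rate:
  assumes "0 < h" "h \<le> h'" "\<And>j. \<bar>g j\<bar> \<le> 1"
  shows "\<bar>poisson_mean h' g - poisson_mean h g\<bar> \<le> (h' - h) / sqrt h"
proof -
  have "\<bar>poisson_mean y (\<lambda>j. g (Suc j)) - poisson_mean y g\<bar> \<le> 1 / sqrt h" if "h < y" for y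
  proof -
    have "\<bar>poisson_mean y (\<lambda>j. g (Suc j)) - poisson_mean y g\<bar> \<le> 1 / sqrt y"
      using that assms by (intro poisson_mean_shift) auto
    also have "\<dots> \<le> 1 / sqrt h" using that assms by (intro divide_left_mono) auto
    finally show ?thesis .
  qed
  then show ?thesis using poisson_mean_rate_le[of h h' g 1 "1 / sqrt h"] assms by simp
qed

text \<open>A crude bound that remains usable near the rate 0, where a factor
  \<open>1 / sqrt h\<close> is not.\<close>

lemma poisson_mean_rate_lipschitz:
  assumes "0 \<le> h" "h \<le> h'" "test_function g"
  shows "\<bar>poisson_mean h' g - poisson_mean h g\<bar> \<le> h' - h"
proof -
  have "\<bar>poisson_mean y (\<lambda>j. g (Suc j)) - poisson_mean y g\<bar> \<le> 1" if "h < y" for y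
    using poisson_mean_test_function[of y g] poisson_mean_test_function[of y "\<lambda>j. g (Suc j)"]
      test_function_comp[OF assms(3), of Suc] that assms by auto
  then show ?thesis using poisson_mean_rate_le[of h h' g 1 1] assms by (simp add: test_function_abs)
qed

section \<open>Poisson variables restricted to one parity\<close>

text \<open>Not normalised: the two parities add up to the Poisson mean, and each has mass about
  1/2.\<close>

definition parity_mean :: "real \<Rightarrow> bool \<Rightarrow> (nat \<Rightarrow> real) \<Rightarrow> real" where
  "parity_mean h e g = poisson_mean h (\<lambda>j. if even j = e then g j else 0)"

lemma parity_mean_shift:
  assumes "h > 0" "test_function g"
  shows "\<bar>parity_mean h e (\<lambda>j. g (Suc j)) - parity_mean h (\<not> e) g\<bar> \<le> 1 / sqrt h"
proof -
  define G where "G j = (if even j = (\<not> e) then g j else 0)" for j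
  have "(\<lambda>j. if even j = e then g (Suc j) else 0) = (\<lambda>j. G (Suc j))"
    by (auto simp: G_def)
  moreover have "\<bar>G j\<bar> \<le> 1" for j using test_function_abs[OF assms(2)] by (simp add: G_def)
  ultimately show ?thesis
    using poisson_mean_shift[OF assms(1), of G] unfolding parity_mean_def G_def[symmetric] by simp
qed

lemma parity_mean_add:
  assumes "test_function g"
  shows "parity_mean h True g + parity_mean h False g = poisson_mean h g"
proof -
  have "\<bar>if even j = e then g j else 0\<bar> \<le> 1" for j e
    using test_function_abs[OF assms] by simp
  note b = this[of _ True, simplified] this[of _ False, simplified]
  have "poisson_mean h (\<lambda>j. 1 * (if even j = True then g j else 0) + 1 * (if even j = False then g j else 0)) =
    1 * parity_mean h True g + 1 * parity_mean h False g"
    unfolding parity_mean_def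
    by (rule poisson_mean_linear[where C = 1 and D = 1]) (simp_all add: b test_function_abs[OF assms])
  moreover have "(\<lambda>j. 1 * (if even j = True then g j else 0) + 1 * (if even j = False then g j else 0)) = g"
    by auto
  ultimately show ?thesis by simp
qed

text \<open>The shift lemma for constant \<open>g\<close> compares the masses of the two parities,
  whose sum is 1.\<close>

lemma parity_mean_one:
  assumes "h > 0"
  shows "\<bar>2 * parity_mean h e (\<lambda>_. 1) - 1\<bar> \<le> 1 / sqrt h"
  using parity_mean_shift[OF assms, of "\<lambda>_. 1" e] parity_mean_add[of "\<lambda>_. 1" h]
  by (cases e) (auto simp: test_function_def)

lemma parity_mean_rate:
  assumes "0 < h" "h \<le> h'" "test_function g"
  shows "\<bar>parity_mean h' e g - parity_mean h e g\<bar> \<le> (h' - h) / sqrt h"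
  unfolding parity_mean_def
  by (rule poisson_mean_rate[OF assms(1,2)]) (use test_function_abs[OF assms(3)] in simp)

lemma parity_mean_test_function:
  assumes "h \<ge> 0" "test_function g"
  shows "0 \<le> parity_mean h e g" "parity_mean h e g \<le> parity_mean h e (\<lambda>_. 1)"
proof -
  show "0 \<le> parity_mean h e g"
    unfolding parity_mean_def by (intro poisson_mean_test_function assms test_function_if)
  show "parity_mean h e g \<le> parity_mean h e (\<lambda>_. 1)"
    unfolding parity_mean_def
    by (rule poisson_mean_mono[where C = 1 and D = 1])
       (use assms test_function_abs[OF assms(2)] in \<open>auto simp: test_function_def\<close>)
qed

lemma gluing_mean_test_function:
  assumes "test_function g" "even (\<Sum>\<^sub># P)"
  shows "0 \<le> gluing_mean P g" "gluing_mean P g \<le> 1"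
proof -
  show "0 \<le> gluing_mean P g" using assms by (intro gluing_mean_nonneg) (simp add: test_function_def)
  have "0 \<le> gluing_mean P (\<lambda>k. 1 * 1 + (- 1) * g k)"
    using assms by (intro gluing_mean_nonneg) (simp add: test_function_def)
  then show "gluing_mean P g \<le> 1"
    unfolding gluing_mean_linear using gluing_mean_one[OF assms(2)] by simp
qed

abbreviation one_polygon_mean :: "nat \<Rightarrow> (nat \<Rightarrow> real) \<Rightarrow> real" where
  "one_polygon_mean m g \<equiv> gluing_mean {#2 * m#} g"

lemma one_polygon_mean_test_function:
  "test_function g \<Longrightarrow> test_function (\<lambda>j. one_polygon_mean (f j) (\<lambda>u. g (j + u)))"
  by (intro test_functionI gluing_mean_test_function) (simp_all add: test_function_def)

text \<open>Adding an independent number of vertices of the one-polygon surface to a Poisson variable of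
  prescribed parity has the same effect as changing the parity, since each vertex costs one shift.\<close>

lemma parity_mean_one_polygon:
  assumes h: "h > 0"
  shows "test_function g \<Longrightarrow>
    \<bar>parity_mean h e (\<lambda>j. one_polygon_mean m (\<lambda>u. g (j + u))) - parity_mean h (e = odd m) g\<bar>
      \<le> (real m + 1) / sqrt h"
proof (induction m arbitrary: g rule: less_induct)
  case (less m)
  note g = less.prems
  define s where "s = 1 / sqrt h"
  have s: "s > 0" using h by (simp add: s_def)
  have shift: "\<bar>parity_mean h e' (\<lambda>j. g' (Suc j)) - parity_mean h (\<not> e') g'\<bar> \<le> s" if "test_function g'" for e' g'
    unfolding s_def by (rule parity_mean_shift[OF h that])
  consider "m = 0" | "m = 1" | k where "m = k + 2"
    by (metis One_nat_def add_2_eq_Suc' not0_implies_Suc)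
  then have "\<bar>parity_mean h e (\<lambda>j. one_polygon_mean m (\<lambda>u. g (j + u))) - parity_mean h (e = odd m) g\<bar> \<le> (real m + 1) * s"
  proof cases
    case 1
    then show ?thesis using shift[OF g, of e] by (simp add: gluing_mean_one_polygon_0)
  next
    case 2
    have "\<bar>parity_mean h e (\<lambda>j. g (Suc (Suc j))) - parity_mean h (\<not> e) (\<lambda>j. g (Suc j))\<bar> \<le> s"
      by (rule shift) (use g in \<open>simp add: test_function_def\<close>)
    moreover have "\<bar>parity_mean h (\<not> e) (\<lambda>j. g (Suc j)) - parity_mean h e g\<bar> \<le> s"
      using shift[OF g, of "\<not> e"] by simp
    ultimately show ?thesis using 2 by (simp add: gluing_mean_one_polygon_1)
  next
    case 3
    have gS: "test_function (\<lambda>j. g (Suc j))" using g by (simp add: test_function_def)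
    define Y where "Y m g = parity_mean h e (\<lambda>j. one_polygon_mean m (\<lambda>u. g (j + u)))" for m g
    have Y: "real (k + 3) * Y (k + 2) g = 2 * Y (k + 1) (\<lambda>j. g (Suc j)) + real (k + 1) * Y k g"
    proof -
      define a b where "a = 2 / real (k + 3)" and "b = real (k + 1) / real (k + 3)"
      have div: "r * X = 2 * A + c * B \<longleftrightarrow> X = 2 / r * A + c / r * B" if "r > 0" for r X A c B :: real
        using that by (auto simp: field_simps)
      have k3: "real (k + 3) > 0" by simp
      have "one_polygon_mean (k + 2) f = a * one_polygon_mean (k + 1) (\<lambda>u. f (Suc u)) + b * one_polygon_mean k f" for f
        using harer_zagier_recurrence[of k f] unfolding div[OF k3] a_def b_def .
      then have e: "(\<lambda>j. if even j = e then one_polygon_mean (k + 2) (\<lambda>u. g (j + u)) else 0) =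
          (\<lambda>j. a * (if even j = e then one_polygon_mean (k + 1) (\<lambda>u. g (Suc (j + u))) else 0) +
               b * (if even j = e then one_polygon_mean k (\<lambda>u. g (j + u)) else 0))"
        by (auto simp: fun_eq_iff)
      have 1: "\<bar>if even j = e then one_polygon_mean (k + 1) (\<lambda>u. g (Suc (j + u))) else 0\<bar> \<le> 1" for j
        using test_function_abs[OF one_polygon_mean_test_function[OF gS], of "\<lambda>_. k + 1" j] by simp
      have 2: "\<bar>if even j = e then one_polygon_mean k (\<lambda>u. g (j + u)) else 0\<bar> \<le> 1" for j
        using test_function_abs[OF one_polygon_mean_test_function[OF g], of "\<lambda>_. k" j] by simp
      have "Y (k + 2) g = a * Y (k + 1) (\<lambda>j. g (Suc j)) + b * Y k g"
        unfolding Y_def parity_mean_def e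
        by (rule poisson_mean_linear[where C = 1 and D = 1]) (fact 1, fact 2)
      then show ?thesis unfolding div[OF k3] a_def b_def .
    qed
    let ?P = "\<lambda>e g. parity_mean h e g"
    have 1: "\<bar>Y (k + 1) (\<lambda>j. g (Suc j)) - ?P (e = odd (k + 1)) (\<lambda>j. g (Suc j))\<bar> \<le> (real k + 2) * s"
      using less.IH[of "k + 1" "\<lambda>j. g (Suc j)", OF _ gS] 3 by (simp add: Y_def s_def add.commute)
    have 2: "\<bar>Y k g - ?P (e = odd k) g\<bar> \<le> (real k + 1) * s"
      using less.IH[of k g, OF _ g] 3 by (simp add: Y_def s_def)
    \<comment> \<open>The additional vertex and the odd step in the half perimeter compensate, so
      both branches of the recurrence aim at the same parity.\<close>
    have par: "(\<not> (e = odd (k + 1))) = (e = odd k)" by auto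
    have 3: "\<bar>?P (e = odd (k + 1)) (\<lambda>j. g (Suc j)) - ?P (e = odd k) g\<bar> \<le> s"
      using shift[OF g, of "e = odd (k + 1)"] unfolding par .
    let ?p = "?P (e = odd k) g" and ?y = "Y (k + 1) (\<lambda>j. g (Suc j))"
    have "\<bar>?y - ?p\<bar> \<le> (real k + 3) * s" using 1 3 by (simp add: algebra_simps abs_le_iff)
    then have "\<bar>2 * (?y - ?p) + (real k + 1) * (Y k g - ?p)\<bar> \<le> 2 * ((real k + 3) * s) + (real k + 1) * ((real k + 1) * s)"
      using 2 by (intro order_trans[OF abs_triangle_ineq] add_mono) (auto simp: abs_mult intro: mult_left_mono)
    moreover have "(real k + 3) * (Y (k + 2) g - ?p) = 2 * (?y - ?p) + (real k + 1) * (Y k g - ?p)"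
      using Y by (simp add: algebra_simps)
    moreover have "(real k + 3) * \<bar>Y (k + 2) g - ?p\<bar> = \<bar>(real k + 3) * (Y (k + 2) g - ?p)\<bar>"
      by (simp add: abs_mult)
    ultimately have "(real k + 3) * \<bar>Y (k + 2) g - ?p\<bar> \<le> 2 * ((real k + 3) * s) + (real k + 1) * ((real k + 1) * s)"
      by simp
    also have "\<dots> = (2 * (real k + 3) + (real k + 1) * (real k + 1)) * s" by (simp add: algebra_simps)
    also have "\<dots> \<le> ((real k + 3) * (real k + 3)) * s"
      using s by (intro mult_right_mono) (auto simp: algebra_simps)
    finally have "(real k + 3) * \<bar>Y (k + 2) g - ?p\<bar> \<le> (real k + 3) * ((real k + 3) * s)" by (simp only: mult.assoc)
    then have "\<bar>Y (k + 2) g - ?p\<bar> \<le> (real k + 3) * s" by simp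
    then show ?thesis using \<open>m = k + 2\<close> by (simp add: Y_def add.commute)
  qed
  then show ?case by (simp add: s_def)
qed

section \<open>Descent along the recurrence to a fixed cutoff\<close>

text \<open>To first order, raising the rate from \<open>h0\<close> to \<open>h2\<close> adds one
  with probability \<open>h2 - h0\<close>. Three rates occur because the branches of the recurrence
  lead to \<open>m - 1\<close> and \<open>m - 2\<close>, with different logarithms.\<close>

lemma poisson_mean_step:
  assumes h: "0 \<le> h0" "h0 \<le> h1" "h1 \<le> h2" and g: "test_function g" and \<tau>: "0 \<le> \<tau>" "\<tau> \<le> 1"
  shows "\<bar>poisson_mean h2 g - (\<tau> * poisson_mean h1 (\<lambda>j. g (Suc j)) + (1 - \<tau>) * poisson_mean h0 g)\<bar>
           \<le> 2 * (h2 - h0)\<^sup>2 + \<bar>h2 - h0 - \<tau>\<bar>"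
proof (cases "h0 = h2")
  case True
  then have "h1 = h0" using h by simp
  have gS: "test_function (\<lambda>j. g (Suc j))" using g by (simp add: test_function_def)
  have "\<bar>poisson_mean h0 (\<lambda>j. g (Suc j)) - poisson_mean h0 g\<bar> \<le> 1"
    using poisson_mean_test_function[OF h(1) g] poisson_mean_test_function[OF h(1) gS] by simp
  then have "\<tau> * \<bar>poisson_mean h0 (\<lambda>j. g (Suc j)) - poisson_mean h0 g\<bar> \<le> \<tau> * 1"
    using \<tau> by (intro mult_left_mono)
  then have "\<bar>\<tau> * (poisson_mean h0 (\<lambda>j. g (Suc j)) - poisson_mean h0 g)\<bar> \<le> \<tau>"
    using \<tau> by (simp add: abs_mult)
  then show ?thesis using True \<open>h1 = h0\<close> \<tau> by (simp add: algebra_simps)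
next
  case False
  then have lt: "h0 < h2" using h by simp
  have gS: "test_function (\<lambda>j. g (Suc j))" using g by (simp add: test_function_def)
  define a where "a = h2 - h0"
  have a: "a > 0" using lt by (simp add: a_def)
  let ?\<phi> = "\<lambda>y. poisson_mean y g" and ?\<psi> = "\<lambda>y. poisson_mean y (\<lambda>j. g (Suc j))"
  from MVT2[OF lt, of ?\<phi> "\<lambda>y. ?\<psi> y - ?\<phi> y"]
  obtain y where y: "h0 < y" "y < h2" "?\<phi> h2 - ?\<phi> h0 = a * (?\<psi> y - ?\<phi> y)"
    unfolding a_def using poisson_mean_has_derivative[of g 1, OF test_function_abs[OF g]] by blast
  have l: "\<bar>poisson_mean u f - poisson_mean v f\<bar> \<le> a"
    if "test_function f" "h0 \<le> u" "u \<le> h2" "h0 \<le> v" "v \<le> h2" for f u v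
    using poisson_mean_rate_lipschitz[of u v f] poisson_mean_rate_lipschitz[of v u f] that h(1)
    by (cases "u \<le> v") (auto simp: a_def abs_le_iff)
  have "\<bar>?\<psi> y - ?\<psi> h1\<bar> \<le> a" "\<bar>?\<phi> y - ?\<phi> h0\<bar> \<le> a"
    using y h lt by (auto intro!: l g gS)
  then have "\<bar>(?\<psi> y - ?\<phi> y) - (?\<psi> h1 - ?\<phi> h0)\<bar> \<le> 2 * a" by (simp add: abs_le_iff)
  then have 1: "\<bar>a * ((?\<psi> y - ?\<phi> y) - (?\<psi> h1 - ?\<phi> h0))\<bar> \<le> a * (2 * a)"
    using a by (simp add: abs_mult)
  have "\<bar>?\<psi> h1 - ?\<phi> h0\<bar> \<le> 1"
    using poisson_mean_test_function[OF _ g, of h0] poisson_mean_test_function[OF _ gS, of h1] h by simp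
  then have "\<bar>a - \<tau>\<bar> * \<bar>?\<psi> h1 - ?\<phi> h0\<bar> \<le> \<bar>a - \<tau>\<bar> * 1" by (intro mult_left_mono) auto
  then have 2: "\<bar>(a - \<tau>) * (?\<psi> h1 - ?\<phi> h0)\<bar> \<le> \<bar>a - \<tau>\<bar>" by (simp add: abs_mult)
  have eq: "?\<phi> h2 - (\<tau> * ?\<psi> h1 + (1 - \<tau>) * ?\<phi> h0) =
     a * ((?\<psi> y - ?\<phi> y) - (?\<psi> h1 - ?\<phi> h0)) + (a - \<tau>) * (?\<psi> h1 - ?\<phi> h0)"
    using y(3) by (simp add: algebra_simps)
  have "\<bar>?\<phi> h2 - (\<tau> * ?\<psi> h1 + (1 - \<tau>) * ?\<phi> h0)\<bar> \<le> a * (2 * a) + \<bar>a - \<tau>\<bar>"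
    unfolding eq by (rule order_trans[OF abs_triangle_ineq add_mono[OF 1 2]])
  moreover have "a * (2 * a) = 2 * a\<^sup>2" by (simp add: power2_eq_square)
  ultimately show ?thesis by (simp add: a_def)
qed

text \<open>The left side is at most \<open>14 / (m - 2)\<^sup>2\<close>, where 14 is 8 from the
  square and 6 from the difference. The factor 42 makes this telescope from \<open>m = 4\<close> on,
  where the comparison is an equality.\<close>

lemma ln_two_step:
  fixes m :: nat
  assumes "m \<ge> 4"
  shows "2 * (ln (real m) - ln (real m - 2))\<^sup>2 + \<bar>ln (real m) - ln (real m - 2) - 2 / (real m + 1)\<bar>
          \<le> 42 / real (m - 1) - 42 / real m"
proof -
  define x where "x = real m"
  have x: "x \<ge> 4" using assms by (simp add: x_def)
  define a where "a = ln x - ln (x - 2)"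
  have a: "a = ln (x / (x - 2))" using x by (simp add: a_def ln_div)
  have "a \<le> x / (x - 2) - 1" unfolding a using x by (intro ln_le_minus_one) auto
  also have "\<dots> = 2 / (x - 2)" using x by (simp add: field_simps)
  finally have a1: "a \<le> 2 / (x - 2)" .
  have "- a = ln ((x - 2) / x)" using x by (simp add: a_def ln_div)
  also have "\<dots> \<le> (x - 2) / x - 1" using x by (intro ln_le_minus_one) auto
  also have "\<dots> = - (2 / x)" using x by (simp add: field_simps)
  finally have a2: "2 / x \<le> a" by simp
  have "2 / (x + 1) \<le> 2 / x" using x by (intro divide_left_mono) auto
  then have "\<bar>a - 2 / (x + 1)\<bar> \<le> 2 / (x - 2) - 2 / (x + 1)" using a1 a2 by simp
  also have "\<dots> = 6 / ((x - 2) * (x + 1))" using x by (simp add: field_simps)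
  also have "\<dots> \<le> 6 / ((x - 2) * (x - 2))" using x by (intro divide_left_mono mult_left_mono mult_pos_pos) auto
  finally have b: "\<bar>a - 2 / (x + 1)\<bar> \<le> 6 / ((x - 2) * (x - 2))" .
  have "0 \<le> a" using a2 x by (meson divide_nonneg_nonneg order_trans zero_le_numeral)
  then have "a\<^sup>2 \<le> (2 / (x - 2))\<^sup>2" using a1 by (intro power_mono)
  then have "2 * a\<^sup>2 \<le> 8 / ((x - 2) * (x - 2))" by (simp add: power2_eq_square)
  with b have "2 * a\<^sup>2 + \<bar>a - 2 / (x + 1)\<bar> \<le> 14 / ((x - 2) * (x - 2))" by (simp add: add_divide_distrib[symmetric])
  also have "\<dots> \<le> 42 / (x * (x - 1))"
  proof -
    have "0 \<le> (2 * x - 3) * (x - 4)" using x by simp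
    then have "14 * (x * (x - 1)) \<le> 42 * ((x - 2) * (x - 2))" by (simp add: algebra_simps)
    then show ?thesis using x by (simp add: divide_le_eq le_divide_eq field_simps)
  qed
  also have "\<dots> = 42 / (x - 1) - 42 / x" using x by (simp add: field_simps)
  finally show ?thesis using assms by (simp add: a_def x_def of_nat_diff)
qed

text \<open>Going down, \<open>m\<close> drops by one together with a new vertex, or by two without
  one, until it is \<open>K\<close> or \<open>Suc K\<close>. The parity of the number
  \<open>j\<close> of new vertices decides between the two, so the end of the descent is a function
  of \<open>j\<close>. The slack of 44 over 42 covers the start \<open>m = Suc K\<close>, where the
  rate is not 0 but at most \<open>1 / K\<close>.\<close>

lemma one_polygon_poisson_approx:
  assumes K: "K \<ge> 2"
  shows "m \<ge> K \<Longrightarrow> test_function g \<Longrightarrow>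
    \<bar>one_polygon_mean m g - poisson_mean (ln (real m) - ln (real K))
        (\<lambda>j. one_polygon_mean (if even (m + j) = even K then K else Suc K) (\<lambda>u. g (j + u)))\<bar>
      \<le> 44 / real K - 42 / real m"
proof (induction m arbitrary: g rule: less_induct)
  case (less m)
  note g = less.prems(2)
  define \<Gamma> where "\<Gamma> m g j = one_polygon_mean (if even (m + j) = even K then K else Suc K) (\<lambda>u. g (j + u))"
    for m :: nat and g :: "nat \<Rightarrow> real" and j :: nat
  have \<Gamma>: "test_function (\<Gamma> m g)" if "test_function g" for m g
    unfolding \<Gamma>_def by (rule one_polygon_mean_test_function[OF that])
  define h where "h m = ln (real m) - ln (real K)" for m :: nat
  consider "m = K" | "m = Suc K" | "K + 2 \<le> m" using less.prems(1) by linarith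
  then have "\<bar>one_polygon_mean m g - poisson_mean (h m) (\<Gamma> m g)\<bar> \<le> 44 / real K - 42 / real m"
  proof cases
    case 1
    then show ?thesis using K by (simp add: h_def poisson_mean_0 \<Gamma>_def divide_simps)
  next
    case 2
    have "h m = ln (real m / real K)" using 2 K by (simp add: h_def ln_div)
    also have "\<dots> \<le> real m / real K - 1" using 2 K by (intro ln_le_minus_one) auto
    also have "\<dots> = 1 / real K" using 2 K by (simp add: field_simps)
    finally have "h m \<le> 1 / real K" .
    moreover have "0 \<le> h m" using 2 K by (simp add: h_def)
    ultimately have "\<bar>poisson_mean (h m) (\<Gamma> m g) - \<Gamma> m g 0\<bar> \<le> 1 / real K"
      using poisson_mean_rate_lipschitz[OF _ _ \<Gamma>[OF g], of 0 "h m" m] by (simp add: poisson_mean_0)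
    moreover have "\<Gamma> m g 0 = one_polygon_mean m g" using 2 by (simp add: \<Gamma>_def)
    moreover have "1 / real K \<le> 44 / real K - 42 / real m"
    proof -
      have "42 / real m \<le> 42 / real K" using 2 K by (intro divide_left_mono) auto
      moreover have "44 / real K = 42 / real K + 2 * (1 / real K)" by simp
      moreover have "1 / real K > 0" using K by simp
      ultimately show ?thesis by linarith
    qed
    ultimately show ?thesis by linarith
  next
    case 3
    define k where "k = m - 2"
    have 3: "m = k + 2" "K \<le> k" using 3 by (auto simp: k_def)
    have gS: "test_function (\<lambda>j. g (Suc j))" using g by (simp add: test_function_def)
    define \<tau> where "\<tau> = 2 / (real m + 1)"
    have \<tau>: "0 \<le> \<tau>" "\<tau> \<le> 1" using 3 K by (auto simp: \<tau>_def)
    have m: "m \<ge> 4" using 3 K by simp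
    have rec: "one_polygon_mean m g = \<tau> * one_polygon_mean (k + 1) (\<lambda>j. g (Suc j)) + (1 - \<tau>) * one_polygon_mean k g"
    proof -
      have div: "r * X = 2 * A + c * B \<longleftrightarrow> X = 2 / r * A + c / r * B" if "r > 0" for r X A c B :: real
        using that by (auto simp: field_simps)
      have k3: "real (k + 3) > 0" by simp
      have "real (k + 1) / real (k + 3) = 1 - \<tau>" "2 / real (k + 3) = \<tau>"
        using 3 by (auto simp: \<tau>_def field_simps)
      then show ?thesis using harer_zagier_recurrence[of k g] unfolding div[OF k3] 3(1) by simp
    qed
    have \<Gamma>1: "\<Gamma> (k + 1) (\<lambda>j. g (Suc j)) = (\<lambda>j. \<Gamma> m g (Suc j))" and \<Gamma>0: "\<Gamma> k g = \<Gamma> m g"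
      by (auto simp: \<Gamma>_def 3(1) fun_eq_iff)
    define B where "B m = 44 / real K - 42 / real m" for m
    have I1: "\<bar>one_polygon_mean (k + 1) (\<lambda>j. g (Suc j)) - poisson_mean (h (k + 1)) (\<lambda>j. \<Gamma> m g (Suc j))\<bar> \<le> B (k + 1)"
      using less.IH[of "k + 1" "\<lambda>j. g (Suc j)"] 3 gS unfolding \<Gamma>1[symmetric] \<Gamma>_def h_def B_def by simp
    have "\<bar>one_polygon_mean k g - poisson_mean (h k) (\<Gamma> m g)\<bar> \<le> B k"
      using less.IH[of k g] 3 g unfolding \<Gamma>0[symmetric] \<Gamma>_def h_def B_def by simp
    \<comment> \<open>Both errors are stated at \<open>m - 1\<close>, so that the error of the step
      telescopes.\<close>
    also have "B k \<le> B (k + 1)" using 3 K unfolding B_def by (intro diff_left_mono divide_left_mono) auto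
    finally have I0: "\<bar>one_polygon_mean k g - poisson_mean (h k) (\<Gamma> m g)\<bar> \<le> B (k + 1)" .
    have "h k \<ge> 0" "h k \<le> h (k + 1)" "h (k + 1) \<le> h m" using 3 K by (auto simp: h_def)
    from poisson_mean_step[OF this \<Gamma>[OF g] \<tau>, of m]
    have step: "\<bar>poisson_mean (h m) (\<Gamma> m g) - (\<tau> * poisson_mean (h (k + 1)) (\<lambda>j. \<Gamma> m g (Suc j)) +
         (1 - \<tau>) * poisson_mean (h k) (\<Gamma> m g))\<bar> \<le> 42 / real (m - 1) - 42 / real m"
      using ln_two_step[OF m] 3 unfolding \<tau>_def h_def by simp
    have "\<bar>\<tau> * (one_polygon_mean (k + 1) (\<lambda>j. g (Suc j)) - poisson_mean (h (k + 1)) (\<lambda>j. \<Gamma> m g (Suc j))) +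
       (1 - \<tau>) * (one_polygon_mean k g - poisson_mean (h k) (\<Gamma> m g))\<bar> \<le> \<tau> * B (k + 1) + (1 - \<tau>) * B (k + 1)"
      using I0 I1 \<tau> by (intro order_trans[OF abs_triangle_ineq] add_mono) (auto simp: abs_mult intro!: mult_left_mono)
    also have "\<dots> = B (k + 1)" by (simp add: algebra_simps)
    finally have A: "\<bar>one_polygon_mean m g - (\<tau> * poisson_mean (h (k + 1)) (\<lambda>j. \<Gamma> m g (Suc j)) +
         (1 - \<tau>) * poisson_mean (h k) (\<Gamma> m g))\<bar> \<le> B (k + 1)"
      unfolding rec by (simp add: algebra_simps)
    have "\<bar>u - p\<bar> \<le> \<bar>u - t\<bar> + \<bar>p - t\<bar>" for u p t :: real by linarith
    from order_trans[OF this add_mono[OF A step]]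
    have "\<bar>one_polygon_mean m g - poisson_mean (h m) (\<Gamma> m g)\<bar> \<le> B (k + 1) + (42 / real (m - 1) - 42 / real m)" .
    also have "\<dots> = 44 / real K - 42 / real m"
      using 3 by (simp add: B_def)
    finally show ?thesis .
  qed
  then show ?case unfolding \<Gamma>_def h_def .
qed

text \<open>On each parity class of \<open>j\<close> the descent ends at one fixed polygon, whose
  vertices only move the parity class. Both classes arrive at the same parity mean, hence the factor
  2.\<close>

lemma one_polygon_parity_approx:
  assumes K: "K \<ge> 2" "m > K" and g: "test_function g"
  defines "h \<equiv> ln (real m) - ln (real K)"
  shows "\<bar>one_polygon_mean m g - 2 * parity_mean h (odd m) g\<bar> \<le> 44 / real K + 2 * (real K + 2) / sqrt h"
proof -
  have h: "h > 0" using K by (simp add: h_def)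
  define \<Gamma> where "\<Gamma> j = one_polygon_mean (if even (m + j) = even K then K else Suc K) (\<lambda>u. g (j + u))" for j
  have \<Gamma>: "test_function \<Gamma>" unfolding \<Gamma>_def by (rule one_polygon_mean_test_function[OF g])
  have "\<bar>one_polygon_mean m g - poisson_mean h \<Gamma>\<bar> \<le> 44 / real K - 42 / real m"
    unfolding \<Gamma>_def h_def using K g by (intro one_polygon_poisson_approx) auto
  then have 1: "\<bar>one_polygon_mean m g - poisson_mean h \<Gamma>\<bar> \<le> 44 / real K"
    by (rule order_trans) simp
  have 2: "\<bar>parity_mean h e \<Gamma> - parity_mean h (odd m) g\<bar> \<le> (real K + 2) / sqrt h" for e
  proof -
    define \<kappa> where "\<kappa> = (if (even m = e) = even K then K else Suc K)"
    have "parity_mean h e \<Gamma> = parity_mean h e (\<lambda>j. one_polygon_mean \<kappa> (\<lambda>u. g (j + u)))"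
      unfolding parity_mean_def \<Gamma>_def \<kappa>_def by (rule arg_cong[of _ _ "poisson_mean h"]) auto
    moreover have "(e = odd \<kappa>) = odd m" by (auto simp: \<kappa>_def)
    ultimately have "\<bar>parity_mean h e \<Gamma> - parity_mean h (odd m) g\<bar> \<le> (real \<kappa> + 1) / sqrt h"
      using parity_mean_one_polygon[OF h g, of e \<kappa>] by simp
    also have "\<dots> \<le> (real K + 2) / sqrt h" using h by (intro divide_right_mono) (auto simp: \<kappa>_def)
    finally show ?thesis .
  qed
  have "poisson_mean h \<Gamma> = parity_mean h True \<Gamma> + parity_mean h False \<Gamma>"
    by (rule parity_mean_add[OF \<Gamma>, symmetric])
  moreover have "2 * (real K + 2) / sqrt h = (real K + 2) / sqrt h + (real K + 2) / sqrt h" by simp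
  ultimately show ?thesis using 1 2[of True] 2[of False] by linarith
qed

section \<open>Conditioning on the parity\<close>

definition conditional_mean :: "real \<Rightarrow> bool \<Rightarrow> (nat \<Rightarrow> real) \<Rightarrow> real" where
  "conditional_mean h e g = parity_mean h e g / parity_mean h e (\<lambda>_. 1)"

lemma parity_mean_one_pos:
  assumes "h > 1"
  shows "parity_mean h e (\<lambda>_. 1) > 0"
proof -
  have "1 / sqrt h < 1" using assms by simp
  then show ?thesis using parity_mean_one[of h e] assms by linarith
qed

lemma conditional_mean_test_function:
  assumes "h > 1" "test_function g"
  shows "0 \<le> conditional_mean h e g" "conditional_mean h e g \<le> 1"
  using parity_mean_test_function[of h g e] parity_mean_one_pos[of h e] assms
  by (auto simp: conditional_mean_def)

lemma conditional_mean_approx: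
  assumes h: "h > 1" and g: "test_function g"
  shows "\<bar>conditional_mean h e g - 2 * parity_mean h e g\<bar> \<le> 1 / sqrt h"
proof -
  let ?c = "parity_mean h e (\<lambda>_. 1)"
  have c: "?c > 0" by (rule parity_mean_one_pos[OF h])
  have "conditional_mean h e g - 2 * parity_mean h e g = conditional_mean h e g * (1 - 2 * ?c)"
    using c by (simp add: conditional_mean_def field_simps)
  then have "\<bar>conditional_mean h e g - 2 * parity_mean h e g\<bar> \<le> 1 * \<bar>1 - 2 * ?c\<bar>"
    using conditional_mean_test_function[OF h g, of e] by (simp only: abs_mult) (intro mult_right_mono, auto)
  also have "\<dots> \<le> 1 / sqrt h" using parity_mean_one[of h e] h by simp
  finally show ?thesis .
qed

lemma conditional_mean_shift:
  assumes h: "h > 1" and g: "test_function g"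
  shows "\<bar>conditional_mean h e (\<lambda>j. g (Suc j)) - conditional_mean h (\<not> e) g\<bar> \<le> 4 / sqrt h"
proof -
  have gS: "test_function (\<lambda>j. g (Suc j))" using g by (simp add: test_function_def)
  \<comment> \<open>One unit for each of the two normalisations, and two for shifting twice the
    parity mean.\<close>
  have "4 / sqrt h = 4 * (1 / sqrt h)" by simp
  then show ?thesis
    using conditional_mean_approx[OF h g, of "\<not> e"] conditional_mean_approx[OF h gS, of e]
      parity_mean_shift[OF _ g, of h e] h by linarith
qed

text \<open>The rate \<open>ln m - ln K\<close> of the descent is below \<open>ln n\<close> by at
  most \<open>ln 8 + ln K\<close>; the ratio 8 is what the peeling guarantees for the last
  polygon.\<close>

lemma one_polygon_conditional_approx:
  assumes K: "K \<ge> 2" and n: "real n > 8 * real K" "ln (real n) > 1" and m: "real n \<le> 8 * real m" "m \<le> n"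
    and g: "test_function g"
  shows "\<bar>one_polygon_mean m g - conditional_mean (ln (real n)) (odd m) g\<bar>
     \<le> 44 / real K + (2 * (real K + 2) + 2 * (ln 8 + ln (real K)) + 1) / sqrt (ln (real n / (8 * real K)))"
proof -
  define h where "h = ln (real m) - ln (real K)"
  define h0 where "h0 = ln (real n / (8 * real K))"
  have pos: "real K > 0" "real n > 0" "real m > 0" using K n m by auto
  have h0_eq: "h0 = ln (real n) - ln 8 - ln (real K)"
    using pos by (simp add: h0_def ln_div ln_mult)
  have h0: "h0 > 0" unfolding h0_def using n pos by (intro ln_gt_zero) (simp add: field_simps)
  have "ln (real n) \<le> ln (8 * real m)" using m pos by (subst ln_le_cancel_iff) auto
  then have nm: "ln (real n) \<le> ln 8 + ln (real m)" using pos by (simp add: ln_mult)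
  then have h0h: "h0 \<le> h" by (simp add: h0_eq h_def)
  then have h: "h > 0" using h0 by simp
  have "real K < real m" using n m by simp
  then have mK: "m > K" by simp
  define s where "s = 1 / sqrt h0"
  have s: "s > 0" using h0 by (simp add: s_def)
  have hs: "1 / sqrt h \<le> s" unfolding s_def using h0 h0h by (intro divide_left_mono) auto
  have 1: "\<bar>one_polygon_mean m g - 2 * parity_mean h (odd m) g\<bar> \<le> 44 / real K + 2 * (real K + 2) * s"
  proof -
    have "2 * (real K + 2) * (1 / sqrt h) \<le> 2 * (real K + 2) * s" using hs by (intro mult_left_mono) auto
    then show ?thesis using one_polygon_parity_approx[OF K mK g] unfolding h_def[symmetric] by simp
  qed
  have hn: "h \<le> ln (real n)"
  proof -
    have "ln (real m) \<le> ln (real n)" "0 \<le> ln (real K)" using m pos K by auto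
    then show ?thesis by (simp add: h_def)
  qed
  have 2: "\<bar>parity_mean (ln (real n)) (odd m) g - parity_mean h (odd m) g\<bar> \<le> (ln 8 + ln (real K)) * s"
  proof -
    have "\<bar>parity_mean (ln (real n)) (odd m) g - parity_mean h (odd m) g\<bar> \<le> (ln (real n) - h) * (1 / sqrt h)"
      using parity_mean_rate[OF h hn g, of "odd m"] by simp
    also have "\<dots> \<le> (ln 8 + ln (real K)) * s"
    proof (rule mult_mono)
      show "ln (real n) - h \<le> ln 8 + ln (real K)" using nm by (simp add: h_def)
      show "0 \<le> ln 8 + ln (real K)" using K by simp
    qed (use hs h in auto)
    finally show ?thesis .
  qed
  have 3: "\<bar>conditional_mean (ln (real n)) (odd m) g - 2 * parity_mean (ln (real n)) (odd m) g\<bar> \<le> s"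
  proof -
    have "h0 \<le> ln (real n)" using h0h hn by simp
    then have "1 / sqrt (ln (real n)) \<le> s" unfolding s_def using h0 by (intro divide_left_mono) auto
    then show ?thesis using conditional_mean_approx[OF n(2) g, of "odd m"] by simp
  qed
  have "(2 * (real K + 2) + 2 * (ln 8 + ln (real K)) + 1) / sqrt h0 =
      2 * (real K + 2) * s + 2 * ((ln 8 + ln (real K)) * s) + s"
    by (simp add: s_def add_divide_distrib)
  then show ?thesis using 1 2 3 unfolding h0_def[symmetric] by linarith
qed

lemma one_polygon_limit:
  assumes "\<epsilon> > 0"
  shows "\<forall>\<^sub>F n in sequentially. \<forall>m g. real n \<le> 8 * real m \<longrightarrow> m \<le> n \<longrightarrow> test_function g \<longrightarrow>
    \<bar>one_polygon_mean m g - conditional_mean (ln (real n)) (odd m) g\<bar> \<le> \<epsilon>"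
proof -
  \<comment> \<open>\<open>K\<close> depends on \<open>\<epsilon>\<close> only: the second error
    term grows with \<open>K\<close> and vanishes only as \<open>n\<close> tends to
    infinity.\<close>
  obtain K0 :: nat where "K0 > 88 / \<epsilon>" using reals_Archimedean2 by blast
  define K where "K = K0 + 2"
  have K: "K \<ge> 2" "real K > 88 / \<epsilon>" using \<open>K0 > 88 / \<epsilon>\<close> by (auto simp: K_def)
  then have K1: "44 / real K \<le> \<epsilon> / 2" using assms by (simp add: field_simps)
  define C where "C = 2 * (real K + 2) + 2 * (ln 8 + ln (real K)) + 1"
  have "((\<lambda>n. C / sqrt (ln (real n / (8 * real K)))) \<longlongrightarrow> 0) sequentially"
    using K(1) by real_asymp
  then have "\<forall>\<^sub>F n in sequentially. C / sqrt (ln (real n / (8 * real K))) < \<epsilon> / 2"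
    using assms by (intro order_tendstoD(2)) auto
  moreover have "\<forall>\<^sub>F n in sequentially. real n > 8 * real K" by real_asymp
  moreover have "\<forall>\<^sub>F n in sequentially. ln (real n) > 1" by real_asymp
  ultimately show ?thesis
  proof eventually_elim
    case (elim n)
    show ?case
    proof (intro allI impI)
      fix m g assume "real n \<le> 8 * real m" "m \<le> n" "test_function g"
      from one_polygon_conditional_approx[OF K(1) elim(2,3) this] elim(1) K1
      show "\<bar>one_polygon_mean m g - conditional_mean (ln (real n)) (odd m) g\<bar> \<le> \<epsilon>"
        unfolding C_def[symmetric] by linarith
    qed
  qed
qed

section \<open>Peeling down to one polygon\<close>

text \<open>A split decreases \<open>m - k\<close> by at most 2 and has probability at most \<open>1 / k\<close>, so \<open>2 * split_cost k\<close> is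
  a budget for the loss of all splits until one polygon is left. The parameter \<open>\<eta>\<close> of the potential below is
  the price of the parity change caused by a closed vertex, and \<open>vertex_cost\<close> bounds the mean number of
  these.\<close>

definition polygon_count :: "nat multiset \<Rightarrow> nat" where
  "polygon_count P = size (filter_mset ((<) 0) P)"

definition split_cost :: "nat \<Rightarrow> real" where
  "split_cost k = (\<Sum>i=2..k. 6 / real i)"

text \<open>The cutoff 2 makes the loops created by a split free: there are at most two of them, and
  a split of the smallest polygon happens only when no loop is present.\<close>

definition loop_cost :: "nat \<Rightarrow> real" where
  "loop_cost l = (if l \<le> 2 then 0 else (real l)\<^sup>2)"

text \<open>It is at least 1 once \<open>m - k\<close> has fallen to \<open>n / 8\<close>, half of
  the \<open>n / 4\<close> available at the start; the bound to be proved is trivial from there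
  on.\<close>

definition progress_cost :: "real \<Rightarrow> nat \<Rightarrow> nat \<Rightarrow> real" where
  "progress_cost n m k = (max 0 (n / 4 - (real m - real k)) + 2 * split_cost k) / (n / 8)"

definition vertex_cost :: "real \<Rightarrow> nat multiset \<Rightarrow> real" where
  "vertex_cost n P = 16 / n * real (half_perimeter P) + 8 / n * loop_cost (count P 1) + real (count P 0)"

text \<open>Bigons are counted together with loops because gluing a loop to a triangle creates a
  bigon: it is the sum that does not grow.\<close>

definition few_loops :: "real \<Rightarrow> nat multiset \<Rightarrow> bool" where
  "few_loops n P \<longleftrightarrow> count P 1 \<le> 2 \<or> real (count P 1 + count P 2) \<le> n / 64"

section \<open>One-step inequalities for the costs\<close>

lemma split_cost_mono: "k \<le> l \<Longrightarrow> split_cost k \<le> split_cost l"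
  unfolding split_cost_def by (intro sum_mono2) auto

lemma split_cost_nonneg: "0 \<le> split_cost k"
  unfolding split_cost_def by (intro sum_nonneg) auto

lemma split_cost_Suc: "k \<ge> 1 \<Longrightarrow> split_cost (Suc k) = split_cost k + 6 / real (Suc k)"
  by (simp add: split_cost_def)

lemma loop_cost_nonneg: "0 \<le> loop_cost l"
  by (simp add: loop_cost_def)

text \<open>With \<open>D\<close> partners, a split has probability
  \<open>(p - 1) / D \<le> 1 / k\<close>. It costs 2 in \<open>m - k\<close> and leaves up to
  \<open>k + 1\<close> polygons instead of \<open>k - 1\<close>. The worst case is
  \<open>k = 2\<close>, and the 6 in \<open>split_cost\<close> is the solution of
  \<open>1 + c / 2 + c / 3 = c\<close>.\<close>

lemma split_cost_step:
  assumes "k \<ge> 2" "1 \<le> p" "real p * real k \<le> D + 1"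
  shows "(real p - 1) * (2 + 2 * split_cost (k + 1)) + (D - (real p - 1)) * (2 * split_cost (k - 1)) \<le> D * (2 * split_cost k)"
proof -
  obtain j where j: "k = Suc j" "j \<ge> 1" using assms(1) by (cases k) auto
  define s where "s = split_cost j"
  have s1: "split_cost k = s + 6 / real k" using split_cost_Suc[OF j(2)] by (simp add: s_def j)
  have s2: "split_cost (k + 1) = s + 6 / real k + 6 / (real k + 1)"
    using split_cost_Suc[of k] assms(1) s1 by (simp add: add.commute)
  have s0: "split_cost (k - 1) = s" by (simp add: s_def j)
  have k: "real k \<ge> 2" using assms(1) by simp
  have "1 + 6 / real k + 6 / (real k + 1) \<le> 1 + 6 / 2 + 6 / 3"
    using k by (intro add_mono divide_left_mono) auto
  then have "(real p - 1) * (1 + 6 / real k + 6 / (real k + 1)) \<le> (real p - 1) * 6"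
    using assms(2) by (intro mult_left_mono) auto
  also have "\<dots> = ((real p - 1) * real k) * (6 / real k)" using k by simp
  also have "\<dots> \<le> D * (6 / real k)"
  proof (rule mult_right_mono)
    have "(real p - 1) * real k = real p * real k - real k" by (simp add: algebra_simps)
    then show "(real p - 1) * real k \<le> D" using assms(3) k by linarith
  qed simp
  finally have "(real p - 1) * (1 + 6 / real k + 6 / (real k + 1)) \<le> D * (6 / real k)" .
  moreover define u v where "u = 6 / real k" and "v = 6 / (real k + 1)"
  ultimately have "(real p - 1) * (1 + u + v) \<le> D * u" by simp
  moreover have "(real p - 1) * (2 + 2 * (s + u + v)) + (D - (real p - 1)) * (2 * s) =
      2 * ((real p - 1) * (1 + u + v)) + D * (2 * s)" by (simp add: algebra_simps)
  moreover have "D * (2 * (s + u)) = 2 * (D * u) + D * (2 * s)" by (simp add: algebra_simps)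
  ultimately show ?thesis unfolding s0 s1 s2 u_def[symmetric] v_def[symmetric] by linarith
qed

lemma sum_mset_indicator:
  "(\<Sum>q\<in>#R. real q * (if q = a then c else 0)) = real a * c * real (count R a)"
  by (induction R) (auto simp: algebra_simps)

lemma sum_mset_real: "(\<Sum>q\<in>#R. real q) = real (\<Sum>\<^sub># R)"
  by (induction R) auto

lemma sum_mset_affine:
  "(\<Sum>q\<in>#R. real q * (u + v q)) = u * real (\<Sum>\<^sub># R) + (\<Sum>q\<in>#R. real q * v q)"
  by (induction R) (auto simp: algebra_simps)

lemma sum_mset_diff_real: "(\<Sum>q\<in>#R. f q - h q :: real) = (\<Sum>q\<in>#R. f q) - (\<Sum>q\<in>#R. h q)"
  by (induction R) auto

lemma sum_mset_abs_le:
  assumes "\<And>q. q \<in># R \<Longrightarrow> \<bar>f q\<bar> \<le> b q"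
  shows "\<bar>\<Sum>q\<in>#R. real q * f q\<bar> \<le> (\<Sum>q\<in>#R. real q * b q)"
  using assms
proof (induction R)
  case (add a R)
  have "\<bar>real a * f a\<bar> \<le> real a * b a" using add.prems[of a] by (simp add: abs_mult mult_left_mono)
  moreover have "\<bar>\<Sum>q\<in>#R. real q * f q\<bar> \<le> (\<Sum>q\<in>#R. real q * b q)" using add by simp
  ultimately show ?case using abs_triangle_ineq[of "real a * f a" "\<Sum>q\<in>#R. real q * f q"] by simp
qed simp

lemma sum_mset_le:
  assumes "\<And>q. q \<in># R \<Longrightarrow> f q \<le> (b q :: real)"
  shows "(\<Sum>q\<in>#R. real q * f q) \<le> (\<Sum>q\<in>#R. real q * b q)"
  using assms by (intro sum_mset_mono mult_left_mono) auto

text \<open>A loop is glued, and \<open>L\<close> includes it. The number of loops decreases unless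
  a bigon is hit, so \<open>L\<^sup>2\<close> tends to lose \<open>2 * L - 1\<close>. Bigons carry
  at most half of the sides and offset at most half of this; as \<open>8 / n * D \<ge> 1\<close>,
  the other half pays for the \<open>L - 1\<close> loops at which a vertex would be closed.\<close>

lemma merge_loop_cost:
  assumes P: "0 \<notin># R" and L: "L = count R 1 + 1" and D: "real (\<Sum>\<^sub># R) = D" "n > 0" "n / 8 \<le> D"
    and few: "L \<le> 2 \<or> real (L + count R 2) \<le> n / 64"
  shows "(\<Sum>q\<in>#R. real q * (8 / n * loop_cost (count (add_mset (q - 1) (R - {#q#})) 1) +
             real (count (add_mset (q - 1) (R - {#q#})) 0))) \<le> 2 + 8 / n * (D * loop_cost L)" (is "?S \<le> _")
proof -
  have c0: "real (count (add_mset (q - 1) (R - {#q#})) 0) = (if q = 1 then 1 else 0)" if "q \<in># R" for q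
    using P that by (cases "q = 0") (auto simp: not_in_iff)
  have c1: "count (add_mset (q - 1) (R - {#q#})) 1 + 1 + (if q = 1 then 1 else 0) = L + (if q = 2 then 1 else 0)"
    if "q \<in># R" for q
    using that P L by (cases "q = 1") (auto simp: Suc_diff_Suc count_greater_zero_iff)
  define \<beta> where "\<beta> = 8 / n"
  have \<beta>: "\<beta> > 0" "\<beta> * D \<ge> 1" using D by (auto simp: \<beta>_def field_simps)
  show ?thesis
  proof (cases "L \<le> 2")
    case True
    have "?S \<le> (\<Sum>q\<in>#R. real q * (if q = 1 then 1 else 0))"
    proof (rule sum_mset_le)
      fix q assume q: "q \<in># R"
      have "count (add_mset (q - 1) (R - {#q#})) 1 \<le> 2" using c1[OF q] True by (auto split: if_splits)
      then show "8 / n * loop_cost (count (add_mset (q - 1) (R - {#q#})) 1) +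
             real (count (add_mset (q - 1) (R - {#q#})) 0) \<le> (if q = 1 then 1 else 0)"
        unfolding c0[OF q] by (simp add: loop_cost_def)
    qed
    also have "\<dots> = real (count R 1)" unfolding sum_mset_indicator by simp
    also have "\<dots> \<le> 2" using True L by simp
    finally show ?thesis using True by (simp add: loop_cost_def)
  next
    case False
    let ?l = "real L"
    have "?S \<le> (\<Sum>q\<in>#R. real q * (\<beta> * (?l - 1)\<^sup>2 + ((if q = 1 then 1 else 0) + (if q = 2 then \<beta> * (2 * ?l - 1) else 0))))"
    proof (rule sum_mset_le)
      fix q assume q: "q \<in># R"
      let ?c = "count (add_mset (q - 1) (R - {#q#})) 1"
      have l: "loop_cost ?c \<le> (real ?c)\<^sup>2" by (simp add: loop_cost_def)
      have "loop_cost ?c \<le> (?l - 1)\<^sup>2 + (if q = 2 then 2 * ?l - 1 else 0)"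
      proof (cases "q = 2")
        case True
        then have "?c = L" using c1[OF q] by simp
        then show ?thesis using l True by (simp add: power2_eq_square algebra_simps)
      next
        case qn: False
        then have "?c \<le> L - 1" using c1[OF q] by (simp split: if_splits)
        then have "real ?c \<le> ?l - 1" using False by linarith
        then have "(real ?c)\<^sup>2 \<le> (?l - 1)\<^sup>2" by (intro power_mono) auto
        then show ?thesis using l qn by simp
      qed
      then have "\<beta> * loop_cost ?c \<le> \<beta> * ((?l - 1)\<^sup>2 + (if q = 2 then 2 * ?l - 1 else 0))"
        using \<beta> by (intro mult_left_mono) auto
      then show "8 / n * loop_cost ?c + real (count (add_mset (q - 1) (R - {#q#})) 0) \<le>
         \<beta> * (?l - 1)\<^sup>2 + ((if q = 1 then 1 else 0) + (if q = 2 then \<beta> * (2 * ?l - 1) else 0))"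
        unfolding c0[OF q] \<beta>_def[symmetric] by (simp add: algebra_simps split: if_splits)
    qed
    also have "\<dots> = \<beta> * (?l - 1)\<^sup>2 * D + (real (count R 1) + 2 * (\<beta> * (2 * ?l - 1)) * real (count R 2))"
      unfolding sum_mset_affine D(1) unfolding distrib_left sum_mset.distrib sum_mset_indicator by simp
    also have "\<dots> = \<beta> * (?l - 1)\<^sup>2 * D + ((?l - 1) + \<beta> * (2 * ?l - 1) * (2 * real (count R 2)))"
      using L by simp
    also have "\<dots> \<le> 2 + \<beta> * (D * ?l\<^sup>2)"
    proof -
      have l3: "?l \<ge> 3" using False by simp
      have "2 * real (count R 2) \<le> D / 2" using few False D by simp
      then have "\<beta> * (2 * ?l - 1) * (2 * real (count R 2)) \<le> \<beta> * (2 * ?l - 1) * (D / 2)"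
        using \<beta> l3 by (intro mult_left_mono mult_nonneg_nonneg) auto
      also have "\<dots> = (\<beta> * D) * (2 * ?l - 1) - (\<beta> * D) * (?l - 1 / 2)" by (simp add: algebra_simps)
      also have "\<dots> \<le> (\<beta> * D) * (2 * ?l - 1) - 1 * (?l - 1 / 2)"
        using \<beta> l3 by (intro diff_left_mono mult_right_mono) auto
      finally have "\<beta> * (2 * ?l - 1) * (2 * real (count R 2)) \<le> (\<beta> * D) * (2 * ?l - 1) - (?l - 1 / 2)" by simp
      moreover have "\<beta> * (?l - 1)\<^sup>2 * D + (\<beta> * D) * (2 * ?l - 1) = \<beta> * (D * ?l\<^sup>2)"
        by (simp add: power2_eq_square algebra_simps)
      ultimately show ?thesis by linarith
    qed
    finally show ?thesis using False by (simp add: loop_cost_def \<beta>_def)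
  qed
qed

section \<open>The potential and its decrease under peeling\<close>

definition potential :: "real \<Rightarrow> real \<Rightarrow> real \<Rightarrow> nat multiset \<Rightarrow> real" where
  "potential n \<delta> \<eta> P = \<delta> + \<eta> * vertex_cost n P + progress_cost n (half_perimeter P) (polygon_count P)"

lemma progress_cost_nonneg: "n > 0 \<Longrightarrow> 0 \<le> progress_cost n m k"
  unfolding progress_cost_def using split_cost_nonneg[of k] by (intro divide_nonneg_pos add_nonneg_nonneg) auto

lemma vertex_cost_nonneg: "n > 0 \<Longrightarrow> 0 \<le> vertex_cost n P"
  unfolding vertex_cost_def by (intro add_nonneg_nonneg mult_nonneg_nonneg loop_cost_nonneg) auto

lemma polygon_count_le: "polygon_count P \<le> size P"
  by (simp add: polygon_count_def size_filter_mset_lesseq)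

text \<open>\<open>r\<close> is the loss in \<open>m - k\<close>. The number of polygons is only
  bounded by \<open>j\<close>, since new polygons of perimeter 0 are not counted.\<close>

lemma progress_cost_mono:
  assumes "n > 0" "real m - real k \<le> real m' - real k' + r" "0 \<le> r" "k' \<le> j"
  shows "progress_cost n m' k' \<le> (max 0 (n / 4 - (real m - real k)) + r + 2 * split_cost j) / (n / 8)"
  unfolding progress_cost_def
  using assms split_cost_mono[OF assms(4)] by (intro divide_right_mono add_mono) auto

text \<open>Gluing a side of the smallest polygon. As its perimeter is at most the average, it splits with
  probability at most the inverse of the number of polygons, and otherwise merges with another one.\<close>

lemma potential_step:
  assumes n: "n > 0" and p: "p \<ge> 1" and R: "R \<noteq> {#}" "\<And>q. q \<in># R \<Longrightarrow> p \<le> q"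
    and sum: "\<Sum>\<^sub># (add_mset p R) = 2 * Suc m" and big: "n / 8 \<le> 2 * real m + 1"
    and few: "few_loops n (add_mset p R)" and \<eta>: "\<eta> \<ge> 0"
  shows "(\<Sum>d<p - 1. potential n \<delta> \<eta> (add_mset d (add_mset (p - 2 - d) R))) +
      (\<Sum>q\<in>#R. real q * potential n \<delta> \<eta> (add_mset (p + q - 2) (R - {#q#})))
      \<le> (2 * real m + 1) * potential n \<delta> \<eta> (add_mset p R)"
proof -
  define P where "P = add_mset p R"
  define k where "k = size P"
  define D where "D = 2 * real m + 1"
  define X where "X = real (Suc m) - real k"
  define C where "C = max 0 (n / 4 - X)"
  define base where "base = \<delta> + \<eta> * (16 / n * real m)"
  have R0: "0 \<notin># R" using R(2)[of 0] p by auto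
  have k2: "k \<ge> 2" using R(1) by (cases "size R") (auto simp: k_def P_def)
  have hP: "half_perimeter P = Suc m" using sum by (simp add: half_perimeter_def P_def)
  have filt: "filter_mset ((<) 0) R = R"
  proof -
    have "filter_mset ((<) 0) R = filter_mset (\<lambda>_. True) R"
      by (rule filter_mset_cong[OF refl]) (use R0 in \<open>metis gr0I\<close>)
    then show ?thesis by simp
  qed
  have kP: "polygon_count P = k" using p filt by (simp add: polygon_count_def P_def k_def)
  have sumR: "real (\<Sum>\<^sub># R) = D - (real p - 1)"
  proof -
    have s: "p + \<Sum>\<^sub># R = 2 * Suc m" using sum by simp
    have "real (p + \<Sum>\<^sub># R) = real (2 * Suc m)" by (simp only: s)
    then have "real p + real (\<Sum>\<^sub># R) = 2 * real m + 2" by (simp del: of_nat_sum_mset)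
    then show ?thesis unfolding D_def by linarith
  qed
  have pk: "real p * real k \<le> D + 1"
  proof -
    have "p * size R \<le> \<Sum>\<^sub># R" using R(2) by (induction R) (auto simp: algebra_simps add_le_mono)
    then have "p * k \<le> 2 * Suc m" using sum by (simp add: k_def P_def)
    then have "real (p * k) \<le> real (2 * Suc m)" by (simp only: of_nat_le_iff)
    then show ?thesis by (simp add: D_def)
  qed
  have split: "potential n \<delta> \<eta> (add_mset d (add_mset (p - 2 - d) R)) \<le>
      base + \<eta> * real (count {#d, p - 2 - d#} 0) + (C + 2 + 2 * split_cost (k + 1)) / (n / 8)"
    if d: "d < p - 1" for d
  proof -
    let ?S = "add_mset d (add_mset (p - 2 - d) R)"
    have h: "half_perimeter ?S = m" using sum d by (simp add: half_perimeter_def)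
    \<comment> \<open>A split needs \<open>p \<ge> 2\<close>, so there was no loop; the two parts
      are at most two loops, which \<open>loop_cost\<close> does not charge.\<close>
    have "count R 1 = 0" using R(2)[of 1] d by (auto simp: not_in_iff[symmetric])
    then have "loop_cost (count ?S 1) = 0" by (simp add: loop_cost_def)
    moreover have "count ?S 0 = count {#d, p - 2 - d#} 0" using R0 by (simp add: not_in_iff)
    ultimately have v: "vertex_cost n ?S = 16 / n * real m + real (count {#d, p - 2 - d#} 0)"
      unfolding vertex_cost_def h by simp
    have kS: "polygon_count ?S \<le> k + 1" using polygon_count_le[of ?S] by (simp add: k_def P_def)
    have "progress_cost n m (polygon_count ?S) \<le> (C + 2 + 2 * split_cost (k + 1)) / (n / 8)"
      unfolding C_def X_def using kS by (intro progress_cost_mono n) auto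
    then show ?thesis unfolding potential_def v h base_def by (simp add: distrib_left)
  qed
  define cost where "cost q = 8 / n * loop_cost (count (add_mset (p + q - 2) (R - {#q#})) 1) +
       real (count (add_mset (p + q - 2) (R - {#q#})) 0)" for q
  have merge: "potential n \<delta> \<eta> (add_mset (p + q - 2) (R - {#q#})) \<le>
      base + (C + 2 * split_cost (k - 1)) / (n / 8) + \<eta> * cost q"
    if q: "q \<in># R" for q
  proof -
    let ?M = "add_mset (p + q - 2) (R - {#q#})"
    obtain R' where R': "R = add_mset q R'" using multi_member_split[OF q] by auto
    have h: "half_perimeter ?M = m" using sum p R(2)[OF q] by (simp add: half_perimeter_def R')
    have v: "vertex_cost n ?M = 16 / n * real m + cost q"
      unfolding vertex_cost_def h cost_def by simp
    have kM: "polygon_count ?M \<le> k - 1" using polygon_count_le[of ?M] by (simp add: k_def P_def R')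
    then have "real (polygon_count ?M) + 1 \<le> real k" using k2 by linarith
    then have "progress_cost n m (polygon_count ?M) \<le> (C + 0 + 2 * split_cost (k - 1)) / (n / 8)"
      unfolding C_def X_def using kM by (intro progress_cost_mono n) auto
    then show ?thesis unfolding potential_def v h base_def by (simp add: distrib_left)
  qed
  have D8: "n / 8 \<le> D" "D > 0" using big n by (auto simp: D_def)
  \<comment> \<open>Each gluing lowers the half perimeter by one. Summed over the \<open>D\<close>
    partners, the term \<open>16 / n * m\<close> of \<open>vertex_cost\<close> thus releases at
    least 2, enough for the vertices not paid by \<open>loop_cost\<close>.\<close>
  have D16: "2 \<le> D * (16 / n)" using D8 n by (simp add: field_simps)
  have costs: "(\<Sum>d<p - 1. real (count {#d, p - 2 - d#} 0)) + (\<Sum>q\<in>#R. real q * cost q) \<le>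
     D * (16 / n) + D * (8 / n * loop_cost (count P 1))"
  proof (cases "p = 1")
    case True
    have "(\<Sum>q\<in>#R. real q * cost q) \<le> 2 + 8 / n * (D * loop_cost (count P 1))"
      using merge_loop_cost[OF R0, of "count P 1" D n] few sumR n D8 True
      by (simp add: P_def cost_def few_loops_def add_ac)
    then show ?thesis using D16 True by (simp add: mult_ac)
  next
    case False
    then have p2: "p \<ge> 2" using p by simp
    have "cost q = 0" if q: "q \<in># R" for q
    proof -
      have "q \<ge> p" using R(2)[OF q] .
      moreover have "1 \<notin># R - {#q#}" "0 \<notin># R - {#q#}" using R(2)[of 1] p2 R0 by (auto dest: in_diffD)
      ultimately show ?thesis using p2 by (auto simp: cost_def loop_cost_def not_in_iff)
    qed
    then have "(\<Sum>q\<in>#R. real q * cost q) = (\<Sum>q\<in>#R. 0)" by (intro arg_cong[of _ _ sum_mset] image_mset_cong) simp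
    \<comment> \<open>A split closes a vertex only when the partner is adjacent to the peeled side,
      on either end; for \<open>p = 2\<close> both ends count at once.\<close>
    moreover have "(\<Sum>d<p - 1. real (count {#d, p - 2 - d#} 0)) \<le> 2"
    proof -
      have "(\<Sum>d<p - 1. real (count {#d, p - 2 - d#} 0)) =
        (\<Sum>d<p - 1. (if d = 0 then 1 else 0) + (if d = p - 2 then 1 else 0))"
        using p2 by (intro sum.cong) auto
      also have "\<dots> \<le> 2" using p2 by (simp add: sum.distrib)
      finally show ?thesis .
    qed
    moreover have "0 \<le> D * (8 / n * loop_cost (count P 1))"
      using D8 n by (intro mult_nonneg_nonneg loop_cost_nonneg) auto
    ultimately show ?thesis using D16 by simp
  qed
  define bS bM where "bS = (C + 2 + 2 * split_cost (k + 1)) / (n / 8)" and "bM = (C + 2 * split_cost (k - 1)) / (n / 8)"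
  have "(\<Sum>d<p - 1. potential n \<delta> \<eta> (add_mset d (add_mset (p - 2 - d) R))) \<le>
     (\<Sum>d<p - 1. base + \<eta> * real (count {#d, p - 2 - d#} 0) + bS)"
    by (intro sum_mono split[folded bS_def]) simp
  also have "\<dots> = (real p - 1) * (base + bS) + \<eta> * (\<Sum>d<p - 1. real (count {#d, p - 2 - d#} 0))"
    using p by (simp only: sum.distrib sum_distrib_left sum_constant card_lessThan) (simp add: of_nat_diff algebra_simps)
  finally have 1: "(\<Sum>d<p - 1. potential n \<delta> \<eta> (add_mset d (add_mset (p - 2 - d) R))) \<le>
    (real p - 1) * (base + bS) + \<eta> * (\<Sum>d<p - 1. real (count {#d, p - 2 - d#} 0))" .
  have "(\<Sum>q\<in>#R. real q * potential n \<delta> \<eta> (add_mset (p + q - 2) (R - {#q#}))) \<le>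
     (\<Sum>q\<in>#R. real q * ((base + bM) + \<eta> * cost q))"
    by (rule sum_mset_le) (rule merge[folded bM_def])
  also have "\<dots> = (D - (real p - 1)) * (base + bM) + \<eta> * (\<Sum>q\<in>#R. real q * cost q)"
    unfolding sum_mset_affine sumR by (simp add: sum_mset_distrib_left mult_ac)
  finally have 2: "(\<Sum>q\<in>#R. real q * potential n \<delta> \<eta> (add_mset (p + q - 2) (R - {#q#}))) \<le>
    (D - (real p - 1)) * (base + bM) + \<eta> * (\<Sum>q\<in>#R. real q * cost q)" .
  have 3: "(real p - 1) * bS + (D - (real p - 1)) * bM \<le> D * progress_cost n (Suc m) k"
  proof -
    have "(real p - 1) * (C + 2 + 2 * split_cost (k + 1)) + (D - (real p - 1)) * (C + 2 * split_cost (k - 1)) \<le>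
       D * (C + 2 * split_cost k)"
      using split_cost_step[OF k2 p pk] by (simp add: algebra_simps)
    then have "((real p - 1) * (C + 2 + 2 * split_cost (k + 1)) + (D - (real p - 1)) * (C + 2 * split_cost (k - 1))) / (n / 8) \<le>
       D * (C + 2 * split_cost k) / (n / 8)"
      using n by (intro divide_right_mono) auto
    moreover have "(a * x + b * y) / z = a * (x / z) + b * (y / z)" for a b x y z :: real
      by (simp add: add_divide_distrib)
    ultimately show ?thesis by (simp only: bS_def bM_def progress_cost_def C_def X_def times_divide_eq_right)
  qed
  have 4: "\<eta> * ((\<Sum>d<p - 1. real (count {#d, p - 2 - d#} 0)) + (\<Sum>q\<in>#R. real q * cost q)) \<le>
     \<eta> * (D * (16 / n) + D * (8 / n * loop_cost (count P 1)))"
    by (rule mult_left_mono[OF costs \<eta>])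
  have zero: "count P 0 = 0" using R0 p by (auto simp: P_def not_in_iff)
  have "D * potential n \<delta> \<eta> P = D * base + \<eta> * (D * (16 / n) + D * (8 / n * loop_cost (count P 1))) +
     D * progress_cost n (Suc m) k"
    unfolding potential_def vertex_cost_def hP kP zero base_def by (simp add: algebra_simps add_divide_distrib)
  moreover have "(real p - 1) * (base + bS) + (D - (real p - 1)) * (base + bM) =
      D * base + ((real p - 1) * bS + (D - (real p - 1)) * bM)"
    by (simp only: distrib_left left_diff_distrib)
  ultimately show ?thesis
    using 1 2 3 4 unfolding P_def[symmetric] D_def[symmetric] distrib_left[of \<eta> "\<Sum>d<p - 1. _ d"] by linarith
qed

lemma few_loops_split:
  assumes "p \<ge> 2" "\<And>q. q \<in># R \<Longrightarrow> p \<le> q"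
  shows "few_loops n (add_mset d (add_mset d' R))"
proof -
  have "1 \<notin># R" using assms(2)[of 1] assms(1) by auto
  then show ?thesis by (simp add: few_loops_def not_in_iff)
qed

text \<open>Gluing a loop removes a loop, turns a bigon into a loop or a triangle into a bigon, so
  neither the number of loops nor its sum with the number of bigons grows. For
  \<open>p \<ge> 2\<close> there is no loop before or after.\<close>

lemma few_loops_merge:
  assumes p: "p \<ge> 1" "\<And>q. q \<in># R \<Longrightarrow> p \<le> q" and q: "q \<in># R" and few: "few_loops n (add_mset p R)"
  shows "few_loops n (add_mset (p + q - 2) (R - {#q#}))"
proof -
  obtain R' where R': "R = add_mset q R'" using multi_member_split[OF q] by auto
  show ?thesis
  proof (cases "p = 1")
    case False
    then have "1 \<notin># R'" using p(1) p(2)[of 1] R' by auto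
    then show ?thesis by (simp add: few_loops_def R' not_in_iff)
  next
    case True
    have "q \<ge> 1" using p(2)[OF q] p(1) by simp
    then consider "q = 1" | "q = 2" | "q = 3" | "q > 3" by linarith
    then show ?thesis using few by cases (auto simp: few_loops_def R' True)
  qed
qed

text \<open>The parity of \<open>m + size P\<close> survives each gluing and changes when a polygon
  of perimeter 0 is removed, which a shift of \<open>g\<close> compensates at the price
  \<open>\<eta>\<close>. As this removal keeps the perimeter, the size enters the induction measure.
  While \<open>m - k > n / 8\<close>, a single remaining polygon has \<open>8 m \<ge> n\<close>, as
  required by the one-polygon bound.\<close>

lemma gluing_mean_close:
  assumes n: "ln (real n) > 1" and \<eta>: "4 / sqrt (ln (real n)) \<le> \<eta>" and \<delta>: "\<delta> \<ge> 0"
    and one: "\<And>m g. real n \<le> 8 * real m \<Longrightarrow> m \<le> n \<Longrightarrow> test_function g \<Longrightarrow>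
      \<bar>one_polygon_mean m g - conditional_mean (ln (real n)) (odd m) g\<bar> \<le> \<delta>"
  shows "\<Sum>\<^sub># P = 2 * m \<Longrightarrow> m \<le> n \<Longrightarrow> few_loops (real n) P \<Longrightarrow> test_function g \<Longrightarrow>
    \<bar>gluing_mean P g - conditional_mean (ln (real n)) (even (m + size P)) g\<bar> \<le> potential (real n) \<delta> \<eta> P"
proof (induction "\<Sum>\<^sub># P + size P" arbitrary: P m g rule: less_induct)
  case less
  note sum = less.prems(1) and mn = less.prems(2) and few = less.prems(3) and g = less.prems(4)
  let ?c = "conditional_mean (ln (real n))"
  have npos: "real n > 0" using n by (cases "n = 0") auto
  have \<eta>0: "\<eta> \<ge> 0" by (rule order_trans[OF _ \<eta>]) (use n in simp)
  have h: "half_perimeter P = m" using sum by (simp add: half_perimeter_def)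
  have trivial: "\<bar>gluing_mean P g - ?c e g\<bar> \<le> 1" for e
    using gluing_mean_test_function[OF g, of P] conditional_mean_test_function[OF n g, of e] sum by simp
  show ?case
  proof (cases "0 \<in># P")
    case True
    then obtain Q where P: "P = add_mset 0 Q" using multi_member_split[of 0 P] by auto
    have gS: "test_function (\<lambda>j. g (Suc j))" using g by (simp add: test_function_def)
    have "\<bar>gluing_mean Q (\<lambda>j. g (Suc j)) - ?c (even (m + size Q)) (\<lambda>j. g (Suc j))\<bar> \<le> potential (real n) \<delta> \<eta> Q"
      using less.hyps[of Q m] sum mn few gS by (simp add: P few_loops_def)
    moreover have "\<bar>?c (even (m + size Q)) (\<lambda>j. g (Suc j)) - ?c (even (m + size P)) g\<bar> \<le> \<eta>"
      using conditional_mean_shift[OF n g, of "even (m + size Q)"] \<eta> by (simp add: P)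
    moreover have "potential (real n) \<delta> \<eta> P = potential (real n) \<delta> \<eta> Q + \<eta>"
      by (simp add: potential_def vertex_cost_def polygon_count_def half_perimeter_def P distrib_left)
    ultimately show ?thesis unfolding P gluing_mean_zero_polygon by (simp add: P)
  next
    case False
    have k: "polygon_count P = size P"
    proof -
      have "filter_mset ((<) 0) P = filter_mset (\<lambda>_. True) P"
        by (rule filter_mset_cong[OF refl]) (use False in \<open>metis gr0I\<close>)
      then show ?thesis by (simp add: polygon_count_def)
    qed
    have costs: "0 \<le> \<eta> * vertex_cost (real n) P" "0 \<le> progress_cost (real n) m (size P)"
      using npos \<eta>0 by (auto intro!: mult_nonneg_nonneg vertex_cost_nonneg progress_cost_nonneg)
    show ?thesis
    proof (cases "real m - real (size P) \<le> real n / 8")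
      case True
      then have "real n / 8 \<le> max 0 (real n / 4 - (real m - real (size P))) + 2 * split_cost (size P)"
        using split_cost_nonneg[of "size P"] by simp
      then have "1 \<le> progress_cost (real n) m (size P)"
        unfolding progress_cost_def using npos by (simp add: le_divide_eq)
      then have "1 \<le> potential (real n) \<delta> \<eta> P"
        unfolding potential_def h k using costs \<delta> by simp
      then show ?thesis using trivial by (rule order_trans[rotated])
    next
      case far: False
      then have m8: "real m > real n / 8" by simp
      then obtain m' where m: "m = Suc m'" using npos by (cases m) auto
      have "P \<noteq> {#}" using sum m by auto
      define p where "p = Min (set_mset P)"
      have pP: "p \<in># P" unfolding p_def using \<open>P \<noteq> {#}\<close> by (intro Min_in) auto
      then obtain R where P: "P = add_mset p R" using multi_member_split[of p P] by auto
      have min: "p \<le> q" if "q \<in># R" for q unfolding p_def using that by (intro Min_le) (auto simp: P)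
      have p1: "p \<ge> 1" using False pP by (cases p) auto
      show ?thesis
      proof (cases "R = {#}")
        case True
        have "\<bar>one_polygon_mean m g - ?c (odd m) g\<bar> \<le> \<delta>"
          using one[of m g] m8 mn g by simp
        moreover have "P = {#2 * m#}" using sum True by (simp add: P)
        moreover have "\<delta> \<le> potential (real n) \<delta> \<eta> P"
          unfolding potential_def h k using costs by simp
        ultimately show ?thesis by simp
      next
        case R: False
        define e where "e = even (m + size P)"
        define D where "D = 2 * real m' + 1"
        have D: "D > 0" by (simp add: D_def)
        have sumP: "\<Sum>\<^sub># (add_mset p R) = 2 * Suc m'" using sum by (simp add: P m)
        have S: "\<bar>gluing_mean (add_mset d (add_mset (p - 2 - d) R)) g - ?c e g\<bar>
            \<le> potential (real n) \<delta> \<eta> (add_mset d (add_mset (p - 2 - d) R))" if d: "d < p - 1" for d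
        proof -
          let ?S = "add_mset d (add_mset (p - 2 - d) R)"
          have s: "\<Sum>\<^sub># ?S = 2 * m'" using sumP d by simp
          moreover have "even (m' + size ?S) = e" by (simp add: e_def P m)
          moreover have "\<Sum>\<^sub># ?S + size ?S < \<Sum>\<^sub># P + size P" using s sum m by (simp add: P)
          moreover have "few_loops (real n) ?S" using d min by (intro few_loops_split[of p]) auto
          ultimately show ?thesis using less.hyps[of ?S m' g] mn g m by simp
        qed
        have M: "\<bar>gluing_mean (add_mset (p + q - 2) (R - {#q#})) g - ?c e g\<bar>
            \<le> potential (real n) \<delta> \<eta> (add_mset (p + q - 2) (R - {#q#}))" if q: "q \<in># R" for q
        proof -
          let ?M = "add_mset (p + q - 2) (R - {#q#})"
          obtain R' where R': "R = add_mset q R'" using multi_member_split[OF q] by auto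
          have s: "\<Sum>\<^sub># ?M = 2 * m'" using sumP p1 min[OF q] by (simp add: R')
          moreover have "even (m' + size ?M) = e" by (simp add: e_def P m R')
          moreover have "\<Sum>\<^sub># ?M + size ?M < \<Sum>\<^sub># P + size P" using s sum m by (simp add: P R')
          moreover have "few_loops (real n) ?M" using few p1 min q unfolding P by (intro few_loops_merge) auto
          ultimately show ?thesis using less.hyps[of ?M m' g] mn g m by simp
        qed
        \<comment> \<open>The weights of the peeling equation add up to \<open>D\<close>, so the
          target can be subtracted term by term.\<close>
        have "real (p - 1) + real (\<Sum>\<^sub># R) = D"
        proof -
          have s: "(p - 1) + \<Sum>\<^sub># R = 2 * m' + 1" using sumP p1 by simp
          have "real ((p - 1) + \<Sum>\<^sub># R) = real (2 * m' + 1)" by (simp only: s)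
          then show ?thesis by (simp add: D_def del: of_nat_sum_mset of_nat_diff)
        qed
        then have "D * ?c e g = real (p - 1) * ?c e g + (\<Sum>q\<in>#R. real q * ?c e g)"
          by (metis distrib_right sum_mset_distrib_right sum_mset_real)
        then have "D * (gluing_mean P g - ?c e g) =
            (\<Sum>d<p - 1. gluing_mean (add_mset d (add_mset (p - 2 - d) R)) g - ?c e g) +
            ((\<Sum>q\<in>#R. real q * gluing_mean (add_mset (p + q - 2) (R - {#q#})) g) - (\<Sum>q\<in>#R. real q * ?c e g))"
          unfolding right_diff_distrib P D_def gluing_mean_peel[OF p1 sumP] by (simp add: sum_subtractf)
        also have "(\<Sum>q\<in>#R. real q * gluing_mean (add_mset (p + q - 2) (R - {#q#})) g) - (\<Sum>q\<in>#R. real q * ?c e g) =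
            (\<Sum>q\<in>#R. real q * (gluing_mean (add_mset (p + q - 2) (R - {#q#})) g - ?c e g))"
          unfolding right_diff_distrib sum_mset_diff_real by simp
        finally have eq: "D * (gluing_mean P g - ?c e g) =
            (\<Sum>d<p - 1. gluing_mean (add_mset d (add_mset (p - 2 - d) R)) g - ?c e g) +
            (\<Sum>q\<in>#R. real q * (gluing_mean (add_mset (p + q - 2) (R - {#q#})) g - ?c e g))" .
        have "D * \<bar>gluing_mean P g - ?c e g\<bar> = \<bar>D * (gluing_mean P g - ?c e g)\<bar>"
          using D by (simp add: abs_mult)
        also have "\<dots> \<le> (\<Sum>d<p - 1. potential (real n) \<delta> \<eta> (add_mset d (add_mset (p - 2 - d) R))) +
            (\<Sum>q\<in>#R. real q * potential (real n) \<delta> \<eta> (add_mset (p + q - 2) (R - {#q#})))"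
          unfolding eq
          by (rule order_trans[OF abs_triangle_ineq], rule add_mono, rule order_trans[OF sum_abs],
              rule sum_mono, rule S, simp, rule sum_mset_abs_le, rule M)
        also have "\<dots> \<le> D * potential (real n) \<delta> \<eta> P"
          unfolding D_def P
        proof (rule potential_step[OF npos p1 R _ sumP])
          show "real n / 8 \<le> 2 * real m' + 1" using m8 m by simp
        qed (use few P min \<eta>0 in auto)
        finally show ?thesis using D by (simp add: e_def)
      qed
    qed
  qed
qed

section \<open>Total variation distance\<close>

lemma pmf_sums_prob:
  fixes p :: "nat pmf"
  shows "(\<lambda>k. pmf p k * indicator A k) sums measure_pmf.prob p A"
proof -
  let ?B = "\<lambda>k. if k \<in> A then {k} else {}"
  have "(\<lambda>k. measure_pmf.prob p (?B k)) sums measure_pmf.prob p (\<Union>k. ?B k)"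
    by (rule measure_pmf.finite_measure_UNION) (auto simp: disjoint_family_on_def)
  moreover have "(\<Union>k. ?B k) = A" by auto
  moreover have "measure_pmf.prob p (?B k) = pmf p k * indicator A k" for k
    by (simp add: measure_pmf_single)
  ultimately show ?thesis by simp
qed

lemma prob_poisson_pmf:
  assumes "\<alpha> > 0"
  shows "measure_pmf.prob (poisson_pmf \<alpha>) A = poisson_mean \<alpha> (indicator A)"
proof -
  have "(\<lambda>k. exp (- \<alpha>) * (indicator A k / fact k * \<alpha> ^ k)) sums measure_pmf.prob (poisson_pmf \<alpha>) A"
    using pmf_sums_prob[of "poisson_pmf \<alpha>" A] assms by (simp add: mult_ac)
  moreover have "(\<lambda>k. exp (- \<alpha>) * (indicator A k / fact k * \<alpha> ^ k)) sums poisson_mean \<alpha> (indicator A)"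
    unfolding poisson_mean_def
    by (intro sums_mult summable_sums poisson_summable[of _ 1]) (simp add: indicator_def)
  ultimately show ?thesis by (rule sums_unique2)
qed

lemma prob_cond_poisson_pmf:
  assumes \<alpha>: "\<alpha> > 0"
  shows "measure_pmf.prob (cond_pmf (poisson_pmf \<alpha>) {k. even k = e}) A = conditional_mean \<alpha> e (indicator A)"
proof -
  let ?p = "poisson_pmf \<alpha>" and ?s = "{k :: nat. even k = e}"
  have ne: "set_pmf ?p \<inter> ?s \<noteq> {}"
  proof -
    have "(if e then 0 else 1) \<in> ?s" by auto
    then show ?thesis using \<alpha> by auto
  qed
  have par: "measure_pmf.prob ?p (B \<inter> ?s) = parity_mean \<alpha> e (indicator B)" for B
    unfolding prob_poisson_pmf[OF \<alpha>] parity_mean_def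
    by (rule arg_cong[of _ _ "poisson_mean \<alpha>"]) (auto simp: indicator_def fun_eq_iff)
  have "pmf (cond_pmf ?p ?s) k * indicator A k = pmf ?p k * indicator (A \<inter> ?s) k / measure_pmf.prob ?p ?s" for k
    unfolding pmf_cond[OF ne] by (auto simp: indicator_def)
  then have "(\<lambda>k. pmf ?p k * indicator (A \<inter> ?s) k / measure_pmf.prob ?p ?s) sums measure_pmf.prob (cond_pmf ?p ?s) A"
    using pmf_sums_prob[of "cond_pmf ?p ?s" A] by presburger
  moreover have "(\<lambda>k. pmf ?p k * indicator (A \<inter> ?s) k / measure_pmf.prob ?p ?s) sums
      (measure_pmf.prob ?p (A \<inter> ?s) / measure_pmf.prob ?p ?s)"
    by (intro sums_divide pmf_sums_prob)
  ultimately have "measure_pmf.prob (cond_pmf ?p ?s) A = measure_pmf.prob ?p (A \<inter> ?s) / measure_pmf.prob ?p ?s"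
    by (rule sums_unique2)
  also have "measure_pmf.prob ?p ?s = parity_mean \<alpha> e (\<lambda>_. 1)"
    using par[of UNIV] by simp
  finally show ?thesis unfolding par conditional_mean_def .
qed

text \<open>Every labeling conjugates the permutation to \<open>next_side\<close>, so the law given
  the labeling is always the same and the labeling averages out.\<close>

lemma prob_vertex_count_pmf:
  assumes P: "configuration P"
  shows "measure_pmf.prob (vertex_count_pmf P) A = gluing_mean P (indicator A)"
proof -
  let ?m = "half_perimeter P"
  let ?I = "fixpoint_free_involutions (labels ?m)"
  let ?L = "labelings P"
  let ?f = "\<lambda>l \<omega>. card (glued_vertices P l \<omega>)"
  have fin: "finite ?I" "?I \<noteq> {}" "finite ?L" "?L \<noteq> {}"
    using finite_fixpoint_free_involutions[of "labels ?m"] fixpoint_free_involutions_nonempty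
      finite_labelings labelings_nonempty[OF P] by (auto simp: labels_def)
  have zero: "count P 0 = 0" using P by (auto simp: configuration_def not_in_iff[symmetric])
  have I: "real (card ?I) = pairings ?m"
    by (rule card_fixpoint_free_involutions) (auto simp: labels_def)
  have next_closed: "next_side a \<in> sides P" if "a \<in> sides P" for a
    using that by (auto simp: sides_def next_side_def)
  have inner: "measure_pmf.prob (map_pmf (?f l) (pmf_of_set ?I)) B = gluing_mean P (indicator B)" if l: "l \<in> ?L" for l B
  proof -
    have bij: "bij_betw l (sides P) (labels ?m)" using l by (simp add: labelings_def)
    have "gluing_sum (labels ?m) (polygon_perm P l) 0 (indicator B) = gluing_sum (sides P) next_side 0 (indicator B)"
    proof (rule gluing_sum_conjugate[OF bij next_closed])
      show "polygon_perm P l (l a) = l (next_side a)" if "a \<in> sides P" for a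
        unfolding polygon_perm_def using bij that by (intro map_permutation_apply) (simp add: bij_betw_def)
    qed
    also have "\<dots> = vertex_sum P (indicator B)" by (simp add: vertex_sum_def zero)
    finally have sum: "(\<Sum>\<omega>\<in>?I. indicator B (?f l \<omega>)) = vertex_sum P (indicator B)"
      by (simp add: gluing_sum_def glued_vertices_def)
    have "measure_pmf.prob (map_pmf (?f l) (pmf_of_set ?I)) B = real (card (?I \<inter> ?f l -` B)) / real (card ?I)"
      using fin by (simp add: measure_map_pmf measure_pmf_of_set)
    also have "real (card (?I \<inter> ?f l -` B)) = (\<Sum>\<omega>\<in>?I. indicator B (?f l \<omega>))"
      using fin(1) by (simp add: indicator_def sum.If_cases Int_def)
    finally show ?thesis unfolding sum I gluing_mean_def .
  qed
  obtain l0 where l0: "l0 \<in> ?L" using fin by auto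
  have "vertex_count_pmf P = bind_pmf (pmf_of_set ?L) (\<lambda>l. map_pmf (?f l) (pmf_of_set ?I))"
    unfolding vertex_count_pmf_def pair_pmf_def map_bind_pmf by (simp add: map_pmf_def bind_return_pmf)
  also have "\<dots> = bind_pmf (pmf_of_set ?L) (\<lambda>l. map_pmf (?f l0) (pmf_of_set ?I))"
  proof (rule bind_pmf_cong[OF refl])
    fix l assume "l \<in> set_pmf (pmf_of_set ?L)"
    then have l: "l \<in> ?L" using fin by simp
    have law: "pmf (map_pmf (?f l) (pmf_of_set ?I)) k = gluing_mean P (indicator {k})" if "l \<in> ?L" for l k
      unfolding measure_pmf_single[symmetric] by (rule inner[OF that])
    show "map_pmf (?f l) (pmf_of_set ?I) = map_pmf (?f l0) (pmf_of_set ?I)"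
      by (rule pmf_eqI) (simp only: law[OF l] law[OF l0])
  qed
  also have "\<dots> = map_pmf (?f l0) (pmf_of_set ?I)" by (rule bind_pmf_const)
  finally show ?thesis by (simp only: inner[OF l0])
qed

lemma test_function_indicator: "test_function (indicator A)"
  by (simp add: test_function_def indicator_def)

lemma tv_dist_le:
  assumes "\<And>A. \<bar>measure_pmf.prob p A - measure_pmf.prob q A\<bar> \<le> b"
  shows "tv_dist p q \<le> b"
  unfolding tv_dist_def by (rule cSUP_least) (use assms in auto)

lemma tv_dist_nonneg: "0 \<le> tv_dist p q"
proof -
  have "\<bar>measure_pmf.prob p A - measure_pmf.prob q A\<bar> \<le> 1" for A
    using measure_pmf.prob_le_1[of p A] measure_pmf.prob_le_1[of q A]
      measure_nonneg[of "measure_pmf p" A] measure_nonneg[of "measure_pmf q" A] by linarith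
  then have "bdd_above (range (\<lambda>A. \<bar>measure_pmf.prob p A - measure_pmf.prob q A\<bar>))"
    by (intro bdd_aboveI[of _ 1]) auto
  from cSUP_upper[OF UNIV_I[of "{}"] this] show ?thesis unfolding tv_dist_def by simp
qed

section \<open>The initial value of the potential and the limit\<close>

lemma split_cost_le_ln: "k \<ge> 1 \<Longrightarrow> split_cost k \<le> 6 * ln (real k)"
proof (induction k rule: dec_induct)
  case base
  then show ?case by (simp add: split_cost_def)
next
  case (step k)
  have k: "real k > 0" using step by simp
  have "- (ln (real (Suc k)) - ln (real k)) = ln (real k / real (Suc k))" using k by (simp add: ln_div)
  also have "\<dots> \<le> real k / real (Suc k) - 1" using k by (intro ln_le_minus_one) auto
  also have "\<dots> = - (1 / real (Suc k))" by (simp add: field_simps)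
  finally have "6 / real (Suc k) \<le> 6 * (ln (real (Suc k)) - ln (real k))" by simp
  then show ?case using step split_cost_Suc[of k] by simp
qed

text \<open>A loop lacks 2 and a bigon 1 to reach perimeter 3. With few of both, there are hardly
  more than \<open>2 n / 3\<close> polygons, and \<open>m - k\<close> starts of order n.\<close>

lemma three_times_size_le:
  "0 \<notin># P \<Longrightarrow> 3 * size P \<le> \<Sum>\<^sub># P + 2 * count P 1 + count P 2"
proof (induction P)
  case (add p P)
  then have "3 * size P \<le> \<Sum>\<^sub># P + 2 * count P 1 + count P 2" and "p \<noteq> 0" by auto
  then show ?case by (cases "p = 1 \<or> p = 2") auto
qed simp

text \<open>Initially the vertex cost is at most 16 + 8, the 8 coming from at most
  \<open>sqrt n\<close> loops, and \<open>\<eta>\<close> has the factor 4: this gives the first 96.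
  The second is 2 * 6 * 8, from the bound \<open>6 * ln n\<close> on the split cost.\<close>

lemma vertex_count_tv_dist:
  assumes P: "configuration P" "half_perimeter P = n" and n: "ln (real n) > 1"
    and loops: "real (count P 1) \<le> sqrt (real n)" "sqrt (real n) \<le> real n / 128"
    and bigons: "real (count P 2) \<le> real n / 128" and \<delta>: "\<delta> \<ge> 0"
    and one: "\<And>m g. real n \<le> 8 * real m \<Longrightarrow> m \<le> n \<Longrightarrow> test_function g \<Longrightarrow>
      \<bar>one_polygon_mean m g - conditional_mean (ln (real n)) (odd m) g\<bar> \<le> \<delta>"
  shows "tv_dist (vertex_count_pmf P) (cond_pmf (poisson_pmf (ln (real n))) {k. even k = even (n + size P)})
    \<le> \<delta> + 96 / sqrt (ln (real n)) + 96 * ln (real n) / real n"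
proof (rule tv_dist_le)
  fix A
  let ?\<eta> = "4 / sqrt (ln (real n))"
  have npos: "real n > 0" using n by (cases "n = 0") auto
  have sum: "\<Sum>\<^sub># P = 2 * n" using P by (auto simp: configuration_def half_perimeter_def)
  have zero: "0 \<notin># P" using P by (auto simp: configuration_def)
  have few: "few_loops (real n) P" using loops bigons by (simp add: few_loops_def)
  have k: "polygon_count P = size P"
  proof -
    have "filter_mset ((<) 0) P = filter_mset (\<lambda>_. True) P"
      by (rule filter_mset_cong[OF refl]) (use zero in \<open>metis gr0I\<close>)
    then show ?thesis by (simp add: polygon_count_def)
  qed
  have "real (3 * size P) \<le> real (2 * n + 2 * count P 1 + count P 2)"
    using three_times_size_le[OF zero] unfolding sum by (simp only: of_nat_le_iff)
  \<comment> \<open>Hence \<open>n - size P \<ge> n / 4\<close>, and only the split cost remains in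
    \<open>progress_cost\<close>.\<close>
  then have size: "real (size P) \<le> 3 / 4 * real n" using loops bigons by simp
  have size_pos: "size P \<ge> 1" using sum npos by (cases "size P") auto
  have vc: "vertex_cost (real n) P \<le> 24"
  proof -
    have "(real (count P 1))\<^sup>2 \<le> (sqrt (real n))\<^sup>2" using loops by (intro power_mono) auto
    then have "loop_cost (count P 1) \<le> real n" using npos by (simp add: loop_cost_def)
    then have "8 / real n * loop_cost (count P 1) \<le> 8 / real n * real n" by (intro mult_left_mono) auto
    then show ?thesis unfolding vertex_cost_def P(2) using zero npos by (simp add: not_in_iff)
  qed
  have pc: "progress_cost (real n) n (size P) \<le> 96 * ln (real n) / real n"
  proof -
    have "split_cost (size P) \<le> 6 * ln (real (size P))" by (rule split_cost_le_ln[OF size_pos])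
    also have "\<dots> \<le> 6 * ln (real n)" using size size_pos npos by simp
    finally have s: "split_cost (size P) \<le> 6 * ln (real n)" .
    have "progress_cost (real n) n (size P) = 2 * split_cost (size P) / (real n / 8)"
      using size unfolding progress_cost_def by simp
    also have "\<dots> \<le> 2 * (6 * ln (real n)) / (real n / 8)"
      using s npos by (intro divide_right_mono mult_left_mono) auto
    finally show ?thesis by simp
  qed
  have "\<bar>gluing_mean P (indicator A) - conditional_mean (ln (real n)) (even (n + size P)) (indicator A)\<bar>
      \<le> potential (real n) \<delta> ?\<eta> P"
    by (rule gluing_mean_close[OF n order_refl \<delta> one sum order_refl few test_function_indicator])
  also have "\<dots> \<le> \<delta> + ?\<eta> * 24 + 96 * ln (real n) / real n"
    unfolding potential_def P(2) k using n by (intro add_mono order_refl mult_left_mono vc pc) auto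
  finally show "\<bar>measure_pmf.prob (vertex_count_pmf P) A - measure_pmf.prob
      (cond_pmf (poisson_pmf (ln (real n))) {k. even k = even (n + size P)}) A\<bar>
      \<le> \<delta> + 96 / sqrt (ln (real n)) + 96 * ln (real n) / real n"
    using n by (simp add: prob_vertex_count_pmf[OF P(1)] prob_cond_poisson_pmf)
qed

theorem theorem3:
  fixes \<P> :: "nat \<Rightarrow> nat multiset"
  assumes "good_sequence \<P>"
  shows "(\<lambda>n. tv_dist (vertex_count_pmf (\<P> n))
                (if even (n + size (\<P> n)) then poisson_even_pmf (ln (real n))
                 else poisson_odd_pmf (ln (real n)))) \<longlonglongrightarrow> 0"
proof (rule tendstoI)
  fix \<epsilon> :: real assume \<epsilon>: "\<epsilon> > 0"
  have P: "\<And>n. n \<ge> 1 \<Longrightarrow> configuration (\<P> n) \<and> half_perimeter (\<P> n) = n"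
    and loops: "(\<lambda>n. real (count (\<P> n) 1) / sqrt (real n)) \<longlonglongrightarrow> 0"
    and bigons: "(\<lambda>n. real (count (\<P> n) 2) / real n) \<longlonglongrightarrow> 0"
    using assms unfolding good_sequence_def loops_def bigons_def by auto
  have "\<forall>\<^sub>F n in sequentially. real (count (\<P> n) 1) / sqrt (real n) < 1"
    by (rule order_tendstoD(2)[OF loops]) simp
  moreover have "\<forall>\<^sub>F n in sequentially. real (count (\<P> n) 2) / real n < 1 / 128"
    by (rule order_tendstoD(2)[OF bigons]) simp
  moreover have "\<forall>\<^sub>F n in sequentially. ln (real n) > 1" by real_asymp
  moreover have "\<forall>\<^sub>F n in sequentially. sqrt (real n) \<le> real n / 128" by real_asymp
  moreover have "\<forall>\<^sub>F n in sequentially. 96 / sqrt (ln (real n)) < \<epsilon> / 3"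
  proof (rule order_tendstoD(2))
    show "(\<lambda>n. 96 / sqrt (ln (real n))) \<longlonglongrightarrow> 0" by real_asymp
  qed (use \<epsilon> in simp)
  moreover have "\<forall>\<^sub>F n in sequentially. 96 * ln (real n) / real n < \<epsilon> / 3"
  proof (rule order_tendstoD(2))
    show "(\<lambda>n. 96 * ln (real n) / real n) \<longlonglongrightarrow> 0" by real_asymp
  qed (use \<epsilon> in simp)
  moreover have "\<forall>\<^sub>F n in sequentially. \<forall>m g. real n \<le> 8 * real m \<longrightarrow> m \<le> n \<longrightarrow> test_function g \<longrightarrow>
    \<bar>one_polygon_mean m g - conditional_mean (ln (real n)) (odd m) g\<bar> \<le> \<epsilon> / 3"
    by (rule one_polygon_limit) (use \<epsilon> in simp)
  ultimately show "\<forall>\<^sub>F n in sequentially. dist (tv_dist (vertex_count_pmf (\<P> n))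
                (if even (n + size (\<P> n)) then poisson_even_pmf (ln (real n))
                 else poisson_odd_pmf (ln (real n)))) 0 < \<epsilon>"
  proof eventually_elim
    case (elim n)
    \<comment> \<open>\<open>ln 0 = 0\<close> by convention, so \<open>ln n > 1\<close> excludes the
      index 0, where the sequence is not constrained.\<close>
    have n: "n \<ge> 1" using elim(3) by (cases n) auto
    have law: "(if even (n + size (\<P> n)) then poisson_even_pmf (ln (real n)) else poisson_odd_pmf (ln (real n))) =
       cond_pmf (poisson_pmf (ln (real n))) {k. even k = even (n + size (\<P> n))}"
      by (simp add: poisson_even_pmf_def poisson_odd_pmf_def)
    have "tv_dist (vertex_count_pmf (\<P> n)) (cond_pmf (poisson_pmf (ln (real n))) {k. even k = even (n + size (\<P> n))})
       \<le> \<epsilon> / 3 + 96 / sqrt (ln (real n)) + 96 * ln (real n) / real n"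
    proof (rule vertex_count_tv_dist)
      show "real (count (\<P> n) 1) \<le> sqrt (real n)" using elim(1) n by (simp add: divide_less_eq)
      show "real (count (\<P> n) 2) \<le> real n / 128" using elim(2) n by (simp add: divide_less_eq)
    qed (use P[OF n] elim \<epsilon> in auto)
    then show ?case unfolding law dist_real_def
      using elim(5,6) tv_dist_nonneg[of "vertex_count_pmf (\<P> n)"
        "cond_pmf (poisson_pmf (ln (real n))) {k. even k = even (n + size (\<P> n))}"] by linarith
  qed
qed

end
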